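(* Let $\phi\in\mathrm{tr}(C^k_{\mathrm{tr}}(\mathbb R^{*d}))_{\mathrm{sa}}$ for some $k\ge2$. Suppose that for some $K>0$, $\|\partial\nabla\phi-K\,\mathrm{Id}\|_{BC_{\mathrm{tr}}(\mathbb R^{*d},\mathscr M^1)^d}<K$. Then for every $\mu\in\Sigma_d$, $$d_{W,2}(\mu,(\nabla\phi)_*\mu)=\tilde\mu\bigl[\langle\nabla\phi-\mathrm{id},\nabla\phi-\mathrm{id}\rangle_{\mathrm{tr}}\bigr]^{1/2}.$$ In other words, if $\mathbf X$ is a self-adjoint $d$-tuple from $(\mathcal A,\tau)\in\mathbb W$, then $\mathbf X$ and $\nabla\phi^{\mathcal A,\tau}(\mathbf X)$ are an optimal coupling of $\lambda_{\mathbf X}$ and $(\nabla\phi)_*\lambda_{\mathbf X}$.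
   Context: Function spaces. A tracial $\mathrm W^*$-algebra $(\mathcal A,\tau)$ is a von Neumann algebra with a faithful normal tracial state. $\mathbb W$ is a set of representatives of the isomorphism classes of tracial $\mathrm W^*$-algebras with separable predual; families indexed by $\mathbb W$ are evaluated on any such algebra via isomorphism. For $\mathbf X\in\mathcal A^d$: $\|\mathbf X\|_\alpha=(\sum_j\tau((X_j^*X_j)^{\alpha/2}))^{1/\alpha}$ ($1\le\alpha<\infty$), $\|\mathbf X\|_\infty=\max_j\|X_j\|$, $\langle\mathbf X,\mathbf Y\rangle_\tau=\sum_j\tau(X_j^*Y_j)$. A trace polynomial is a linear combination of formal expressions $p_0\,\mathrm{tr}(p_1)\cdots\mathrm{tr}(p_n)$ with $p_i$ non-commutative polynomials in self-adjoint variables; it is evaluated in $(\mathcal A,\tau)$ by replacing $\mathrm{tr}$ by $\tau$. For a complex-multilinear $\Lambda:\mathcal A^{d_1}\times\dots\times\mathcal A^{d_\ell}\to\mathcal A^{d'}$, $\|\Lambda\|_{\mathscr M^\ell,\mathrm{tr}}$ is the supremum of $\|\Lambda[\mathbf Y_1,\dots,\mathbf Y_\ell]\|_\alpha$ over $\alpha,\alpha_j\in[1,\infty]$ with $1/\alpha=\sum_j1/\alpha_j$ and $\|\mathbf Y_j\|_{\alpha_j}\le1$ (for $\ell=0$: $\|\Lambda\|_\infty$); real-multilinear maps on self-adjoint tuples are extended complex-multilinearly. $C_{\mathrm{tr}}(\mathbb R^{*d},\mathscr M(\mathbb R^{*d_1},\dots,\mathbb R^{*d_\ell}))^{d'}$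 is the set of families $\mathbf f=(\mathbf f^{\mathcal A,\tau})_{(\mathcal A,\tau)\in\mathbb W}$ of maps $\mathcal A_{\mathrm{sa}}^d\times\mathcal A_{\mathrm{sa}}^{d_1}\times\dots\times\mathcal A_{\mathrm{sa}}^{d_\ell}\to\mathcal A^{d'}$, real-multilinear in the last $\ell$ arguments, such that for all $R,\epsilon>0$ there is a $d'$-tuple $\mathbf g$ of trace polynomials, multilinear in the last $\ell$ variables, with $\|\mathbf f-\mathbf g\|_R<\epsilon$, where $\|\mathbf f\|_R=\sup_{(\mathcal A,\tau)}\sup_{\|\mathbf X\|_\infty\le R}\|\mathbf f^{\mathcal A,\tau}(\mathbf X)\|_{\mathscr M^\ell,\mathrm{tr}}$. $C^k_{\mathrm{tr}}$: those $\mathbf f$ whose iterated directional derivatives in $\mathbf X$ of each order $j\le k$ exist and are given by some $\partial^j\mathbf f\in C_{\mathrm{tr}}(\mathbb R^{*d},\mathscr M(\mathbb R^{*d_1},\dots,\mathbb R^{*d_\ell},\mathbb R^{*d},\dots,\mathbb R^{*d}))^{d'}$. $\|\mathbf f\|_{BC_{\mathrm{tr}}(\mathbb R^{*d},\mathscr M^\ell)^{d'}}=\sup_R\|\mathbf f\|_R$. Subscript $\mathrm{sa}$: self-adjoint-valued; $\mathrm{tr}(C^k_{\mathrm{tr}}(\mathbb R^{*d}))$: scalar-valued functions. $\mathrm{id}(\mathbf X)=\mathbf X$, $\mathrm{Id}(\mathbf X)[\mathbf Y]=\mathbf Y$; $\langle\mathbf f,\mathbf g\rangle_{\mathrm{tr}}$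 is $\mathbf X\mapsto\langle\mathbf f(\mathbf X),\mathbf g(\mathbf X)\rangle_\tau$. For scalar-valued $f\in C^1_{\mathrm{tr}}$, $\nabla f\in C_{\mathrm{tr}}(\mathbb R^{*d})^d$ is characterized by $\partial f(\mathbf X)[\mathbf Y]=\langle\mathbf Y,\nabla f(\mathbf X)\rangle_\tau$ for $\mathbf Y\in\mathcal A_{\mathrm{sa}}^d$. Laws and coupling distance. $\lambda_{\mathbf X}$ is the non-commutative law $p\mapsto\tau(p(\mathbf X))$ on $\mathbb C\langle x_1,\dots,x_d\rangle$ of a self-adjoint $d$-tuple $\mathbf X$ in $(\mathcal A,\tau)$; $\Sigma_d$ is the set of all such laws. For $\mu=\lambda_{\mathbf X}$: $\tilde\mu(f)=f^{\mathcal A,\tau}(\mathbf X)$ for $f\in\mathrm{tr}(C_{\mathrm{tr}}(\mathbb R^{*d}))$, and $\mathbf f_*\mu=\lambda_{\mathbf f^{\mathcal A,\tau}(\mathbf X)}$ for $\mathbf f\in C_{\mathrm{tr}}(\mathbb R^{*d})^d_{\mathrm{sa}}$ (both depend only on $\mu$). $d_{W,2}(\mu,\nu)=\inf\{\|\mathbf X-\mathbf Y\|_2:(\mathcal A,\tau)\in\mathbb W,\ \mathbf X,\mathbf Y\in\mathcal A_{\mathrm{sa}}^d,\ \lambda_{\mathbf X}=\mu,\ \lambda_{\mathbf Y}=\nu\}$; a pair $\mathbf X,\mathbf Y$ achieving the infimum is an optimal coupling. *)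

theory Defs
  imports "HOL-Analysis.Analysis" "HOL-Library.Poly_Mapping"
begin

section \<open>The complex Hilbert space of square-summable sequences\<close>

typedef ell2 = "{x :: nat \<Rightarrow> complex. summable (\<lambda>n. (cmod (x n))\<^sup>2)}"
  morphisms ell2_nth Abs_ell2
  by (rule exI[of _ "\<lambda>_. 0"]) simp

setup_lifting type_definition_ell2

lemma summable_ell2_mult:
  fixes x y :: "nat \<Rightarrow> complex"
  assumes "summable (\<lambda>n. (cmod (x n))\<^sup>2)" "summable (\<lambda>n. (cmod (y n))\<^sup>2)"
  shows "summable (\<lambda>n. cnj (x n) * y n)"
proof (rule summable_comparison_test')
  show "summable (\<lambda>n. (cmod (x n))\<^sup>2 + (cmod (y n))\<^sup>2)"
    by (intro summable_add assms)
  show "norm (cnj (x n) * y n) \<le> (cmod (x n))\<^sup>2 + (cmod (y n))\<^sup>2" for n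
  proof -
    have "2 * (cmod (x n) * cmod (y n)) \<le> (cmod (x n))\<^sup>2 + (cmod (y n))\<^sup>2"
      using sum_squares_bound[of "cmod (x n)" "cmod (y n)"] by simp
    moreover have "0 \<le> cmod (x n) * cmod (y n)" by simp
    ultimately show ?thesis unfolding norm_mult complex_mod_cnj by linarith
  qed
qed

lemma summable_ell2_add:
  fixes x y :: "nat \<Rightarrow> complex"
  assumes "summable (\<lambda>n. (cmod (x n))\<^sup>2)" "summable (\<lambda>n. (cmod (y n))\<^sup>2)"
  shows "summable (\<lambda>n. (cmod (x n + y n))\<^sup>2)"
proof (rule summable_comparison_test')
  show "summable (\<lambda>n. 2 * ((cmod (x n))\<^sup>2 + (cmod (y n))\<^sup>2))"
    by (intro summable_add summable_mult assms)
  show "norm ((cmod (x n + y n))\<^sup>2) \<le> 2 * ((cmod (x n))\<^sup>2 + (cmod (y n))\<^sup>2)" for n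
  proof -
    have "(cmod (x n + y n))\<^sup>2 \<le> (cmod (x n) + cmod (y n))\<^sup>2"
      by (intro power_mono norm_triangle_ineq) simp
    also have "\<dots> \<le> 2 * ((cmod (x n))\<^sup>2 + (cmod (y n))\<^sup>2)"
      using sum_squares_bound[of "cmod (x n)" "cmod (y n)"] by (simp add: power2_sum)
    finally show ?thesis by simp
  qed
qed

lift_definition ell2_scaleC :: "complex \<Rightarrow> ell2 \<Rightarrow> ell2" is "\<lambda>c x n. c * x n"
  by (simp add: norm_mult power_mult_distrib summable_mult)

definition cinner :: "ell2 \<Rightarrow> ell2 \<Rightarrow> complex" where
  "cinner x y = suminf (\<lambda>n. cnj (ell2_nth x n) * ell2_nth y n)"

lemma summable_cinner: "summable (\<lambda>n. cnj (ell2_nth x n) * ell2_nth y n)"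
  using ell2_nth[of x] ell2_nth[of y] by (intro summable_ell2_mult) auto

instantiation ell2 :: real_inner
begin

lift_definition zero_ell2 :: ell2 is "\<lambda>_. 0" by simp
lift_definition uminus_ell2 :: "ell2 \<Rightarrow> ell2" is "\<lambda>x n. - x n" by simp
lift_definition plus_ell2 :: "ell2 \<Rightarrow> ell2 \<Rightarrow> ell2" is "\<lambda>x y n. x n + y n"
  by (rule summable_ell2_add)
lift_definition minus_ell2 :: "ell2 \<Rightarrow> ell2 \<Rightarrow> ell2" is "\<lambda>x y n. x n - y n"
proof -
  fix x y :: "nat \<Rightarrow> complex"
  assume "summable (\<lambda>n. (cmod (x n))\<^sup>2)" "summable (\<lambda>n. (cmod (y n))\<^sup>2)"
  then show "summable (\<lambda>n. (cmod (x n - y n))\<^sup>2)"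
    using summable_ell2_add[of x "\<lambda>n. - y n"] by simp
qed
definition scaleR_ell2 :: "real \<Rightarrow> ell2 \<Rightarrow> ell2" where
  "scaleR_ell2 r = ell2_scaleC (complex_of_real r)"
definition inner_ell2 :: "ell2 \<Rightarrow> ell2 \<Rightarrow> real" where
  "inner_ell2 x y = Re (cinner x y)"
definition norm_ell2 :: "ell2 \<Rightarrow> real" where
  "norm_ell2 x = sqrt (inner x x)"
definition dist_ell2 :: "ell2 \<Rightarrow> ell2 \<Rightarrow> real" where
  "dist_ell2 x y = norm (x - y)"
definition sgn_ell2 :: "ell2 \<Rightarrow> ell2" where
  "sgn_ell2 x = inverse (norm x) *\<^sub>R x"
definition uniformity_ell2 :: "(ell2 \<times> ell2) filter" where
  "uniformity_ell2 = (INF e\<in>{0 <..}. principal {(x, y :: ell2). dist x y < e})"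
definition open_ell2 :: "ell2 set \<Rightarrow> bool" where
  "open_ell2 U \<longleftrightarrow> (\<forall>x\<in>U. eventually (\<lambda>(x', y). x' = x \<longrightarrow> y \<in> U) uniformity)"

instance
proof
  fix x y z :: ell2 and a b r :: real and U :: "ell2 set"
  show "x + y + z = x + (y + z)" by transfer (simp add: add.assoc)
  show "x + y = y + x" by transfer (simp add: add.commute)
  show "0 + x = x" by transfer simp
  show "- x + x = 0" by transfer simp
  show "x - y = x + - y" by transfer simp
  show "a *\<^sub>R (x + y) = a *\<^sub>R x + a *\<^sub>R y"
    unfolding scaleR_ell2_def by transfer (simp add: distrib_left)
  show "(a + b) *\<^sub>R x = a *\<^sub>R x + b *\<^sub>R x"
    unfolding scaleR_ell2_def by transfer (simp add: distrib_right)
  show "a *\<^sub>R b *\<^sub>R x = (a * b) *\<^sub>R x"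
    unfolding scaleR_ell2_def by transfer (simp add: mult.assoc)
  show "1 *\<^sub>R x = x" unfolding scaleR_ell2_def by transfer simp
  show "dist x y = norm (x - y)" by (rule dist_ell2_def)
  show "sgn x = inverse (norm x) *\<^sub>R x" by (rule sgn_ell2_def)
  show "uniformity = (INF e\<in>{0 <..}. principal {(x, y :: ell2). dist x y < e})"
    by (rule uniformity_ell2_def)
  show "open U \<longleftrightarrow> (\<forall>x\<in>U. eventually (\<lambda>(x', y). x' = x \<longrightarrow> y \<in> U) uniformity)"
    by (rule open_ell2_def)
  have inner: "inner u v = suminf (\<lambda>n. Re (cnj (ell2_nth u n) * ell2_nth v n))" for u v
    unfolding inner_ell2_def cinner_def by (rule Re_suminf[OF summable_cinner])
  have sm: "summable (\<lambda>n. Re (cnj (ell2_nth u n) * ell2_nth v n))" for u v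
    by (rule summable_Re[OF summable_cinner])
  show "inner x y = inner y x"
    unfolding inner by (simp add: mult.commute)
  have "inner (x + y) z = suminf (\<lambda>n. Re (cnj (ell2_nth x n) * ell2_nth z n)
      + Re (cnj (ell2_nth y n) * ell2_nth z n))"
    unfolding inner by (simp add: plus_ell2.rep_eq algebra_simps)
  also have "\<dots> = inner x z + inner y z"
    unfolding inner by (rule suminf_add[OF sm sm, symmetric])
  finally show "inner (x + y) z = inner x z + inner y z" .
  have "inner (r *\<^sub>R x) y = suminf (\<lambda>n. r * Re (cnj (ell2_nth x n) * ell2_nth y n))"
    unfolding inner scaleR_ell2_def by (simp add: ell2_scaleC.rep_eq algebra_simps)
  also have "\<dots> = r * inner x y"
    unfolding inner by (rule suminf_mult[OF sm])
  finally show "inner (r *\<^sub>R x) y = r * inner x y" .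
  have xx: "Re (cnj (ell2_nth x n) * ell2_nth x n) = (cmod (ell2_nth x n))\<^sup>2" for n
    unfolding cmod_power2 by (simp add: power2_eq_square)
  have sx: "summable (\<lambda>n. (cmod (ell2_nth x n))\<^sup>2)"
    using ell2_nth[of x] by simp
  show "0 \<le> inner x x"
    unfolding inner xx by (intro suminf_nonneg sx) simp
  have "inner x x = 0 \<longleftrightarrow> (\<forall>n. ell2_nth x n = 0)"
    unfolding inner xx by (subst suminf_eq_zero_iff[OF sx]) auto
  also have "\<dots> \<longleftrightarrow> x = 0" by transfer auto
  finally show "inner x x = 0 \<longleftrightarrow> x = 0" .
  show "norm x = sqrt (inner x x)" by (rule norm_ell2_def)
qed

end

lemma bounded_linear_ell2_scaleC: "bounded_linear (ell2_scaleC c)"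
proof (rule bounded_linear_intro)
  fix x y :: ell2 and r :: real
  show "ell2_scaleC c (x + y) = ell2_scaleC c x + ell2_scaleC c y"
    by transfer (simp add: distrib_left)
  show "ell2_scaleC c (r *\<^sub>R x) = r *\<^sub>R ell2_scaleC c x"
    unfolding scaleR_ell2_def by transfer (simp add: mult.left_commute)
  have sx: "summable (\<lambda>n. (cmod (ell2_nth x n))\<^sup>2)"
    using ell2_nth[of x] by simp
  have nrm: "norm u = sqrt (suminf (\<lambda>n. (cmod (ell2_nth u n))\<^sup>2))" for u
  proof -
    have "Re (cinner u u) = suminf (\<lambda>n. Re (cnj (ell2_nth u n) * ell2_nth u n))"
      unfolding cinner_def by (rule Re_suminf[OF summable_cinner])
    then show ?thesis
      unfolding norm_ell2_def inner_ell2_def cmod_power2 by (simp add: power2_eq_square)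
  qed
  have "suminf (\<lambda>n. (cmod (ell2_nth (ell2_scaleC c x) n))\<^sup>2)
      = (cmod c)\<^sup>2 * suminf (\<lambda>n. (cmod (ell2_nth x n))\<^sup>2)"
    by (simp add: ell2_scaleC.rep_eq norm_mult power_mult_distrib suminf_mult[OF sx])
  then show "norm (ell2_scaleC c x) \<le> norm x * cmod c"
    unfolding nrm by (simp add: real_sqrt_mult)
qed

section \<open>Bounded operators\<close>

text \<open>
  The library's bounded linear maps are real-linear. The complex-linear ones are those
  in \<open>clin_ops\<close>; on them complex scalars act through \<open>iop\<close>, multiplication by the
  imaginary unit.
\<close>

type_synonym bop = "ell2 \<Rightarrow>\<^sub>L ell2"

lift_definition iop :: bop is "ell2_scaleC \<i>"
  by (rule bounded_linear_ell2_scaleC)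

definition clin_ops :: "bop set" where
  "clin_ops = {T. T o\<^sub>L iop = iop o\<^sub>L T}"

definition scaleC_op :: "complex \<Rightarrow> bop \<Rightarrow> bop" where
  "scaleC_op c T = Re c *\<^sub>R T + Im c *\<^sub>R (iop o\<^sub>L T)"

definition adj :: "bop \<Rightarrow> bop" where
  "adj T = (THE S. \<forall>x y. cinner (blinfun_apply S x) y = cinner x (blinfun_apply T y))"

definition op_le :: "bop \<Rightarrow> bop \<Rightarrow> bool" where
  "op_le S T \<longleftrightarrow> (\<forall>x. 0 \<le> inner x (blinfun_apply (T - S) x))"

definition commutant :: "bop set \<Rightarrow> bop set" where
  "commutant A = {T \<in> clin_ops. \<forall>S\<in>A. S o\<^sub>L T = T o\<^sub>L S}"

definition von_neumann_algebra :: "bop set \<Rightarrow> bool" where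
  "von_neumann_algebra A \<longleftrightarrow> (\<forall>T\<in>A. adj T \<in> A) \<and> commutant (commutant A) = A"

definition sa :: "bop set \<Rightarrow> bop set" where
  "sa A = {T \<in> A. adj T = T}"

subsection \<open>Continuous functional calculus for positive operators\<close>

definition op_poly :: "real poly \<Rightarrow> bop \<Rightarrow> bop" where
  "op_poly p T = (\<Sum>i\<le>degree p. coeff p i *\<^sub>R (((\<lambda>S. T o\<^sub>L S) ^^ i) id_blinfun))"

text \<open>
  For positive \<open>T\<close> the spectrum lies in \<open>{0..norm T}\<close>, and \<open>f(T)\<close> is the norm limit of
  \<open>p\<^sub>n(T)\<close> for any polynomials \<open>p\<^sub>n\<close> converging to the continuous function \<open>f\<close> uniformly on
  that interval.
\<close>

definition op_calc :: "(real \<Rightarrow> real) \<Rightarrow> bop \<Rightarrow> bop" where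
  "op_calc f T = (THE S. \<forall>p. uniform_limit {0..norm T} (\<lambda>n. poly (p n)) f sequentially
     \<longrightarrow> (\<lambda>n. op_poly (p n) T) \<longlonglongrightarrow> S)"

definition op_powr :: "bop \<Rightarrow> real \<Rightarrow> bop" where
  "op_powr T s = op_calc (\<lambda>x. x powr s) T"

section \<open>Tracial von Neumann algebras\<close>

text \<open>
  A pair \<open>(A, \<tau>)\<close>; only the values of \<open>\<tau>\<close> on \<open>A\<close> matter. A von Neumann algebra has
  separable predual iff it acts faithfully and normally on a separable Hilbert space, which,
  after amplification, may be taken to be \<open>ell2\<close>. So up to isomorphism the pairs below are
  exactly the tracial von Neumann algebras with separable predual.
\<close>

type_synonym tracial = "bop set \<times> (bop \<Rightarrow> complex)"

text \<open>Normality of a positive functional: suprema of bounded increasing nets are preserved.\<close>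

definition normal_functional :: "bop set \<Rightarrow> (bop \<Rightarrow> complex) \<Rightarrow> bool" where
  "normal_functional A \<tau> \<longleftrightarrow>
     (\<forall>D T. D \<subseteq> sa A \<longrightarrow> D \<noteq> {}
        \<longrightarrow> (\<forall>S\<in>D. \<forall>S'\<in>D. \<exists>U\<in>D. op_le S U \<and> op_le S' U)
        \<longrightarrow> T \<in> sa A \<longrightarrow> (\<forall>S\<in>D. op_le S T)
        \<longrightarrow> (\<forall>U\<in>sa A. (\<forall>S\<in>D. op_le S U) \<longrightarrow> op_le T U)
        \<longrightarrow> Re (\<tau> T) = (SUP S\<in>D. Re (\<tau> S)))"

definition faithful_normal_tracial_state :: "bop set \<Rightarrow> (bop \<Rightarrow> complex) \<Rightarrow> bool" where
  "faithful_normal_tracial_state A \<tau> \<longleftrightarrow>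
     (\<forall>S\<in>A. \<forall>T\<in>A. \<tau> (S + T) = \<tau> S + \<tau> T) \<and>
     (\<forall>c. \<forall>T\<in>A. \<tau> (scaleC_op c T) = c * \<tau> T) \<and>
     \<tau> id_blinfun = 1 \<and>
     (\<forall>T\<in>A. Im (\<tau> (adj T o\<^sub>L T)) = 0 \<and> 0 \<le> Re (\<tau> (adj T o\<^sub>L T))) \<and>
     (\<forall>T\<in>A. \<tau> (adj T o\<^sub>L T) = 0 \<longrightarrow> T = 0) \<and>
     (\<forall>S\<in>A. \<forall>T\<in>A. \<tau> (S o\<^sub>L T) = \<tau> (T o\<^sub>L S)) \<and>
     normal_functional A \<tau>"

definition tracial_Wstar :: "tracial \<Rightarrow> bool" where
  "tracial_Wstar M \<longleftrightarrow>
     von_neumann_algebra (fst M) \<and> faithful_normal_tracial_state (fst M) (snd M)"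

definition tracial_iso :: "tracial \<Rightarrow> tracial \<Rightarrow> bool" where
  "tracial_iso M N \<longleftrightarrow> (\<exists>\<pi>. bij_betw \<pi> (fst M) (fst N) \<and>
     (\<forall>S\<in>fst M. \<forall>T\<in>fst M. \<pi> (S + T) = \<pi> S + \<pi> T) \<and>
     (\<forall>c. \<forall>T\<in>fst M. \<pi> (scaleC_op c T) = scaleC_op c (\<pi> T)) \<and>
     (\<forall>S\<in>fst M. \<forall>T\<in>fst M. \<pi> (S o\<^sub>L T) = \<pi> S o\<^sub>L \<pi> T) \<and>
     (\<forall>T\<in>fst M. \<pi> (adj T) = adj (\<pi> T)) \<and>
     (\<forall>T\<in>fst M. snd N (\<pi> T) = snd M T))"

definition representatives :: "tracial set \<Rightarrow> bool" where
  "representatives W \<longleftrightarrow> (\<forall>M\<in>W. tracial_Wstar M) \<and>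
     (\<forall>M. tracial_Wstar M \<longrightarrow> (\<exists>!N. N \<in> W \<and> tracial_iso M N))"

definition tuples :: "tracial \<Rightarrow> (bop ^ 'n::finite) set" where
  "tuples M = {X. \<forall>j. X $ j \<in> fst M}"

definition sa_tuples :: "tracial \<Rightarrow> (bop ^ 'n::finite) set" where
  "sa_tuples M = {X. \<forall>j. X $ j \<in> sa (fst M)}"

definition Lp_norm :: "tracial \<Rightarrow> ennreal \<Rightarrow> bop ^ 'n::finite \<Rightarrow> real" where
  "Lp_norm M \<alpha> X =
     (if \<alpha> = \<infinity> then Max (range (\<lambda>j. norm (X $ j)))
      else (\<Sum>j\<in>UNIV. Re (snd M (op_powr (adj (X $ j) o\<^sub>L X $ j) (enn2real \<alpha> / 2))))
             powr (1 / enn2real \<alpha>))"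

definition tr_inner :: "tracial \<Rightarrow> bop ^ 'n::finite \<Rightarrow> bop ^ 'n \<Rightarrow> complex" where
  "tr_inner M X Y = (\<Sum>j\<in>UNIV. snd M (adj (X $ j) o\<^sub>L Y $ j))"

section \<open>Trace polynomials\<close>

text \<open>
  Letters \<open>XV i\<close> stand for the coordinates of \<open>X\<close>, letters \<open>YV j i\<close> for those of the
  \<open>j\<close>-th multilinear argument.  Expanding the \<open>p\<^sub>i\<close> into words, a trace polynomial is a
  finite linear combination of expressions \<open>w\<^sub>0 tr(w\<^sub>1) \<dots> tr(w\<^sub>n)\<close>, encoded as \<open>(w\<^sub>0, [w\<^sub>1, \<dots>, w\<^sub>n])\<close>.
\<close>

datatype 'n letter = XV 'n | YV nat 'n

type_synonym 'n trace_poly = "('n letter list \<times> 'n letter list list) \<Rightarrow>\<^sub>0 complex"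

definition word_eval :: "('v \<Rightarrow> bop) \<Rightarrow> 'v list \<Rightarrow> bop" where
  "word_eval \<rho> w = foldr (\<lambda>v S. \<rho> v o\<^sub>L S) w id_blinfun"

fun letter_eval :: "bop ^ 'n::finite \<Rightarrow> (bop ^ 'n) list \<Rightarrow> 'n letter \<Rightarrow> bop" where
  "letter_eval X Ys (XV i) = X $ i"
| "letter_eval X Ys (YV j i) = (Ys ! j) $ i"

definition tp_eval ::
  "'n::finite trace_poly \<Rightarrow> tracial \<Rightarrow> bop ^ 'n \<Rightarrow> (bop ^ 'n) list \<Rightarrow> bop" where
  "tp_eval p M X Ys = (\<Sum>m\<in>Poly_Mapping.keys p.
     scaleC_op (Poly_Mapping.lookup p m
         * prod_list (map (\<lambda>w. snd M (word_eval (letter_eval X Ys) w)) (snd m)))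
       (word_eval (letter_eval X Ys) (fst m)))"

text \<open>
  A trace polynomial is multilinear in its last \<open>l\<close> arguments iff every expression in it
  contains exactly one letter from each of them.
\<close>

fun letter_of_arg :: "nat \<Rightarrow> 'n letter \<Rightarrow> bool" where
  "letter_of_arg j (XV i) = False"
| "letter_of_arg j (YV j' i) = (j = j')"

definition tp_multilinear :: "nat \<Rightarrow> 'n trace_poly \<Rightarrow> bool" where
  "tp_multilinear l p \<longleftrightarrow> (\<forall>m\<in>Poly_Mapping.keys p. \<forall>j.
     length (filter (letter_of_arg j) (concat (fst m # snd m))) = (if j < l then 1 else 0))"

section \<open>The function spaces\<close>

text \<open>
  All arguments are \<open>d\<close>-tuples, \<open>d = CARD('n)\<close>, and values are \<open>d'\<close>-tuples, \<open>d' = CARD('m)\<close>.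
  The \<open>l\<close> multilinear arguments are passed as a list of length \<open>l\<close>.
\<close>

type_synonym ('n, 'm) family = "tracial \<Rightarrow> bop ^ 'n \<Rightarrow> (bop ^ 'n) list \<Rightarrow> bop ^ 'm"

definition re_part :: "bop ^ 'n \<Rightarrow> bop ^ 'n" where
  "re_part Y = (\<chi> i. (1/2) *\<^sub>R (Y $ i + adj (Y $ i)))"

definition im_part :: "bop ^ 'n \<Rightarrow> bop ^ 'n" where
  "im_part Y = (\<chi> i. scaleC_op (1 / (2 * \<i>)) (Y $ i - adj (Y $ i)))"

text \<open>
  Complex-multilinear extension of a real-multilinear map on self-adjoint tuples: substitute
  \<open>Y\<^sub>j = re_part Y\<^sub>j + \<i> im_part Y\<^sub>j\<close> and expand.
\<close>

definition complex_ext ::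
  "nat \<Rightarrow> ((bop ^ 'n) list \<Rightarrow> bop ^ 'm) \<Rightarrow> (bop ^ 'n) list \<Rightarrow> bop ^ 'm" where
  "complex_ext l \<Lambda> Ys = (\<Sum>S\<in>Pow {..<l}. \<chi> i. scaleC_op (\<i> ^ card S)
     (\<Lambda> (map (\<lambda>j. if j \<in> S then im_part (Ys ! j) else re_part (Ys ! j)) [0..<l]) $ i))"

definition multi_norm ::
  "tracial \<Rightarrow> nat \<Rightarrow> ((bop ^ 'n::finite) list \<Rightarrow> bop ^ 'm::finite) \<Rightarrow> ennreal" where
  "multi_norm M l \<Lambda> = Sup {ennreal (Lp_norm M \<alpha> (complex_ext l \<Lambda> Ys)) | \<alpha> \<alpha>s Ys.
     1 \<le> \<alpha> \<and> length \<alpha>s = l \<and> (\<forall>a\<in>set \<alpha>s. 1 \<le> a) \<and>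
     inverse \<alpha> = (\<Sum>j<l. inverse (\<alpha>s ! j)) \<and>
     length Ys = l \<and> set Ys \<subseteq> tuples M \<and> (\<forall>j<l. Lp_norm M (\<alpha>s ! j) (Ys ! j) \<le> 1)}"

definition fam_norm ::
  "tracial set \<Rightarrow> nat \<Rightarrow> real \<Rightarrow> ('n::finite, 'm::finite) family \<Rightarrow> ennreal" where
  "fam_norm W l R f = (SUP M\<in>W. SUP X\<in>{X \<in> sa_tuples M. Lp_norm M \<infinity> X \<le> R}.
     multi_norm M l (f M X))"

definition BC_norm :: "tracial set \<Rightarrow> nat \<Rightarrow> ('n::finite, 'm::finite) family \<Rightarrow> ennreal" where
  "BC_norm W l f = (SUP R\<in>{0<..}. fam_norm W l R f)"

definition real_multilinear ::
  "tracial \<Rightarrow> nat \<Rightarrow> ((bop ^ 'n::finite) list \<Rightarrow> bop ^ 'm::finite) \<Rightarrow> bool" where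
  "real_multilinear M l \<Lambda> \<longleftrightarrow>
     (\<forall>Ys U V a b j. length Ys = l \<longrightarrow> set Ys \<subseteq> sa_tuples M \<longrightarrow> U \<in> sa_tuples M
        \<longrightarrow> V \<in> sa_tuples M \<longrightarrow> j < l
        \<longrightarrow> \<Lambda> (Ys[j := a *\<^sub>R U + b *\<^sub>R V]) = a *\<^sub>R \<Lambda> (Ys[j := U]) + b *\<^sub>R \<Lambda> (Ys[j := V]))"

definition C_tr :: "tracial set \<Rightarrow> nat \<Rightarrow> ('n::finite, 'm::finite) family set" where
  "C_tr W l = {f.
     (\<forall>M\<in>W. \<forall>X\<in>sa_tuples M. real_multilinear M l (f M X) \<and>
        (\<forall>Ys. length Ys = l \<longrightarrow> set Ys \<subseteq> sa_tuples M \<longrightarrow> f M X Ys \<in> tuples M)) \<and>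
     (\<forall>R>0. \<forall>\<epsilon>>0. \<exists>g :: 'm \<Rightarrow> 'n trace_poly. (\<forall>i. tp_multilinear l (g i)) \<and>
        fam_norm W l R (\<lambda>M X Ys. f M X Ys - (\<chi> i. tp_eval (g i) M X Ys)) < ennreal \<epsilon>)}"

text \<open>Two-sided directional derivative, in the (operator) norm topology.\<close>

definition has_dir_deriv ::
  "('a::real_vector \<Rightarrow> 'b::real_normed_vector) \<Rightarrow> 'a \<Rightarrow> 'a \<Rightarrow> 'b \<Rightarrow> bool" where
  "has_dir_deriv F X Y L \<longleftrightarrow> ((\<lambda>t::real. (F (X + t *\<^sub>R Y) - F X) /\<^sub>R t) \<longlongrightarrow> L) (at 0)"

definition dir_deriv ::
  "('a::real_vector \<Rightarrow> 'b::real_normed_vector) \<Rightarrow> 'a \<Rightarrow> 'a \<Rightarrow> 'b" where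
  "dir_deriv F X Y = (THE L. has_dir_deriv F X Y L)"

text \<open>
  \<open>F j\<close> is the \<open>j\<close>-th iterated directional derivative of \<open>f\<close>; each differentiation in \<open>X\<close>
  appends its direction to the list of multilinear arguments.
\<close>

definition Ck_tr :: "tracial set \<Rightarrow> nat \<Rightarrow> nat \<Rightarrow> ('n::finite, 'm::finite) family set" where
  "Ck_tr W k l = {f. \<exists>F. F 0 = f \<and> (\<forall>j\<le>k. F j \<in> C_tr W (l + j)) \<and>
     (\<forall>j<k. \<forall>M\<in>W. \<forall>X\<in>sa_tuples M. \<forall>Ys. \<forall>Y\<in>sa_tuples M.
        length Ys = l + j \<longrightarrow> set Ys \<subseteq> sa_tuples M
        \<longrightarrow> has_dir_deriv (\<lambda>X. F j M X Ys) X Y (F (Suc j) M X (Ys @ [Y])))}"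

text \<open>Scalar-valued functions are complex-valued, with \<open>c\<close> identified with \<open>c 1\<close> in \<open>A\<close>.\<close>

type_synonym 'n scalar_family = "tracial \<Rightarrow> bop ^ 'n \<Rightarrow> complex"

definition scalar_embed :: "'n::finite scalar_family \<Rightarrow> ('n, 1) family" where
  "scalar_embed \<phi> = (\<lambda>M X Ys. \<chi> i. scaleC_op (\<phi> M X) id_blinfun)"

definition tr_Ck_sa :: "tracial set \<Rightarrow> nat \<Rightarrow> 'n::finite scalar_family set" where
  "tr_Ck_sa W k = {\<phi>. scalar_embed \<phi> \<in> Ck_tr W k 0 \<and>
     (\<forall>M\<in>W. \<forall>X\<in>sa_tuples M. \<phi> M X \<in> \<real>)}"

type_synonym 'n vector_family = "tracial \<Rightarrow> bop ^ 'n \<Rightarrow> bop ^ 'n"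

definition nabla :: "'n::finite scalar_family \<Rightarrow> 'n vector_family" where
  "nabla \<phi> M X = (THE G. G \<in> tuples M \<and>
     (\<forall>Y\<in>sa_tuples M. has_dir_deriv (\<phi> M) X Y (tr_inner M Y G)))"

section \<open>Laws and couplings\<close>

type_synonym 'n nc_poly = "'n list \<Rightarrow>\<^sub>0 complex"

definition ncp_eval :: "'n nc_poly \<Rightarrow> bop ^ 'n \<Rightarrow> bop" where
  "ncp_eval p X = (\<Sum>w\<in>Poly_Mapping.keys p.
     scaleC_op (Poly_Mapping.lookup p w) (word_eval (\<lambda>i. X $ i) w))"

type_synonym 'n nc_law = "'n nc_poly \<Rightarrow> complex"

definition nc_law :: "tracial \<Rightarrow> bop ^ 'n \<Rightarrow> 'n nc_law" where
  "nc_law M X = (\<lambda>p. snd M (ncp_eval p X))"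

definition nc_laws :: "tracial set \<Rightarrow> 'n::finite nc_law set" where
  "nc_laws W = {nc_law M X | M X. M \<in> W \<and> X \<in> sa_tuples M}"

definition law_eval :: "tracial set \<Rightarrow> 'n::finite nc_law \<Rightarrow> 'n scalar_family \<Rightarrow> complex" where
  "law_eval W \<mu> f = (THE c. \<exists>M\<in>W. \<exists>X\<in>sa_tuples M. nc_law M X = \<mu> \<and> c = f M X)"

definition push_law :: "tracial set \<Rightarrow> 'n::finite vector_family \<Rightarrow> 'n nc_law \<Rightarrow> 'n nc_law" where
  "push_law W f \<mu> = (THE \<nu>. \<exists>M\<in>W. \<exists>X\<in>sa_tuples M. nc_law M X = \<mu> \<and> \<nu> = nc_law M (f M X))"

definition d_W2 :: "tracial set \<Rightarrow> 'n::finite nc_law \<Rightarrow> 'n nc_law \<Rightarrow> real" where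
  "d_W2 W \<mu> \<nu> = Inf {Lp_norm M 2 (X - Y) | M X Y. M \<in> W \<and>
     X \<in> sa_tuples M \<and> Y \<in> sa_tuples M \<and> nc_law M X = \<mu> \<and> nc_law M Y = \<nu>}"

definition optimal_coupling ::
  "tracial set \<Rightarrow> tracial \<Rightarrow> bop ^ 'n::finite \<Rightarrow> bop ^ 'n \<Rightarrow> 'n nc_law \<Rightarrow> 'n nc_law \<Rightarrow> bool" where
  "optimal_coupling W M X Y \<mu> \<nu> \<longleftrightarrow> M \<in> W \<and> X \<in> sa_tuples M \<and> Y \<in> sa_tuples M \<and>
     nc_law M X = \<mu> \<and> nc_law M Y = \<nu> \<and> Lp_norm M 2 (X - Y) = d_W2 W \<mu> \<nu>"

end

theory Submission
  imports Defs "HOL-Computational_Algebra.Fundamental_Theorem_Algebra"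
begin

text \<open>
  The hypothesis makes \<open>\<phi>\<close> convex and \<open>U \<mapsto> U - \<nabla>\<phi>(U) / K\<close> a strict contraction for the \<open>L\<^sup>2\<close> norm. Let
  \<open>Z = \<nabla>\<phi>(X)\<close>, and let \<open>X'\<close>, \<open>Y'\<close> in another algebra have the laws of \<open>X\<close> and \<open>Z\<close>. If \<open>Y'\<close> were the gradient at
  some \<open>X''\<close> with the law of \<open>X\<close>, then \<open>\<phi>(X') \<ge> \<phi>(X'') + \<langle>Y', X' - X''\<rangle>\<close> and \<open>\<phi>(X') = \<phi>(X'')\<close> would give
  \<open>\<langle>X', Y'\<rangle> \<le> \<langle>X'', Y'\<rangle> = \<langle>X, Z\<rangle>\<close>, which is optimality. Picard iterates of the contraction, computed from \<open>Z\<close> and from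
  \<open>Y'\<close> in parallel, have equal laws and serve as approximations of \<open>X''\<close>.

  The gradient and its directional derivatives are obtained by duality: an operator \<open>Z\<close> is bounded in norm by
  the values \<open>|\<tau>(P Z)|\<close> for \<open>P \<ge> 0\<close>, \<open>\<tau>(P) \<le> 1\<close>, and the trace polynomials approximating \<open>\<partial>\<phi>(X)[Y]\<close> can, by
  cyclicity, be brought into the form \<open>\<langle>Y, h(X)\<rangle>\<close>.
\<close>

section \<open>Completeness and the Riesz representation on square-summable sequences\<close>

text \<open>The contraction holds in the L2 norm only, and an L2 limit need not consist of bounded
  operators. So X'' is never formed: each iterate satisfies the convexity inequalities up to an
  error of order (c/K)^n, and the limit is taken among real numbers. \<open>Ck_tr\<close> gives
  derivatives of the potential as multilinear forms with operator values. That the gradient is a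
  tuple of bounded operators, and that it is differentiable in norm, has to be proved. What makes
  this possible is the freedom of exponents in \<open>multi_norm\<close>: with exponent 1 on one
  direction and \<infinity> on the others, the approximation error is uniform over the L1 ball,
  which is what duality with the operator norm asks for. The hypothesis on the Hessian is used with
  exponents (2, 2), where it says that Hess - K has norm at most some c < K on L2; this gives both
  Hess \<ge> K - c > 0 and the contraction factor c/K of 1 - Hess/K.\<close>

lemma ell2_summable: "summable (\<lambda>n. (cmod (ell2_nth x n))\<^sup>2)"
  using ell2_nth[of x] by simp

lemma inner_ell2_suminf: "inner u v = (suminf (\<lambda>n. Re (cnj (ell2_nth u n) * ell2_nth v n)))"
  unfolding inner_ell2_def cinner_def by (rule Re_suminf[OF summable_cinner])

lemma norm_ell2_squared: "(norm x)\<^sup>2 = (suminf (\<lambda>n. (cmod (ell2_nth x n))\<^sup>2))"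
proof -
  have "Re (cnj (ell2_nth x n) * ell2_nth x n) = (cmod (ell2_nth x n))\<^sup>2" for n
    unfolding cmod_power2 by (simp add: power2_eq_square)
  then show ?thesis
    unfolding power2_norm_eq_inner inner_ell2_suminf by simp
qed

lemma sum_ell2_le_norm: "(\<Sum>n<J. (cmod (ell2_nth x n))\<^sup>2) \<le> (norm x)\<^sup>2"
  unfolding norm_ell2_squared by (intro sum_le_suminf ell2_summable) auto

lemma norm_ell2_leI:
  assumes "\<And>J. (\<Sum>n<J. (cmod (ell2_nth x n))\<^sup>2) \<le> e\<^sup>2" "0 \<le> e"
  shows "norm x \<le> e"
proof -
  have "(norm x)\<^sup>2 \<le> e\<^sup>2"
    unfolding norm_ell2_squared by (intro suminf_le_const ell2_summable assms)
  with assms(2) show ?thesis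
    by (meson power2_le_imp_le)
qed

lemma ell2_eqI: "(\<And>n. ell2_nth x n = ell2_nth y n) \<Longrightarrow> x = y"
  using ell2_nth_inject by blast

lemma cmod_ell2_nth_le: "cmod (ell2_nth x n) \<le> norm x"
proof -
  have "(cmod (ell2_nth x n))\<^sup>2 \<le> (\<Sum>k<Suc n. (cmod (ell2_nth x k))\<^sup>2)"
    by (simp add: sum_nonneg)
  also have "\<dots> \<le> (norm x)\<^sup>2" by (rule sum_ell2_le_norm)
  finally show ?thesis by (rule power2_le_imp_le) simp
qed

lemma Abs_ell2_from_bounded:
  assumes "\<And>J. (\<Sum>n<J. (cmod (f n))\<^sup>2) \<le> B"
  shows "ell2_nth (Abs_ell2 f) = f"
proof -
  have "summable (\<lambda>n. (cmod (f n))\<^sup>2)"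
    by (rule summableI_nonneg_bounded[of _ B]) (use assms in auto)
  then show ?thesis by (simp add: Abs_ell2_inverse)
qed

text \<open>Completeness passes on to \<open>bop\<close>, where limits of polynomials give the
  functional calculus and limits of difference quotients give derivatives.\<close>

instance ell2 :: banach
proof
  fix X :: "nat \<Rightarrow> ell2" assume C: "Cauchy X"
  have "Cauchy (\<lambda>m. ell2_nth (X m) n)" for n
  proof (rule metric_CauchyI)
    fix e :: real assume "0 < e"
    with C obtain M where M: "\<forall>m\<ge>M. \<forall>k\<ge>M. dist (X m) (X k) < e"
      using metric_CauchyD by blast
    show "\<exists>M. \<forall>m\<ge>M. \<forall>k\<ge>M. dist (ell2_nth (X m) n) (ell2_nth (X k) n) < e"
    proof (intro exI allI impI)
      fix m k assume "m \<ge> M" "k \<ge> M"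
      have "dist (ell2_nth (X m) n) (ell2_nth (X k) n) \<le> dist (X m) (X k)"
        using cmod_ell2_nth_le[of "X m - X k" n] by (simp add: dist_norm minus_ell2.rep_eq)
      with M \<open>m \<ge> M\<close> \<open>k \<ge> M\<close> show "dist (ell2_nth (X m) n) (ell2_nth (X k) n) < e"
        by (meson le_less_trans)
    qed
  qed
  then have "\<forall>n. \<exists>l. (\<lambda>m. ell2_nth (X m) n) \<longlonglongrightarrow> l"
    using Cauchy_convergent convergent_def by metis
  then obtain x where x: "\<And>n. (\<lambda>m. ell2_nth (X m) n) \<longlonglongrightarrow> x n" by metis
  \<comment> \<open>The Cauchy bound on finite partial sums survives the limit in k, uniformly in J.
    With e = 1 it shows square summability, with small e convergence.\<close>
  have key: "\<exists>M. \<forall>m\<ge>M. \<forall>J. (\<Sum>n<J. (cmod (ell2_nth (X m) n - x n))\<^sup>2) \<le> e\<^sup>2"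
    if "0 < e" for e
  proof -
    obtain M where M: "\<forall>m\<ge>M. \<forall>k\<ge>M. dist (X m) (X k) < e"
      using C \<open>0 < e\<close> metric_CauchyD by blast
    have "(\<Sum>n<J. (cmod (ell2_nth (X m) n - x n))\<^sup>2) \<le> e\<^sup>2" if m: "m \<ge> M" for m J
    proof (rule LIMSEQ_le_const2)
      show "(\<lambda>k. \<Sum>n<J. (cmod (ell2_nth (X m) n - ell2_nth (X k) n))\<^sup>2)
          \<longlonglongrightarrow> (\<Sum>n<J. (cmod (ell2_nth (X m) n - x n))\<^sup>2)"
        by (intro tendsto_intros x)
      have "(\<Sum>n<J. (cmod (ell2_nth (X m) n - ell2_nth (X k) n))\<^sup>2) \<le> e\<^sup>2" if "k \<ge> M" for k
      proof -
        have "(\<Sum>n<J. (cmod (ell2_nth (X m) n - ell2_nth (X k) n))\<^sup>2) \<le> (norm (X m - X k))\<^sup>2"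
          using sum_ell2_le_norm[of "X m - X k" J] by (simp add: minus_ell2.rep_eq)
        also have "\<dots> \<le> e\<^sup>2"
          using M m \<open>k \<ge> M\<close> by (intro power_mono) (auto simp: dist_norm less_imp_le)
        finally show ?thesis .
      qed
      then show "\<exists>N. \<forall>k\<ge>N. (\<Sum>n<J. (cmod (ell2_nth (X m) n - ell2_nth (X k) n))\<^sup>2) \<le> e\<^sup>2"
        by blast
    qed
    then show ?thesis by blast
  qed
  obtain M where M: "\<And>J. (\<Sum>n<J. (cmod (ell2_nth (X M) n - x n))\<^sup>2) \<le> 1\<^sup>2"
    using key[of 1] by auto
  \<comment> \<open>The bound controls the difference \<open>X M - x\<close>, so this difference is
    made an element first and the limit is written as \<open>X M - d\<close>.\<close>
  define d where "d = Abs_ell2 (\<lambda>n. ell2_nth (X M) n - x n)"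
  have d: "ell2_nth d = (\<lambda>n. ell2_nth (X M) n - x n)"
    unfolding d_def by (rule Abs_ell2_from_bounded[OF M])
  have diff: "ell2_nth (X m - (X M - d)) n = ell2_nth (X m) n - x n" for m n
    by (simp add: minus_ell2.rep_eq d)
  have "X \<longlonglongrightarrow> X M - d"
  proof (rule metric_LIMSEQ_I)
    fix e :: real assume "0 < e"
    then obtain N where N: "\<forall>m\<ge>N. \<forall>J. (\<Sum>n<J. (cmod (ell2_nth (X m) n - x n))\<^sup>2) \<le> (e/2)\<^sup>2"
      using key[of "e/2"] by auto
    have "dist (X m) (X M - d) < e" if "m \<ge> N" for m
    proof -
      have "norm (X m - (X M - d)) \<le> e/2"
        using N that \<open>0 < e\<close> by (intro norm_ell2_leI) (auto simp: diff)
      with \<open>0 < e\<close> show ?thesis by (simp add: dist_norm)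
    qed
    then show "\<exists>N. \<forall>m\<ge>N. dist (X m) (X M - d) < e" by blast
  qed
  then show "convergent X" by (auto simp: convergent_def)
qed

definition ell2_single :: "nat \<Rightarrow> complex \<Rightarrow> ell2" where
  "ell2_single n c = Abs_ell2 (\<lambda>k. if k = n then c else 0)"

lemma ell2_nth_single: "ell2_nth (ell2_single n c) k = (if k = n then c else 0)"
proof -
  have "summable (\<lambda>k. (cmod (if k = n then c else 0))\<^sup>2)"
    by (rule summable_finite[of "{n}"]) auto
  then show ?thesis
    unfolding ell2_single_def by (simp add: Abs_ell2_inverse)
qed

lemma ell2_nth_sum: "ell2_nth (\<Sum>i\<in>S. f i) k = (\<Sum>i\<in>S. ell2_nth (f i) k)"
  by (induction S rule: infinite_finite_induct) (auto simp: zero_ell2.rep_eq plus_ell2.rep_eq)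

lemma ell2_scaleR_nth: "ell2_nth (r *\<^sub>R x) n = of_real r * ell2_nth x n"
  by (simp add: scaleR_ell2_def ell2_scaleC.rep_eq)

definition ell2_trunc :: "nat \<Rightarrow> ell2 \<Rightarrow> ell2" where
  "ell2_trunc J x = (\<Sum>n<J. ell2_single n (ell2_nth x n))"

lemma ell2_nth_trunc: "ell2_nth (ell2_trunc J x) k = (if k < J then ell2_nth x k else 0)"
  by (simp add: ell2_trunc_def ell2_nth_sum ell2_nth_single)

lemma norm_ell2_trunc: "(norm (ell2_trunc J x))\<^sup>2 = (\<Sum>n<J. (cmod (ell2_nth x n))\<^sup>2)"
proof -
  have "(norm (ell2_trunc J x))\<^sup>2 = (\<Sum>n<J. (cmod (ell2_nth (ell2_trunc J x) n))\<^sup>2)"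
    unfolding norm_ell2_squared by (intro suminf_finite) (auto simp: ell2_nth_trunc)
  then show ?thesis by (simp add: ell2_nth_trunc)
qed

lemma ell2_trunc_tendsto: "(\<lambda>J. ell2_trunc J x) \<longlonglongrightarrow> x"
proof -
  have inner_tr: "inner x (ell2_trunc J x) = (\<Sum>n<J. (cmod (ell2_nth x n))\<^sup>2)" for J
  proof -
    have "inner x (ell2_trunc J x)
        = (\<Sum>n<J. Re (cnj (ell2_nth x n) * ell2_nth (ell2_trunc J x) n))"
      unfolding inner_ell2_suminf by (intro suminf_finite) (auto simp: ell2_nth_trunc)
    also have "\<dots> = (\<Sum>n<J. (cmod (ell2_nth x n))\<^sup>2)"
      unfolding cmod_power2 by (intro sum.cong) (auto simp: ell2_nth_trunc power2_eq_square)
    finally show ?thesis .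
  qed
  have "(norm (ell2_trunc J x - x))\<^sup>2 = (norm x)\<^sup>2 - (\<Sum>n<J. (cmod (ell2_nth x n))\<^sup>2)" for J
  proof -
    have "(norm (ell2_trunc J x - x))\<^sup>2
        = (norm (ell2_trunc J x))\<^sup>2 - 2 * inner x (ell2_trunc J x) + (norm x)\<^sup>2"
      by (simp add: power2_norm_eq_inner inner_diff_left inner_diff_right inner_commute)
    then show ?thesis unfolding norm_ell2_trunc inner_tr by simp
  qed
  moreover have "(\<lambda>J. (norm x)\<^sup>2 - (\<Sum>n<J. (cmod (ell2_nth x n))\<^sup>2)) \<longlonglongrightarrow> (norm x)\<^sup>2 - (norm x)\<^sup>2"
    unfolding norm_ell2_squared by (intro tendsto_intros summable_LIMSEQ ell2_summable)
  ultimately have "(\<lambda>J. (norm (ell2_trunc J x - x))\<^sup>2) \<longlonglongrightarrow> 0" by simp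
  from tendsto_real_sqrt[OF this] have "(\<lambda>J. norm (ell2_trunc J x - x)) \<longlonglongrightarrow> 0" by simp
  then show ?thesis using LIM_zero_iff tendsto_norm_zero_iff by blast
qed

lemma ell2_single_split:
  "ell2_single n c = Re c *\<^sub>R ell2_single n 1 + Im c *\<^sub>R ell2_single n \<i>"
  by (rule ell2_eqI) (auto simp: plus_ell2.rep_eq ell2_scaleR_nth ell2_nth_single complex_eq_iff)

text \<open>The coordinates of z are read off from the values of f on basis vectors; as f is only
  real-linear, the values at 1 and at \<i> make up one complex coordinate. Square summability comes
  from testing f on the truncated coordinate sequence itself.\<close>

lemma ell2_Riesz:
  fixes f :: "ell2 \<Rightarrow> real"
  assumes f: "bounded_linear f" and K: "\<And>y. \<bar>f y\<bar> \<le> K * norm y" "0 \<le> K"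
  obtains z where "\<And>y. f y = inner z y" "norm z \<le> K"
proof -
  interpret f: bounded_linear f by (rule f)
  define b where "b n = Complex (f (ell2_single n 1)) (f (ell2_single n \<i>))" for n
  have fs: "f (ell2_single n c) = Re (cnj (b n) * c)" for n c
    by (subst ell2_single_split) (simp add: f.add f.scaleR b_def)
  have ftr: "f (ell2_trunc J y) = (\<Sum>n<J. Re (cnj (b n) * ell2_nth y n))" for J y
    unfolding ell2_trunc_def by (simp add: f.sum fs)
  have bound: "(\<Sum>n<J. (cmod (b n))\<^sup>2) \<le> K\<^sup>2" for J
  proof -
    define s where "s = (\<Sum>n<J. (cmod (b n))\<^sup>2)"
    define y where "y = (\<Sum>n<J. ell2_single n (b n))"
    have y: "ell2_nth y n = (if n < J then b n else 0)" for n
      by (simp add: y_def ell2_nth_sum ell2_nth_single)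
    have tr: "ell2_trunc J y = y"
      by (rule ell2_eqI) (simp add: ell2_nth_trunc y)
    have "f y = s"
      using ftr[of J y] unfolding tr s_def cmod_power2 
      by (simp add: y power2_eq_square)
    moreover have ny: "(norm y)\<^sup>2 = s"
      using norm_ell2_trunc[of J y] unfolding tr s_def by (simp add: y)
    ultimately have "(norm y)\<^sup>2 \<le> K * norm y" using K(1)[of y] by simp
    then have "norm y \<le> K"
      using K(2) by (cases "norm y = 0") (auto simp: power2_eq_square)
    then show ?thesis using ny K(2) unfolding s_def by (metis norm_ge_zero power_mono)
  qed
  define z where "z = Abs_ell2 b"
  have z: "ell2_nth z = b" unfolding z_def by (rule Abs_ell2_from_bounded[OF bound])
  show ?thesis
  proof
    fix y
    have "(\<lambda>J. f (ell2_trunc J y)) \<longlonglongrightarrow> f y"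
      by (intro f.tendsto ell2_trunc_tendsto)
    moreover have "(\<lambda>J. f (ell2_trunc J y)) \<longlonglongrightarrow> inner z y"
      unfolding ftr inner_ell2_suminf z[symmetric]
      by (intro summable_LIMSEQ summable_Re summable_cinner)
    ultimately show "f y = inner z y" by (rule LIMSEQ_unique)
  next
    show "norm z \<le> K" by (intro norm_ell2_leI) (use bound K(2) in \<open>auto simp: z\<close>)
  qed
qed

section \<open>Adjoints of bounded operators\<close>

lemmas oL_bilinear =
  bounded_bilinear.add_left[OF bounded_bilinear_blinfun_compose]
  bounded_bilinear.add_right[OF bounded_bilinear_blinfun_compose]
  bounded_bilinear.diff_left[OF bounded_bilinear_blinfun_compose]
  bounded_bilinear.diff_right[OF bounded_bilinear_blinfun_compose]
  bounded_bilinear.minus_left[OF bounded_bilinear_blinfun_compose]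
  bounded_bilinear.minus_right[OF bounded_bilinear_blinfun_compose]
  bounded_bilinear.scaleR_left[OF bounded_bilinear_blinfun_compose]
  bounded_bilinear.scaleR_right[OF bounded_bilinear_blinfun_compose]
  bounded_bilinear.zero_left[OF bounded_bilinear_blinfun_compose]
  bounded_bilinear.zero_right[OF bounded_bilinear_blinfun_compose]

lemmas tendsto_oL = bounded_bilinear.tendsto[OF bounded_bilinear_blinfun_compose]

lemma oL_assoc: "(R o\<^sub>L S) o\<^sub>L T = R o\<^sub>L (S o\<^sub>L T)"
  by (rule blinfun_eqI) simp

lemma oL_id [simp]: "T o\<^sub>L id_blinfun = T" "id_blinfun o\<^sub>L T = T"
  by (rule blinfun_eqI, simp)+

lemma iop_apply: "blinfun_apply iop x = ell2_scaleC \<i> x"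
  by (simp add: iop.rep_eq)

lemma iop_squared: "iop o\<^sub>L iop = - id_blinfun"
proof (rule blinfun_eqI)
  fix x show "blinfun_apply (iop o\<^sub>L iop) x = blinfun_apply (- id_blinfun) x"
    by (rule ell2_eqI) (simp add: iop_apply ell2_scaleC.rep_eq uminus_ell2.rep_eq blinfun.bilinear_simps)
qed

lemma inner_iop_left: "inner (blinfun_apply iop x) y = - inner x (blinfun_apply iop y)"
proof -
  have s: "summable (\<lambda>n. Re (cnj (ell2_nth x n) * ell2_nth (blinfun_apply iop y) n))"
    by (intro summable_Re summable_cinner)
  show ?thesis
    unfolding inner_ell2_suminf suminf_minus[OF s, symmetric]
    by (intro suminf_cong) (simp add: iop_apply ell2_scaleC.rep_eq)
qed

text \<open>\<open>adj\<close> is defined through \<open>cinner\<close>, but all computations use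
  the real \<open>inner\<close>; this identity translates between them.\<close>

lemma cinner_Complex: "cinner x y = Complex (inner x y) (inner (blinfun_apply iop x) y)"
proof -
  have "inner (blinfun_apply iop x) y = (suminf (\<lambda>n. Im (cnj (ell2_nth x n) * ell2_nth y n)))"
    unfolding inner_ell2_suminf by (intro suminf_cong) (simp add: iop_apply ell2_scaleC.rep_eq)
  also have "\<dots> = Im (cinner x y)"
    unfolding cinner_def by (rule Im_suminf[OF summable_cinner, symmetric])
  finally show ?thesis by (simp add: inner_ell2_def)
qed

lemma bop_inner_eqI:
  fixes S T :: bop
  assumes "\<And>x y. inner (blinfun_apply S x) y = inner (blinfun_apply T x) y"
  shows "S = T"
proof (rule blinfun_eqI)
  fix x
  have "inner (blinfun_apply S x - blinfun_apply T x) (blinfun_apply S x - blinfun_apply T x) = 0"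
    using assms[of x "blinfun_apply S x - blinfun_apply T x"] by (simp add: inner_diff_left)
  then show "blinfun_apply S x = blinfun_apply T x" by simp
qed

lemma ex_real_adjoint:
  fixes T :: bop
  shows "\<exists>S :: bop. \<forall>x y. inner (blinfun_apply S x) y = inner x (blinfun_apply T y)"
proof -
  have "\<exists>z. (\<forall>y. inner x (blinfun_apply T y) = inner z y) \<and> norm z \<le> norm x * norm T" for x
  proof -
    have bl: "bounded_linear (\<lambda>y. inner x (blinfun_apply T y))"
      using bounded_linear_compose[OF bounded_linear_inner_right blinfun.bounded_linear_right] .
    have "\<bar>inner x (blinfun_apply T y)\<bar> \<le> norm x * norm T * norm y" for y
    proof -
      have "\<bar>inner x (blinfun_apply T y)\<bar> \<le> norm x * norm (blinfun_apply T y)"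
        by (rule Cauchy_Schwarz_ineq2)
      also have "\<dots> \<le> norm x * (norm T * norm y)"
        by (intro mult_left_mono norm_blinfun) simp
      finally show ?thesis by (simp add: mult.assoc)
    qed
    from ell2_Riesz[OF bl this] show ?thesis by (metis mult_nonneg_nonneg norm_ge_zero)
  qed
  then obtain g where g: "\<And>x y. inner x (blinfun_apply T y) = inner (g x) y"
    and gn: "\<And>x. norm (g x) \<le> norm x * norm T" by metis
  have eq: "u = v" if "\<And>y. inner u y = inner v y" for u v :: ell2
    using that[of "u - v"] by (metis inner_diff_left inner_eq_zero_iff right_minus_eq)
  have "bounded_linear g"
  proof (rule bounded_linear_intro)
    show "g (x + y) = g x + g y" for x y
      by (rule eq) (simp add: g[symmetric] inner_add_left)
    show "g (r *\<^sub>R x) = r *\<^sub>R g x" for r x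
      by (rule eq) (simp add: g[symmetric])
  qed (rule gn)
  then show ?thesis
    by (intro exI[of _ "Blinfun g"]) (simp add: bounded_linear_Blinfun_apply g)
qed

lemma clin_iop: "T \<in> clin_ops \<Longrightarrow> blinfun_apply T (blinfun_apply iop x) = blinfun_apply iop (blinfun_apply T x)"
  unfolding clin_ops_def by (metis (mono_tags) blinfun_apply_blinfun_compose mem_Collect_eq)

text \<open>Resolves the \<open>THE\<close> in \<open>adj\<close> for complex-linear operators: the
  real adjoint of such an operator commutes with \<open>iop\<close> too, hence also satisfies the
  complex adjoint identity.\<close>

lemma adj_exists:
  assumes "T \<in> clin_ops"
  shows "\<exists>S. S \<in> clin_ops \<and> (\<forall>x y. inner (blinfun_apply S x) y = inner x (blinfun_apply T y)) \<and> adj T = S"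
proof -
  obtain S :: bop where S: "\<And>x y. inner (blinfun_apply S x) y = inner x (blinfun_apply T y)"
    using ex_real_adjoint by metis
  have clin: "S o\<^sub>L iop = iop o\<^sub>L S"
    by (rule bop_inner_eqI) (simp add: S inner_iop_left clin_iop[OF assms])
  have cS: "cinner (blinfun_apply S x) y = cinner x (blinfun_apply T y)" for x y
  proof -
    have "inner (blinfun_apply iop (blinfun_apply S x)) y
        = inner (blinfun_apply iop x) (blinfun_apply T y)"
      using clin by (metis S blinfun_apply_blinfun_compose)
    then show ?thesis by (simp add: cinner_Complex S)
  qed
  have "adj T = S"
    unfolding adj_def
  proof (rule the_equality)
    fix R assume R: "\<forall>x y. cinner (blinfun_apply R x) y = cinner x (blinfun_apply T y)"
    then have "\<forall>x y. inner (blinfun_apply R x) y = inner x (blinfun_apply T y)"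
      unfolding cinner_Complex by simp
    then show "R = S" by (intro bop_inner_eqI) (simp add: S)
  qed (use cS in simp)
  with S clin show ?thesis unfolding clin_ops_def by blast
qed

lemma adj_clin: "T \<in> clin_ops \<Longrightarrow> adj T \<in> clin_ops"
  using adj_exists by metis

lemma inner_adj_left: "T \<in> clin_ops \<Longrightarrow> inner (blinfun_apply (adj T) x) y = inner x (blinfun_apply T y)"
  using adj_exists by metis

lemma inner_adj_right: "T \<in> clin_ops \<Longrightarrow> inner x (blinfun_apply (adj T) y) = inner (blinfun_apply T x) y"
  by (metis inner_adj_left inner_commute)

lemma adj_eqI:
  assumes "T \<in> clin_ops" "\<And>x y. inner (blinfun_apply S x) y = inner x (blinfun_apply T y)"
  shows "adj T = S"
  by (rule bop_inner_eqI) (simp add: assms inner_adj_left)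

lemma clin_iopI: "(\<And>x. blinfun_apply T (blinfun_apply iop x) = blinfun_apply iop (blinfun_apply T x)) \<Longrightarrow> T \<in> clin_ops"
  unfolding clin_ops_def by (auto intro!: blinfun_eqI)

lemma clin_add: "S \<in> clin_ops \<Longrightarrow> T \<in> clin_ops \<Longrightarrow> S + T \<in> clin_ops"
  by (rule clin_iopI) (simp add: blinfun.bilinear_simps clin_iop)

lemma clin_scaleR: "T \<in> clin_ops \<Longrightarrow> r *\<^sub>R T \<in> clin_ops"
  by (rule clin_iopI) (simp add: blinfun.bilinear_simps clin_iop)

lemma clin_oL: "S \<in> clin_ops \<Longrightarrow> T \<in> clin_ops \<Longrightarrow> S o\<^sub>L T \<in> clin_ops"
  by (rule clin_iopI) (simp add: clin_iop)

lemma clin_id: "id_blinfun \<in> clin_ops"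
  by (rule clin_iopI) simp

lemma clin_iop_mem: "iop \<in> clin_ops"
  by (rule clin_iopI) simp

lemma clin_scaleC: "T \<in> clin_ops \<Longrightarrow> scaleC_op c T \<in> clin_ops"
  unfolding scaleC_op_def by (intro clin_add clin_scaleR clin_oL clin_iop_mem)

lemma adj_adj: "T \<in> clin_ops \<Longrightarrow> adj (adj T) = T"
  by (rule adj_eqI) (simp_all add: adj_clin inner_adj_right)

lemma adj_add: "S \<in> clin_ops \<Longrightarrow> T \<in> clin_ops \<Longrightarrow> adj (S + T) = adj S + adj T"
  by (rule adj_eqI) (simp_all add: clin_add blinfun.bilinear_simps inner_adj_left inner_add_left inner_add_right)

lemma adj_scaleR: "T \<in> clin_ops \<Longrightarrow> adj (r *\<^sub>R T) = r *\<^sub>R adj T"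
  by (rule adj_eqI) (simp_all add: clin_scaleR blinfun.bilinear_simps inner_adj_left)

lemma adj_minus: "T \<in> clin_ops \<Longrightarrow> adj (- T) = - adj T"
  using adj_scaleR[of T "-1"] by simp

lemma adj_diff: "S \<in> clin_ops \<Longrightarrow> T \<in> clin_ops \<Longrightarrow> adj (S - T) = adj S - adj T"
  using adj_add[of S "- T"] adj_minus[of T] clin_scaleR[of T "-1"] by simp

lemma adj_oL: "S \<in> clin_ops \<Longrightarrow> T \<in> clin_ops \<Longrightarrow> adj (S o\<^sub>L T) = adj T o\<^sub>L adj S"
  by (rule adj_eqI) (simp_all add: clin_oL inner_adj_left)

lemma adj_id: "adj id_blinfun = id_blinfun"
  by (rule adj_eqI) (simp_all add: clin_id)

lemma adj_zero: "adj 0 = 0"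
  by (rule adj_eqI) (simp_all add: clin_ops_def)

lemma adj_iop: "adj iop = - iop"
  by (rule adj_eqI) (simp_all add: clin_iop_mem blinfun.bilinear_simps inner_iop_left)

lemma adj_scaleC: 
  assumes "T \<in> clin_ops" shows "adj (scaleC_op c T) = scaleC_op (cnj c) (adj T)"
proof -
  have "adj T o\<^sub>L iop = iop o\<^sub>L adj T" using adj_clin[OF assms] by (simp add: clin_ops_def)
  then show ?thesis
    unfolding scaleC_op_def
    by (simp add: adj_add adj_scaleR adj_oL adj_iop assms clin_scaleR clin_oL clin_iop_mem oL_bilinear)
qed

lemma norm_adj:
  assumes "T \<in> clin_ops" shows "norm (adj T) = norm T"
proof -
  have le: "norm (adj S) \<le> norm S" if S: "S \<in> clin_ops" for S
  proof (rule norm_blinfun_bound)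
    fix x
    let ?y = "blinfun_apply (adj S) x"
    have "(norm ?y)\<^sup>2 = inner x (blinfun_apply S ?y)"
      by (simp add: power2_norm_eq_inner inner_adj_left S)
    also have "\<dots> \<le> norm x * norm (blinfun_apply S ?y)" by (rule norm_cauchy_schwarz)
    also have "\<dots> \<le> norm x * (norm S * norm ?y)" by (intro mult_left_mono norm_blinfun) simp
    finally show "norm ?y \<le> norm S * norm x"
      by (cases "norm ?y = 0") (auto simp: power2_eq_square mult_ac)
  qed simp
  from le[OF assms] le[OF adj_clin[OF assms]] show ?thesis by (simp add: adj_adj assms)
qed

lemma scaleC_op_of_real: "scaleC_op (of_real r) T = r *\<^sub>R T"
  by (simp add: scaleC_op_def)

lemma scaleC_op_simps:
  "scaleC_op 1 T = T" "scaleC_op 0 T = 0" "scaleC_op c 0 = 0"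
  "scaleC_op c (S + T) = scaleC_op c S + scaleC_op c T"
  "scaleC_op (c + d) T = scaleC_op c T + scaleC_op d T"
  by (simp_all add: scaleC_op_def oL_bilinear algebra_simps)

lemma scaleC_scaleC: "scaleC_op c (scaleC_op d T) = scaleC_op (c * d) T"
proof -
  have "iop o\<^sub>L (iop o\<^sub>L T) = - T"
    by (simp add: oL_assoc[symmetric] iop_squared oL_bilinear)
  then show ?thesis
    by (simp add: scaleC_op_def oL_bilinear algebra_simps)
qed

lemma scaleC_oL_left: "scaleC_op c S o\<^sub>L T = scaleC_op c (S o\<^sub>L T)"
  by (simp add: scaleC_op_def oL_bilinear oL_assoc)

lemma scaleC_oL_right: "S \<in> clin_ops \<Longrightarrow> S o\<^sub>L scaleC_op c T = scaleC_op c (S o\<^sub>L T)"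
  by (simp add: scaleC_op_def oL_bilinear clin_ops_def flip: oL_assoc)

lemma tendsto_scaleC_op:
  assumes "(f \<longlongrightarrow> c) F" "(g \<longlongrightarrow> T) F"
  shows "((\<lambda>x. scaleC_op (f x) (g x)) \<longlongrightarrow> scaleC_op c T) F"
  unfolding scaleC_op_def by (intro tendsto_intros tendsto_oL assms)

section \<open>Polynomials of a symmetric operator\<close>

definition symmetric_op :: "bop \<Rightarrow> bool" where
  "symmetric_op T \<longleftrightarrow> (\<forall>x y. inner (blinfun_apply T x) y = inner x (blinfun_apply T y))"

definition positive_op :: "bop \<Rightarrow> bool" where
  "positive_op T \<longleftrightarrow> symmetric_op T \<and> (\<forall>x. 0 \<le> inner x (blinfun_apply T x))"

lemma symmetric_opD: "symmetric_op T \<Longrightarrow> inner (blinfun_apply T x) y = inner x (blinfun_apply T y)"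
  by (simp add: symmetric_op_def)

lemma positive_op_symmetric: "positive_op T \<Longrightarrow> symmetric_op T"
  by (simp add: positive_op_def)

lemma op_poly_pCons: "op_poly (pCons a p) T = a *\<^sub>R id_blinfun + (T o\<^sub>L op_poly p T)"
proof -
  let ?P = "\<lambda>i. ((\<lambda>S. T o\<^sub>L S) ^^ i) id_blinfun"
  have ext: "op_poly q T = (\<Sum>i\<le>n. coeff q i *\<^sub>R ?P i)" if "degree q \<le> n" for q n
    unfolding op_poly_def using that
    by (intro sum.mono_neutral_left) (auto simp: coeff_eq_0)
  have "op_poly (pCons a p) T = (\<Sum>i\<le>Suc (degree p). coeff (pCons a p) i *\<^sub>R ?P i)"
    by (rule ext) (rule degree_pCons_le)
  also have "\<dots> = a *\<^sub>R id_blinfun + (\<Sum>i\<le>degree p. coeff p i *\<^sub>R (T o\<^sub>L ?P i))"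
    by (subst sum.atMost_Suc_shift) simp
  also have "(\<Sum>i\<le>degree p. coeff p i *\<^sub>R (T o\<^sub>L ?P i)) = T o\<^sub>L op_poly p T"
    unfolding op_poly_def
    by (simp add: bounded_bilinear.sum_right[OF bounded_bilinear_blinfun_compose] oL_bilinear)
  finally show ?thesis .
qed

lemma op_poly_0 [simp]: "op_poly 0 T = 0"
  by (simp add: op_poly_def)

lemma op_poly_add: "op_poly (p + q) T = op_poly p T + op_poly q T"
  by (induction p q rule: poly_induct2) (simp_all add: op_poly_pCons oL_bilinear algebra_simps)

lemma op_poly_smult: "op_poly (smult c p) T = c *\<^sub>R op_poly p T"
  by (induction p) (simp_all add: op_poly_pCons oL_bilinear algebra_simps)

lemma op_poly_minus: "op_poly (- p) T = - op_poly p T"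
  using op_poly_smult[of "-1" p T] by simp

lemma op_poly_diff: "op_poly (p - q) T = op_poly p T - op_poly q T"
  using op_poly_add[of p "- q" T] by (simp add: op_poly_minus)

lemma op_poly_mult: "op_poly (p * q) T = op_poly p T o\<^sub>L op_poly q T"
  by (induction p)
    (simp_all add: op_poly_pCons oL_bilinear op_poly_add op_poly_smult oL_assoc)

lemma op_poly_const: "op_poly [:a:] T = a *\<^sub>R id_blinfun"
  by (simp add: op_poly_pCons)

lemma op_poly_pcompose: "op_poly (pcompose p q) T = op_poly p (op_poly q T)"
  by (induction p) (simp_all add: op_poly_pCons pcompose_pCons op_poly_add op_poly_mult)

lemma symmetric_op_poly:
  assumes "symmetric_op T" shows "symmetric_op (op_poly p T)"
proof -
  have comm: "op_poly p T o\<^sub>L T = T o\<^sub>L op_poly p T" for p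
    using op_poly_mult[of p "[:0, 1:]" T] op_poly_mult[of "[:0, 1:]" p T]
    by (simp add: op_poly_pCons mult.commute)
  show ?thesis
  proof (induction p)
    case (pCons a p)
    have "inner (blinfun_apply T (blinfun_apply (op_poly p T) x)) y
        = inner x (blinfun_apply T (blinfun_apply (op_poly p T) y))" for x y
    proof -
      have "blinfun_apply T (blinfun_apply (op_poly p T) y) = blinfun_apply (op_poly p T) (blinfun_apply T y)"
        using comm by (metis blinfun_apply_blinfun_compose)
      with pCons.IH assms show ?thesis by (simp add: symmetric_op_def)
    qed
    then show ?case
      by (simp add: symmetric_op_def op_poly_pCons blinfun.bilinear_simps inner_add_left inner_add_right)
  qed (simp add: symmetric_op_def)
qed

lemma bounded_below_by_form:
  fixes S :: bop
  assumes "\<And>y. \<delta> * (norm y)\<^sup>2 \<le> \<bar>inner y (blinfun_apply S y)\<bar>"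
  shows "\<delta> * norm y \<le> norm (blinfun_apply S y)"
proof (cases "y = 0")
  case False
  have "\<delta> * norm y * norm y \<le> norm (blinfun_apply S y) * norm y"
    using assms[of y] Cauchy_Schwarz_ineq2[of y "blinfun_apply S y"]
    by (simp add: power2_eq_square mult_ac)
  with False show ?thesis by simp
qed simp

lemma poly_map_of_real: "poly (map_poly complex_of_real p) (complex_of_real x) = complex_of_real (poly p x)"
  by (induction p) (simp_all add: map_poly_pCons)

lemma map_of_real_add: "map_poly complex_of_real (p + q) = map_poly complex_of_real p + map_poly complex_of_real q"
  by (rule poly_eqI) (simp add: coeff_map_poly)

lemma map_of_real_mult: "map_poly complex_of_real (p * q) = map_poly complex_of_real p * map_poly complex_of_real q"
proof (induction p)
  case (pCons a p)
  have "map_poly complex_of_real (smult a q) = smult (complex_of_real a) (map_poly complex_of_real q)"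
    by (rule poly_eqI) (simp add: coeff_map_poly)
  with pCons show ?case by (simp add: map_poly_pCons map_of_real_add)
qed simp

text \<open>Take a complex root z. If it is not real, divide by (t - Re z)^2 + (Im z)^2: the
  remainder is real, has degree below 2 and vanishes at the non-real z, so it is zero.\<close>

lemma real_poly_factor:
  fixes q :: "real poly"
  assumes "0 < degree q"
  obtains (linear) r k where "q = [:-r, 1:] * k" "poly q r = 0" "degree k < degree q"
    | (quadratic) a b k where "b \<noteq> 0" "q = [:a\<^sup>2 + b\<^sup>2, -2 * a, 1:] * k" "degree k < degree q"
proof -
  let ?c = "map_poly complex_of_real"
  have "\<not> constant (poly (?c q))"
    using assms by (simp add: constant_degree degree_map_poly)
  then obtain z where z: "poly (?c q) z = 0" using fundamental_theorem_of_algebra by blast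
  have q0: "q \<noteq> 0" using assms by auto
  show thesis
  proof (cases "Im z = 0")
    case True
    then have "z = complex_of_real (Re z)" by (simp add: complex_eq_iff)
    with z have r: "poly q (Re z) = 0" by (metis of_real_eq_0_iff poly_map_of_real)
    then obtain k where k: "q = [:- Re z, 1:] * k" by (auto simp: poly_eq_0_iff_dvd dvd_def)
    with q0 have "k \<noteq> 0" by auto
    then have "degree q = 1 + degree k" unfolding k by (subst degree_mult_eq) auto
    with k r show ?thesis by (intro linear[of "Re z" k]) auto
  next
    case False
    define d where "d = [:(Re z)\<^sup>2 + (Im z)\<^sup>2, -2 * Re z, 1:]"
    have d2: "degree d = 2" by (simp add: d_def)
    then have d0: "d \<noteq> 0" by auto
    have dz: "poly (?c d) z = 0"
      by (simp add: d_def map_poly_pCons complex_eq_iff power2_eq_square algebra_simps)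
    have "?c q = ?c d * ?c (q div d) + ?c (q mod d)"
      by (simp flip: map_of_real_mult map_of_real_add)
    with z dz have mz: "poly (?c (q mod d)) z = 0" by simp
    have "degree (q mod d) < 2" using degree_mod_less[OF d0, of q] d2 by auto
    then obtain u v where uv: "q mod d = [:u, v:]"
    proof -
      have "q mod d = [:coeff (q mod d) 0, coeff (q mod d) 1:]"
      proof (rule poly_eqI)
        fix n
        show "coeff (q mod d) n = coeff [:coeff (q mod d) 0, coeff (q mod d) 1:] n"
          using \<open>degree (q mod d) < 2\<close>
          by (cases n; cases "n - 1") (auto simp: coeff_pCons coeff_eq_0 split: nat.splits)
      qed
      then show ?thesis using that by blast
    qed
    with mz have "complex_of_real u + z * complex_of_real v = 0" by (simp add: map_poly_pCons)
    with False have "v = 0" "u = 0" by (auto simp: complex_eq_iff)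
    with uv have q: "q = d * (q div d)"
      using mult_div_mod_eq[of d q] by simp
    with q0 have "q div d \<noteq> 0" by auto
    then have "degree q = 2 + degree (q div d)"
      using degree_mult_eq[OF d0, of "q div d"] q d2 by simp
    with q False show ?thesis by (intro quadratic[of "Im z" "Re z" "q div d"]) (auto simp: d_def)
  qed
qed

text \<open>Replaces the spectral mapping theorem. A linear factor is bounded below because its root
  lies outside [0, norm T], which contains the numerical range of T; a quadratic one because (T -
  a)^2 + b^2 \<ge> b^2. Bounded-below operators compose.\<close>

lemma op_poly_bounded_below:
  assumes T: "positive_op T"
  shows "(\<And>x. 0 \<le> x \<Longrightarrow> x \<le> norm T \<Longrightarrow> poly q x \<noteq> 0) \<Longrightarrow>
    \<exists>\<delta>>0. \<forall>y. \<delta> * norm y \<le> norm (blinfun_apply (op_poly q T) y)"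
proof (induction "degree q" arbitrary: q rule: less_induct)
  case less
  have sym: "inner (blinfun_apply T x) y = inner x (blinfun_apply T y)"
    and pos: "0 \<le> inner x (blinfun_apply T x)" for x y
    using T by (auto simp: positive_op_def symmetric_op_def)
  have upper: "inner x (blinfun_apply T x) \<le> norm T * (norm x)\<^sup>2" for x
  proof -
    have "inner x (blinfun_apply T x) \<le> norm x * norm (blinfun_apply T x)" by (rule norm_cauchy_schwarz)
    also have "\<dots> \<le> norm x * (norm T * norm x)" by (intro mult_left_mono norm_blinfun) simp
    finally show ?thesis by (simp add: power2_eq_square mult_ac)
  qed
  show ?case
  proof (cases "degree q = 0")
    case True
    then obtain a where a: "q = [:a:]" by (rule degree_eq_zeroE)
    with less.prems[of 0] have "a \<noteq> 0" by simp
    with a show ?thesis by (intro exI[of _ "\<bar>a\<bar>"]) (simp add: op_poly_const blinfun.bilinear_simps)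
  next
    case False
    then have "0 < degree q" by simp
    then show ?thesis
    proof (cases q rule: real_poly_factor)
      case (linear r k)
      have "poly k x \<noteq> 0" if "0 \<le> x" "x \<le> norm T" for x
        using less.prems[OF that] linear(1) by auto
      with less.hyps[OF linear(3)] obtain \<delta> where
        \<delta>: "\<delta> > 0" "\<forall>y. \<delta> * norm y \<le> norm (blinfun_apply (op_poly k T) y)" by auto
      have r: "r < 0 \<or> norm T < r" using less.prems[of r] linear(2) by force
      have S: "op_poly [:-r, 1:] T = T - r *\<^sub>R id_blinfun" by (simp add: op_poly_pCons)
      have "\<exists>\<eta>>0. \<forall>y. \<eta> * (norm y)\<^sup>2 \<le> \<bar>inner y (blinfun_apply (T - r *\<^sub>R id_blinfun) y)\<bar>"
      proof -
        have e: "inner y (blinfun_apply (T - r *\<^sub>R id_blinfun) y) = inner y (blinfun_apply T y) - r * (norm y)\<^sup>2" for y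
          by (simp add: blinfun.bilinear_simps inner_diff_right power2_norm_eq_inner)
        from r show ?thesis
        proof
          assume "r < 0"
          then show ?thesis unfolding e using pos
            by (intro exI[of _ "- r"]) (smt (verit, ccfv_SIG) mult_minus_left)
        next
          assume "norm T < r"
          then show ?thesis unfolding e using upper
            by (intro exI[of _ "r - norm T"]) (smt (verit, ccfv_SIG) left_diff_distrib)
        qed
      qed
      then obtain \<eta> where \<eta>: "\<eta> > 0" "\<And>y. \<eta> * norm y \<le> norm (blinfun_apply (op_poly [:-r, 1:] T) y)"
        using bounded_below_by_form S by metis
      show ?thesis
      proof (intro exI[of _ "\<eta> * \<delta>"] conjI allI)
        fix y
        have "\<eta> * (\<delta> * norm y) \<le> \<eta> * norm (blinfun_apply (op_poly k T) y)"
          using \<eta>(1) \<delta>(2) by (intro mult_left_mono) auto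
        also have "\<dots> \<le> norm (blinfun_apply (op_poly q T) y)"
          using \<eta>(2)[of "blinfun_apply (op_poly k T) y"] 
          by (subst linear(1)) (simp only: op_poly_mult blinfun_apply_blinfun_compose)
        finally show "\<eta> * \<delta> * norm y \<le> norm (blinfun_apply (op_poly q T) y)" by (simp add: mult.assoc)
      qed (use \<eta> \<delta> in simp)
    next
      case (quadratic a b k)
      have "poly k x \<noteq> 0" if "0 \<le> x" "x \<le> norm T" for x
        using less.prems[OF that] quadratic(2) by auto
      with less.hyps[OF quadratic(3)] obtain \<delta> where
        \<delta>: "\<delta> > 0" "\<forall>y. \<delta> * norm y \<le> norm (blinfun_apply (op_poly k T) y)" by auto
      let ?d = "[:a\<^sup>2 + b\<^sup>2, -2 * a, 1:]"
      have "inner y (blinfun_apply (op_poly ?d T) y)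
          = (norm (blinfun_apply T y - a *\<^sub>R y))\<^sup>2 + b\<^sup>2 * (norm y)\<^sup>2" for y
      proof -
        have "inner y (blinfun_apply (op_poly ?d T) y) = (a\<^sup>2 + b\<^sup>2) * inner y y
            - 2 * a * inner y (blinfun_apply T y) + inner y (blinfun_apply T (blinfun_apply T y))"
          by (simp add: op_poly_pCons blinfun.bilinear_simps inner_add_right inner_diff_right)
        moreover have "inner y (blinfun_apply T (blinfun_apply T y)) = inner (blinfun_apply T y) (blinfun_apply T y)"
          by (simp add: sym)
        moreover have "(norm (blinfun_apply T y - a *\<^sub>R y))\<^sup>2 + b\<^sup>2 * (norm y)\<^sup>2
            = inner (blinfun_apply T y) (blinfun_apply T y) - 2 * a * inner y (blinfun_apply T y)
              + (a\<^sup>2 + b\<^sup>2) * inner y y"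
          unfolding power2_norm_eq_inner
          by (simp add: inner_diff_left inner_diff_right inner_commute algebra_simps power2_eq_square)
        ultimately show ?thesis by simp
      qed
      then have "b\<^sup>2 * (norm y)\<^sup>2 \<le> \<bar>inner y (blinfun_apply (op_poly ?d T) y)\<bar>" for y
        by simp
      then have \<eta>: "b\<^sup>2 * norm y \<le> norm (blinfun_apply (op_poly ?d T) y)" for y
        using bounded_below_by_form by metis
      show ?thesis
      proof (intro exI[of _ "b\<^sup>2 * \<delta>"] conjI allI)
        fix y
        have "b\<^sup>2 * (\<delta> * norm y) \<le> b\<^sup>2 * norm (blinfun_apply (op_poly k T) y)"
          using \<delta>(2) by (intro mult_left_mono) auto
        also have "\<dots> \<le> norm (blinfun_apply (op_poly q T) y)"
          using \<eta>[of "blinfun_apply (op_poly k T) y"]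
          by (subst quadratic(2)) (simp only: op_poly_mult blinfun_apply_blinfun_compose)
        finally show "b\<^sup>2 * \<delta> * norm y \<le> norm (blinfun_apply (op_poly q T) y)" by (simp add: mult.assoc)
      qed (use \<delta> quadratic(1) in simp)
    qed
  qed
qed

text \<open>If M = norm S exceeded m for S = p(T), then M^2 - p^2 would have no zero on [0, norm T],
  so M^2 - S^2 would be bounded below. But a symmetric S has vectors that nearly attain its norm,
  and M^2 - S^2 nearly annihilates them.\<close>

lemma norm_op_poly_le:
  assumes T: "positive_op T" and m: "\<And>x. 0 \<le> x \<Longrightarrow> x \<le> norm T \<Longrightarrow> \<bar>poly p x\<bar> \<le> m"
  shows "norm (op_poly p T) \<le> m"
proof (rule ccontr)
  assume neg: "\<not> norm (op_poly p T) \<le> m"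
  define S where "S = op_poly p T"
  define M where "M = norm S"
  have m0: "0 \<le> m" using m[of 0] by simp
  have mM: "m < M" using neg by (simp add: M_def S_def)
  have symS: "inner (blinfun_apply S x) y = inner x (blinfun_apply S y)" for x y
    using symmetric_op_poly[OF positive_op_symmetric[OF T]] by (auto simp: S_def symmetric_op_def)
  have "poly ([:M\<^sup>2:] - p * p) x \<noteq> 0" if "0 \<le> x" "x \<le> norm T" for x
  proof -
    have "poly p x * poly p x \<le> m\<^sup>2"
      using power_mono[OF m[OF that], of 2] by (simp add: power2_eq_square)
    also have "\<dots> < M\<^sup>2" using m0 mM by (intro power_strict_mono) auto
    finally show ?thesis by simp
  qed
  from op_poly_bounded_below[OF T this] obtain \<delta> where
    \<delta>: "\<delta> > 0" "\<And>y. \<delta> * norm y \<le> norm (blinfun_apply (op_poly ([:M\<^sup>2:] - p * p) T) y)" by blast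
  \<comment> \<open>Expanding norm ((M^2 - S^2) y)^2 \<ge> \<delta>^2 norm y^2 and estimating norm
    (S^2 y) \<le> M^2 norm y leaves norm (S y)^2 \<le> (M^2 - \<delta>^2 / (2 M^2)) norm
    y^2.\<close>
  define \<kappa> where "\<kappa> = sqrt (max 0 (M\<^sup>2 - \<delta>\<^sup>2 / (2 * M\<^sup>2)))"
  have M0: "0 < M" using m0 mM by simp
  have bound: "norm (blinfun_apply S y) \<le> \<kappa> * norm y" for y
  proof -
    let ?u = "blinfun_apply S y" and ?v = "blinfun_apply S (blinfun_apply S y)"
    have nu: "norm ?u \<le> M * norm y" and nv: "norm ?v \<le> M * norm ?u"
      unfolding M_def by (rule norm_blinfun)+
    have "(\<delta> * norm y)\<^sup>2 \<le> (norm (M\<^sup>2 *\<^sub>R y - ?v))\<^sup>2"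
      using \<delta> by (intro power_mono)
        (auto simp: op_poly_diff op_poly_const op_poly_mult blinfun.bilinear_simps S_def)
    also have "\<dots> = M^4 * (norm y)\<^sup>2 - 2 * M\<^sup>2 * inner y ?v + (norm ?v)\<^sup>2"
      unfolding power2_norm_eq_inner
      by (simp add: inner_diff_left inner_diff_right inner_commute algebra_simps power4_eq_xxxx power2_eq_square)
    also have "inner y ?v = (norm ?u)\<^sup>2"
      by (simp add: power2_norm_eq_inner flip: symS)
    also have "(norm ?v)\<^sup>2 \<le> (M * (M * norm y))\<^sup>2"
      using nv nu M0 by (intro power_mono) (auto intro: order_trans mult_left_mono)
    finally have "\<delta>\<^sup>2 * (norm y)\<^sup>2 \<le> 2 * M^4 * (norm y)\<^sup>2 - 2 * M\<^sup>2 * (norm ?u)\<^sup>2"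
      by (simp add: power_mult_distrib power4_eq_xxxx power2_eq_square algebra_simps)
    then have "(norm ?u)\<^sup>2 * (2 * M\<^sup>2) \<le> (2 * M^4 - \<delta>\<^sup>2) * (norm y)\<^sup>2"
      by (simp add: algebra_simps)
    then have "(norm ?u)\<^sup>2 \<le> (2 * M^4 - \<delta>\<^sup>2) * (norm y)\<^sup>2 / (2 * M\<^sup>2)"
      using M0 by (simp add: pos_le_divide_eq)
    also have "\<dots> = (M\<^sup>2 - \<delta>\<^sup>2 / (2 * M\<^sup>2)) * (norm y)\<^sup>2"
      using M0 by (simp add: field_simps power4_eq_xxxx power2_eq_square)
    also have "\<dots> \<le> \<kappa>\<^sup>2 * (norm y)\<^sup>2"
      unfolding \<kappa>_def by (intro mult_right_mono) auto
    finally have "(norm ?u)\<^sup>2 \<le> (\<kappa> * norm y)\<^sup>2" by (simp add: power_mult_distrib)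
    then show ?thesis by (rule power2_le_imp_le) (simp add: \<kappa>_def)
  qed
  have "M \<le> \<kappa>" unfolding M_def by (rule norm_blinfun_bound[OF _ bound]) (simp add: \<kappa>_def)
  moreover have "\<kappa> < M"
  proof -
    have "max 0 (M\<^sup>2 - \<delta>\<^sup>2 / (2 * M\<^sup>2)) < M\<^sup>2" using M0 \<delta>(1) by simp
    then have "\<kappa> < sqrt (M\<^sup>2)" unfolding \<kappa>_def by (rule real_sqrt_less_mono)
    with M0 show ?thesis by simp
  qed
  ultimately show False by simp
qed

section \<open>Continuous functional calculus\<close>

lemma op_poly_approx_diff:
  assumes T: "positive_op T"
    and p: "uniform_limit {0..norm T} (\<lambda>n. poly (p n)) f sequentially"
    and q: "uniform_limit {0..norm T} (\<lambda>n. poly (q n)) f sequentially"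
    and e: "0 < e"
  shows "\<exists>N. \<forall>m\<ge>N. \<forall>n\<ge>N. norm (op_poly (p m) T - op_poly (q n) T) \<le> e"
proof -
  have "0 < e / 2" using e by simp
  obtain N1 where N1: "\<And>n x. N1 \<le> n \<Longrightarrow> x \<in> {0..norm T} \<Longrightarrow> dist (poly (p n) x) (f x) < e/2"
    using uniform_limitD[OF p \<open>0 < e / 2\<close>] unfolding eventually_sequentially by blast
  obtain N2 where N2: "\<And>n x. N2 \<le> n \<Longrightarrow> x \<in> {0..norm T} \<Longrightarrow> dist (poly (q n) x) (f x) < e/2"
    using uniform_limitD[OF q \<open>0 < e / 2\<close>] unfolding eventually_sequentially by blast
  have "norm (op_poly (p m) T - op_poly (q n) T) \<le> e" if "m \<ge> max N1 N2" "n \<ge> max N1 N2" for m n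
    unfolding op_poly_diff[symmetric]
  proof (rule norm_op_poly_le[OF T])
    fix x assume "0 \<le> x" "x \<le> norm T"
    then have "dist (poly (p m) x) (f x) < e/2" "dist (poly (q n) x) (f x) < e/2"
      using that by (intro N1 N2; simp)+
    then have "\<bar>poly (p m) x - f x\<bar> < e/2" "\<bar>poly (q n) x - f x\<bar> < e/2"
      unfolding dist_real_def .
    then show "\<bar>poly (p m - q n) x\<bar> \<le> e" unfolding poly_diff by linarith
  qed
  then show ?thesis by blast
qed

text \<open>By \<open>norm_op_poly_le\<close> a uniformly convergent sequence of polynomials has
  Cauchy images, and two such sequences with the same limit have the same image limit. The given p
  also shows that the condition in \<open>op_calc\<close> is not vacuous, which makes the limit
  unique.\<close>

lemma op_calc_tendsto:
  assumes T: "positive_op T"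
    and p: "uniform_limit {0..norm T} (\<lambda>n. poly (p n)) f sequentially"
  shows "(\<lambda>n. op_poly (p n) T) \<longlonglongrightarrow> op_calc f T"
proof -
  have "Cauchy (\<lambda>n. op_poly (p n) T)"
  proof (rule metric_CauchyI)
    fix e :: real assume "0 < e"
    then obtain N where N: "\<forall>m\<ge>N. \<forall>n\<ge>N. norm (op_poly (p m) T - op_poly (p n) T) \<le> e/2"
      using op_poly_approx_diff[OF T p p, of "e/2"] by auto
    have "dist (op_poly (p m) T) (op_poly (p n) T) < e" if "m \<ge> N" "n \<ge> N" for m n
    proof -
      have "norm (op_poly (p m) T - op_poly (p n) T) \<le> e/2" using N that by blast
      with \<open>0 < e\<close> show ?thesis unfolding dist_norm by linarith
    qed
    then show "\<exists>N. \<forall>m\<ge>N. \<forall>n\<ge>N. dist (op_poly (p m) T) (op_poly (p n) T) < e" by blast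
  qed
  then obtain S where S: "(\<lambda>n. op_poly (p n) T) \<longlonglongrightarrow> S"
    using Cauchy_convergent convergent_def by blast
  have "op_calc f T = S"
    unfolding op_calc_def
  proof (rule the_equality)
    show "\<forall>q. uniform_limit {0..norm T} (\<lambda>n. poly (q n)) f sequentially \<longrightarrow> (\<lambda>n. op_poly (q n) T) \<longlonglongrightarrow> S"
    proof (intro allI impI)
      fix q :: "nat \<Rightarrow> real poly"
      assume q: "uniform_limit {0..norm T} (\<lambda>n. poly (q n)) f sequentially"
      have "(\<lambda>n. op_poly (q n) T - op_poly (p n) T) \<longlonglongrightarrow> 0"
      proof (rule LIMSEQ_I)
        fix e :: real assume "0 < e"
        then obtain N where "\<forall>m\<ge>N. \<forall>n\<ge>N. norm (op_poly (q m) T - op_poly (p n) T) \<le> e/2"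
          using op_poly_approx_diff[OF T q p, of "e/2"] by auto
        then have "\<forall>n\<ge>N. norm (op_poly (q n) T - op_poly (p n) T - 0) < e"
          using \<open>0 < e\<close> by (force intro: le_less_trans)
        then show "\<exists>N. \<forall>n\<ge>N. norm (op_poly (q n) T - op_poly (p n) T - 0) < e" by blast
      qed
      from tendsto_add[OF this S] show "(\<lambda>n. op_poly (q n) T) \<longlonglongrightarrow> S" by simp
    qed
  next
    fix R assume "\<forall>q. uniform_limit {0..norm T} (\<lambda>n. poly (q n)) f sequentially \<longrightarrow> (\<lambda>n. op_poly (q n) T) \<longlonglongrightarrow> R"
    with p have "(\<lambda>n. op_poly (p n) T) \<longlonglongrightarrow> R" by blast
    with S show "R = S" using LIMSEQ_unique by blast
  qed
  with S show ?thesis by simp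
qed

lemma poly_approximation:
  fixes f :: "real \<Rightarrow> real"
  assumes "continuous_on {0..c} f"
  obtains p where "uniform_limit {0..c} (\<lambda>n. poly (p n)) f sequentially"
proof -
  have "\<exists>q :: real poly. \<forall>x\<in>{0..c}. \<bar>f x - poly q x\<bar> < inverse (real (Suc n))" for n
  proof -
    obtain g where g: "real_polynomial_function g" "\<And>x. x \<in> {0..c} \<Longrightarrow> \<bar>f x - g x\<bar> < inverse (real (Suc n))"
      using Stone_Weierstrass_real_polynomial_function[OF compact_Icc assms, of "inverse (real (Suc n))"]
      by auto
    then obtain a N where "g = (\<lambda>x. \<Sum>i\<le>N. a i * x ^ i)"
      by (auto simp: real_polynomial_function_iff_sum)
    then have "poly (\<Sum>i\<le>N. monom (a i) i) = g"
      by (auto simp: poly_sum poly_monom)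
    with g show ?thesis by metis
  qed
  then obtain p :: "nat \<Rightarrow> real poly" where
    p: "\<And>n x. x \<in> {0..c} \<Longrightarrow> \<bar>f x - poly (p n) x\<bar> < inverse (real (Suc n))" by metis
  have "uniform_limit {0..c} (\<lambda>n. poly (p n)) f sequentially"
  proof (rule uniform_limitI)
    fix e :: real assume "0 < e"
    then obtain N where N: "inverse (real (Suc N)) < e" using reals_Archimedean by blast
    have "dist (poly (p n) x) (f x) < e" if "n \<ge> N" "x \<in> {0..c}" for n x
    proof -
      have "inverse (real (Suc n)) \<le> inverse (real (Suc N))" using that by (simp add: field_simps)
      with p[OF that(2), of n] N show ?thesis unfolding dist_real_def by linarith
    qed
    then show "\<forall>\<^sub>F n in sequentially. \<forall>x\<in>{0..c}. dist (poly (p n) x) (f x) < e"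
      unfolding eventually_sequentially by blast
  qed
  then show ?thesis by (rule that)
qed

lemma op_calc_poly:
  assumes "positive_op T" "\<And>x. 0 \<le> x \<Longrightarrow> x \<le> norm T \<Longrightarrow> f x = poly p x"
  shows "op_calc f T = op_poly p T"
proof -
  have "uniform_limit {0..norm T} (\<lambda>n. poly p) f sequentially"
    by (rule uniform_limitI) (use assms(2) in auto)
  from op_calc_tendsto[OF assms(1) this] show ?thesis
    by (simp add: LIMSEQ_const_iff)
qed

lemma op_calc_add:
  assumes T: "positive_op T" and f: "continuous_on {0..norm T} f" and g: "continuous_on {0..norm T} g"
  shows "op_calc (\<lambda>x. f x + g x) T = op_calc f T + op_calc g T"
proof -
  obtain p where p: "uniform_limit {0..norm T} (\<lambda>n. poly (p n)) f sequentially"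
    using poly_approximation[OF f] .
  obtain q where q: "uniform_limit {0..norm T} (\<lambda>n. poly (q n)) g sequentially"
    using poly_approximation[OF g] .
  have "uniform_limit {0..norm T} (\<lambda>n. poly (p n + q n)) (\<lambda>x. f x + g x) sequentially"
    using uniform_limit_add[OF p q] by (simp add: poly_add[abs_def])
  from op_calc_tendsto[OF T this] have "(\<lambda>n. op_poly (p n) T + op_poly (q n) T) \<longlonglongrightarrow> op_calc (\<lambda>x. f x + g x) T"
    by (simp add: op_poly_add)
  moreover have "(\<lambda>n. op_poly (p n) T + op_poly (q n) T) \<longlonglongrightarrow> op_calc f T + op_calc g T"
    by (intro tendsto_add op_calc_tendsto T p q)
  ultimately show ?thesis by (rule LIMSEQ_unique)
qed

lemma op_calc_mult:
  assumes T: "positive_op T" and f: "continuous_on {0..norm T} f" and g: "continuous_on {0..norm T} g"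
  shows "op_calc (\<lambda>x. f x * g x) T = op_calc f T o\<^sub>L op_calc g T"
proof -
  obtain p where p: "uniform_limit {0..norm T} (\<lambda>n. poly (p n)) f sequentially"
    using poly_approximation[OF f] .
  obtain q where q: "uniform_limit {0..norm T} (\<lambda>n. poly (q n)) g sequentially"
    using poly_approximation[OF g] .
  have "bounded (f ` {0..norm T})" "bounded (g ` {0..norm T})"
    by (intro compact_imp_bounded compact_continuous_image f g compact_Icc)+
  from uniform_lim_mult[OF p q this]
  have "uniform_limit {0..norm T} (\<lambda>n. poly (p n * q n)) (\<lambda>x. f x * g x) sequentially"
    by (simp add: poly_mult[abs_def])
  from op_calc_tendsto[OF T this] have "(\<lambda>n. op_poly (p n) T o\<^sub>L op_poly (q n) T) \<longlonglongrightarrow> op_calc (\<lambda>x. f x * g x) T"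
    by (simp add: op_poly_mult)
  moreover have "(\<lambda>n. op_poly (p n) T o\<^sub>L op_poly (q n) T) \<longlonglongrightarrow> (op_calc f T o\<^sub>L op_calc g T)"
    by (intro tendsto_oL op_calc_tendsto T p q)
  ultimately show ?thesis by (rule LIMSEQ_unique)
qed

lemma op_calc_cong:
  assumes "\<And>x. 0 \<le> x \<Longrightarrow> x \<le> norm T \<Longrightarrow> f x = g x"
  shows "op_calc f T = op_calc g T"
proof -
  have "uniform_limit {0..norm T} (\<lambda>n. poly (p n)) f sequentially
    \<longleftrightarrow> uniform_limit {0..norm T} (\<lambda>n. poly (p n)) g sequentially" for p
    by (rule uniform_limit_cong') (use assms in auto)
  then show ?thesis unfolding op_calc_def by simp
qed

lemma op_calc_in_closed:
  assumes "positive_op T" "continuous_on {0..norm T} f" "closed C" "\<And>p. op_poly p T \<in> C"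
  shows "op_calc f T \<in> C"
proof -
  obtain p where p: "uniform_limit {0..norm T} (\<lambda>n. poly (p n)) f sequentially"
    using poly_approximation[OF assms(2)] .
  show ?thesis
    by (rule closed_sequentially[OF assms(3) _ op_calc_tendsto[OF assms(1) p]]) (use assms(4) in auto)
qed

lemma closed_symmetric_op: "closed {T. symmetric_op T}"
  unfolding symmetric_op_def
  by (intro closed_Collect_all closed_Collect_eq continuous_intros)

lemma symmetric_op_calc:
  assumes "positive_op T" "continuous_on {0..norm T} f"
  shows "symmetric_op (op_calc f T)"
  using op_calc_in_closed[OF assms closed_symmetric_op] symmetric_op_poly positive_op_symmetric assms(1)
  by blast

lemma positive_op_square:
  assumes "symmetric_op T" shows "positive_op (T o\<^sub>L T)"
  using assms by (auto simp: positive_op_def symmetric_op_def) (metis inner_ge_zero)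

lemma norm_symmetric_square:
  assumes "symmetric_op T" shows "norm (T o\<^sub>L T) = (norm T)\<^sup>2"
proof (rule antisym)
  show "norm (T o\<^sub>L T) \<le> (norm T)\<^sup>2"
    by (simp add: norm_blinfun_compose power2_eq_square)
  have "norm T \<le> sqrt (norm (T o\<^sub>L T))"
  proof (rule norm_blinfun_bound)
    fix x
    have "(norm (blinfun_apply T x))\<^sup>2 = inner x (blinfun_apply (T o\<^sub>L T) x)"
      using assms by (simp add: power2_norm_eq_inner symmetric_op_def)
    also have "\<dots> \<le> norm x * norm (blinfun_apply (T o\<^sub>L T) x)" by (rule norm_cauchy_schwarz)
    also have "\<dots> \<le> norm x * (norm (T o\<^sub>L T) * norm x)" by (intro mult_left_mono norm_blinfun) simp
    finally have "(norm (blinfun_apply T x))\<^sup>2 \<le> (sqrt (norm (T o\<^sub>L T)) * norm x)\<^sup>2"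
      unfolding power_mult_distrib by (simp add: power2_eq_square mult_ac)
    then show "norm (blinfun_apply T x) \<le> sqrt (norm (T o\<^sub>L T)) * norm x"
      by (rule power2_le_imp_le) simp
  qed simp
  from power_mono[OF this, of 2] show "(norm T)\<^sup>2 \<le> norm (T o\<^sub>L T)" by simp
qed

text \<open>If p_n approximates the square root on [0, norm Y^2], then p_n(x^2) approximates x on
  [0, norm Y], because norm (Y^2) = (norm Y)^2. This computes \<open>Lp_norm\<close> with exponent 1
  on positive operators.\<close>

lemma op_calc_sqrt_square:
  assumes Y: "positive_op Y"
  shows "op_calc (\<lambda>x. x powr (1/2)) (Y o\<^sub>L Y) = Y"
proof -
  have sym: "symmetric_op Y" using Y by (rule positive_op_symmetric)
  have n: "norm (Y o\<^sub>L Y) = (norm Y)\<^sup>2" by (rule norm_symmetric_square[OF sym])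
  have cont: "continuous_on {0..norm (Y o\<^sub>L Y)} (\<lambda>x::real. x powr (1/2))"
    by (intro continuous_on_powr' continuous_intros) auto
  then obtain p where p: "uniform_limit {0..norm (Y o\<^sub>L Y)} (\<lambda>n. poly (p n)) (\<lambda>x. x powr (1/2)) sequentially"
    using poly_approximation by blast
  have "uniform_limit {0..norm Y} (\<lambda>n. poly (pcompose (p n) [:0, 0, 1:])) (\<lambda>x. x) sequentially"
  proof (rule uniform_limitI)
    fix e :: real assume "0 < e"
    from uniform_limitD[OF p this]
    show "\<forall>\<^sub>F n in sequentially. \<forall>x\<in>{0..norm Y}. dist (poly (pcompose (p n) [:0, 0, 1:]) x) x < e"
    proof (rule eventually_mono)
      fix n assume *: "\<forall>x\<in>{0..norm (Y o\<^sub>L Y)}. dist (poly (p n) x) (x powr (1/2)) < e"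
      show "\<forall>x\<in>{0..norm Y}. dist (poly (pcompose (p n) [:0, 0, 1:]) x) x < e"
      proof
        fix x assume x: "x \<in> {0..norm Y}"
        then have "x * x \<in> {0..norm (Y o\<^sub>L Y)}" 
          unfolding n by (auto simp: power2_eq_square intro: mult_mono)
        moreover have "(x * x) powr (1/2) = x" using x by (simp add: powr_half_sqrt)
        ultimately show "dist (poly (pcompose (p n) [:0, 0, 1:]) x) x < e"
          using * by (metis (no_types, lifting) poly_pcompose mult.right_neutral mult_zero_left mult_zero_right 
            add.left_neutral poly_pCons poly_0 add.right_neutral)
      qed
    qed
  qed
  from op_calc_tendsto[OF Y this]
  have "(\<lambda>n. op_poly (p n) (Y o\<^sub>L Y)) \<longlonglongrightarrow> op_calc (\<lambda>x. x) Y"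
    by (simp add: op_poly_pcompose op_poly_pCons)
  moreover have "op_calc (\<lambda>x. x) Y = Y"
    using op_calc_poly[OF Y, of "\<lambda>x. x" "[:0, 1:]"] by (simp add: op_poly_pCons)
  moreover have "(\<lambda>n. op_poly (p n) (Y o\<^sub>L Y)) \<longlonglongrightarrow> op_calc (\<lambda>x. x powr (1/2)) (Y o\<^sub>L Y)"
    by (intro op_calc_tendsto positive_op_square sym p)
  ultimately show ?thesis using LIMSEQ_unique by metis
qed

section \<open>Trace inequalities in a tracial von Neumann algebra\<close>

text \<open>\<open>von_neumann_algebra\<close> speaks only of adjoints and of the bicommutant; the
  algebra operations, and below the norm closedness, come from the algebra being a
  commutant.\<close>

lemma commutant_closed_ops:
  assumes "B \<subseteq> clin_ops"
  shows "id_blinfun \<in> commutant B"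
    and "S \<in> commutant B \<Longrightarrow> T \<in> commutant B \<Longrightarrow> S + T \<in> commutant B"
    and "S \<in> commutant B \<Longrightarrow> T \<in> commutant B \<Longrightarrow> S o\<^sub>L T \<in> commutant B"
    and "T \<in> commutant B \<Longrightarrow> scaleC_op c T \<in> commutant B"
proof -
  show "id_blinfun \<in> commutant B" by (auto simp: commutant_def clin_id)
  show "S \<in> commutant B \<Longrightarrow> T \<in> commutant B \<Longrightarrow> S + T \<in> commutant B"
    by (auto simp: commutant_def clin_add oL_bilinear)
  show "T \<in> commutant B \<Longrightarrow> scaleC_op c T \<in> commutant B"
    using assms by (auto simp: commutant_def clin_scaleC scaleC_oL_left scaleC_oL_right subset_iff)
  show "S \<in> commutant B \<Longrightarrow> T \<in> commutant B \<Longrightarrow> S o\<^sub>L T \<in> commutant B"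
    unfolding commutant_def by (auto intro: clin_oL) (metis oL_assoc)
qed

lemma continuous_on_oL:
  "continuous_on D f \<Longrightarrow> continuous_on D g \<Longrightarrow> continuous_on D (\<lambda>x. f x o\<^sub>L g x :: bop)"
  by (rule bounded_bilinear.continuous_on[OF bounded_bilinear_blinfun_compose])

lemma closed_commutant: "closed (commutant B)"
proof -
  have "commutant B = {T. T o\<^sub>L iop = iop o\<^sub>L T} \<inter> (\<Inter>S\<in>B. {T. S o\<^sub>L T = T o\<^sub>L S})"
    by (auto simp: commutant_def clin_ops_def)
  then show ?thesis
    by (auto intro!: closed_Int closed_INT closed_Collect_eq continuous_on_oL continuous_on_id continuous_on_const)
qed

lemma positive_op_norm_minus:
  assumes "symmetric_op S" shows "positive_op (S + norm S *\<^sub>R id_blinfun)"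
proof -
  have "0 \<le> inner x (blinfun_apply S x) + norm S * (norm x)\<^sup>2" for x
  proof -
    have "\<bar>inner x (blinfun_apply S x)\<bar> \<le> norm x * norm (blinfun_apply S x)" by (rule Cauchy_Schwarz_ineq2)
    also have "\<dots> \<le> norm x * (norm S * norm x)" by (intro mult_left_mono norm_blinfun) simp
    finally show ?thesis by (simp add: power2_eq_square mult_ac)
  qed
  with assms show ?thesis
    by (simp add: positive_op_def symmetric_op_def blinfun.bilinear_simps inner_add_left inner_add_right
        power2_norm_eq_inner)
qed

text \<open>Polarisation for x and the multiple y of Z x that has the norm of x, followed by the
  parallelogram identity.\<close>

lemma norm_le_numerical_radius:
  assumes sym: "symmetric_op Z" and e: "0 \<le> e"
    and b: "\<And>x. \<bar>inner x (blinfun_apply Z x)\<bar> \<le> e * (norm x)\<^sup>2"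
  shows "norm Z \<le> e"
proof (rule norm_blinfun_bound[OF e])
  fix x
  let ?z = "blinfun_apply Z x"
  show "norm ?z \<le> e * norm x"
  proof (cases "?z = 0")
    case False
    then have z: "norm ?z > 0" by simp
    define y where "y = (norm x / norm ?z) *\<^sub>R ?z"
    have ny: "norm y = norm x" using z by (simp add: y_def)
    have "4 * inner y ?z = inner (x + y) (blinfun_apply Z (x + y)) - inner (x - y) (blinfun_apply Z (x - y))"
    proof -
      have "inner x (blinfun_apply Z y) = inner y ?z"
        using symmetric_opD[OF sym, of x y] by (simp add: inner_commute)
      then show ?thesis
        by (simp add: blinfun.bilinear_simps inner_add_left inner_add_right inner_diff_left inner_diff_right)
    qed
    also have "\<dots> \<le> e * (norm (x + y))\<^sup>2 + e * (norm (x - y))\<^sup>2"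
      using b[of "x + y"] b[of "x - y"] by linarith
    also have "\<dots> = e * ((norm (x + y))\<^sup>2 + (norm (x - y))\<^sup>2)" by (simp add: algebra_simps)
    also have "(norm (x + y))\<^sup>2 + (norm (x - y))\<^sup>2 = 2 * (norm x)\<^sup>2 + 2 * (norm y)\<^sup>2"
      unfolding power2_norm_eq_inner
      by (simp add: inner_add_left inner_add_right inner_diff_left inner_diff_right)
    finally have "inner y ?z \<le> e * (norm x)\<^sup>2" using ny by simp
    moreover have "inner y ?z = norm x * norm ?z"
      using z by (simp add: y_def flip: power2_norm_eq_inner) (simp add: power2_eq_square)
    ultimately have "norm x * norm ?z \<le> norm x * (e * norm x)" by (simp add: power2_eq_square mult_ac)
    moreover have "norm x > 0" using False by (auto simp: blinfun.bilinear_simps)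
    ultimately show ?thesis by simp
  qed (use e in simp)
qed

lemma norm_iop_oL: "norm (iop o\<^sub>L T) \<le> norm T"
proof -
  have "norm (blinfun_apply iop x) = norm x" for x
  proof -
    have "inner (blinfun_apply iop x) (blinfun_apply iop x) = inner x x"
      using inner_iop_left[of x "blinfun_apply iop x"] iop_squared
      by (metis add.inverse_inverse blinfun.minus_left blinfun_apply_blinfun_compose blinfun_apply_id_blinfun id_apply inner_minus_right)
    then show ?thesis by (simp add: norm_eq_sqrt_inner)
  qed
  then have "norm (blinfun_apply (iop o\<^sub>L T) x) \<le> norm T * norm x" for x
    by (simp add: norm_blinfun)
  then show ?thesis by (intro norm_blinfun_bound) auto
qed

section \<open>Algebra operations and the trace on a tracial von Neumann algebra\<close>

locale tracial_algebra =
  fixes M :: tracial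
  assumes tracial: "tracial_Wstar M"
begin

abbreviation "A \<equiv> fst M"
abbreviation "\<tau> \<equiv> snd M"

lemma A_bicommutant: "commutant (commutant A) = A"
  using tracial by (simp add: tracial_Wstar_def von_neumann_algebra_def)

lemma commutant_clin: "commutant B \<subseteq> clin_ops"
  by (auto simp: commutant_def)

lemma A_clin: "T \<in> A \<Longrightarrow> T \<in> clin_ops"
  using A_bicommutant commutant_clin by blast

lemma A_id: "id_blinfun \<in> A"
  and A_add: "S \<in> A \<Longrightarrow> T \<in> A \<Longrightarrow> S + T \<in> A"
  and A_oL: "S \<in> A \<Longrightarrow> T \<in> A \<Longrightarrow> S o\<^sub>L T \<in> A"
  and A_scaleC: "T \<in> A \<Longrightarrow> scaleC_op c T \<in> A"
  using commutant_closed_ops[of "commutant A", OF commutant_clin] unfolding A_bicommutant by blast+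

lemma A_adj: "T \<in> A \<Longrightarrow> adj T \<in> A"
  using tracial by (simp add: tracial_Wstar_def von_neumann_algebra_def)

lemma A_scaleR: "T \<in> A \<Longrightarrow> r *\<^sub>R T \<in> A"
  using A_scaleC[of T "of_real r"] by (simp add: scaleC_op_of_real)

lemma A_zero: "0 \<in> A"
  using A_scaleR[OF A_id, of 0] by simp

lemma A_diff: "S \<in> A \<Longrightarrow> T \<in> A \<Longrightarrow> S - T \<in> A"
  using A_add[of S "-1 *\<^sub>R T"] A_scaleR[of T "-1"] by simp

lemma A_sum: "(\<And>i. i \<in> I \<Longrightarrow> f i \<in> A) \<Longrightarrow> (\<Sum>i\<in>I. f i) \<in> A"
  by (induction I rule: infinite_finite_induct) (auto simp: A_zero A_add)

lemma closed_A: "closed A"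
  using closed_commutant[of "commutant A"] by (simp add: A_bicommutant)

lemmas A_intros = A_id A_add A_oL A_scaleC A_adj A_scaleR A_zero A_diff

lemma sa_iff_symmetric: "T \<in> A \<Longrightarrow> adj T = T \<longleftrightarrow> symmetric_op T"
  by (metis A_clin adj_eqI inner_adj_left symmetric_op_def)

lemma sa_A: "T \<in> sa A \<Longrightarrow> T \<in> A"
  and sa_adj: "T \<in> sa A \<Longrightarrow> adj T = T"
  and sa_symmetric: "T \<in> sa A \<Longrightarrow> symmetric_op T"
  by (auto simp: sa_def sa_iff_symmetric)

lemma saI: "T \<in> A \<Longrightarrow> symmetric_op T \<Longrightarrow> T \<in> sa A"
  by (auto simp: sa_def sa_iff_symmetric)

lemma closed_sa: "closed (sa A)"
proof -
  have "sa A = A \<inter> {T. symmetric_op T}" using sa_A sa_symmetric saI by blast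
  then show ?thesis using closed_A closed_symmetric_op by auto
qed

lemma sa_add: "S \<in> sa A \<Longrightarrow> T \<in> sa A \<Longrightarrow> S + T \<in> sa A"
  and sa_diff: "S \<in> sa A \<Longrightarrow> T \<in> sa A \<Longrightarrow> S - T \<in> sa A"
  and sa_scaleR: "T \<in> sa A \<Longrightarrow> r *\<^sub>R T \<in> sa A"
  and sa_zero: "0 \<in> sa A"
  and sa_id: "id_blinfun \<in> sa A"
  by (auto simp: sa_def A_intros adj_add adj_diff adj_scaleR adj_zero adj_id A_clin)

lemma state: "faithful_normal_tracial_state A \<tau>"
  using tracial by (simp add: tracial_Wstar_def)

lemma tau_add: "S \<in> A \<Longrightarrow> T \<in> A \<Longrightarrow> \<tau> (S + T) = \<tau> S + \<tau> T"
  and tau_scaleC: "T \<in> A \<Longrightarrow> \<tau> (scaleC_op c T) = c * \<tau> T"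
  and tau_id: "\<tau> id_blinfun = 1"
  and tau_square_real: "T \<in> A \<Longrightarrow> Im (\<tau> (adj T o\<^sub>L T)) = 0"
  and tau_square_nonneg: "T \<in> A \<Longrightarrow> 0 \<le> Re (\<tau> (adj T o\<^sub>L T))"
  and tau_faithful: "T \<in> A \<Longrightarrow> \<tau> (adj T o\<^sub>L T) = 0 \<Longrightarrow> T = 0"
  and tau_comm: "S \<in> A \<Longrightarrow> T \<in> A \<Longrightarrow> \<tau> (S o\<^sub>L T) = \<tau> (T o\<^sub>L S)"
  using state by (auto simp: faithful_normal_tracial_state_def)

lemma tau_scaleR: "T \<in> A \<Longrightarrow> \<tau> (r *\<^sub>R T) = of_real r * \<tau> T"
  using tau_scaleC[of T "of_real r"] by (simp add: scaleC_op_of_real)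

lemma tau_zero: "\<tau> 0 = 0"
  using tau_scaleR[OF A_id, of 0] by simp

lemma tau_diff: "S \<in> A \<Longrightarrow> T \<in> A \<Longrightarrow> \<tau> (S - T) = \<tau> S - \<tau> T"
  using tau_add[of S "-1 *\<^sub>R T"] A_scaleR[of T "-1"] tau_scaleR[of T "-1"] by simp

lemma tau_sum: "(\<And>i. i \<in> I \<Longrightarrow> f i \<in> A) \<Longrightarrow> \<tau> (\<Sum>i\<in>I. f i) = (\<Sum>i\<in>I. \<tau> (f i))"
  by (induction I rule: infinite_finite_induct) (auto simp: tau_zero tau_add A_sum)

lemma tau_square_of_real: "T \<in> A \<Longrightarrow> \<tau> (adj T o\<^sub>L T) = of_real (Re (\<tau> (adj T o\<^sub>L T)))"
  using tau_square_real by (simp add: complex_eq_iff)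

lemma tau_faithful_Re: "T \<in> A \<Longrightarrow> Re (\<tau> (adj T o\<^sub>L T)) = 0 \<Longrightarrow> T = 0"
  using tau_faithful tau_square_of_real by (metis of_real_0)

text \<open>Polarisation: \<tau> is real on squares \<open>adj S o\<^sub>L S\<close>; S = 1 + c T
  with c = 1 compares the imaginary parts and with c = \<i> the real parts.\<close>

lemma tau_adj:
  assumes "T \<in> A" shows "\<tau> (adj T) = cnj (\<tau> T)"
proof -
  have im: "Im (\<tau> (adj T) * cnj c + c * \<tau> T) = 0" for c
  proof -
    let ?S = "id_blinfun + scaleC_op c T"
    have S: "?S \<in> A" "scaleC_op c T \<in> A" "scaleC_op (cnj c) (adj T) \<in> A" using assms by (auto intro!: A_intros)
    have e: "adj ?S o\<^sub>L ?S = id_blinfun + scaleC_op c T + scaleC_op (cnj c) (adj T) + (adj (scaleC_op c T) o\<^sub>L scaleC_op c T)"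
      using assms by (simp add: adj_add adj_id adj_scaleC A_clin clin_id clin_scaleC oL_bilinear algebra_simps)
    have "adj (scaleC_op c T) o\<^sub>L scaleC_op c T \<in> A" using S by (auto intro!: A_intros)
    then have "\<tau> (adj ?S o\<^sub>L ?S) = 1 + c * \<tau> T + cnj c * \<tau> (adj T) + \<tau> (adj (scaleC_op c T) o\<^sub>L scaleC_op c T)"
      unfolding e using S assms by (simp add: tau_add tau_scaleC tau_id A_intros)
    with tau_square_real[OF S(1)] tau_square_real[OF S(2)] show ?thesis by (simp add: mult.commute)
  qed
  from im[of 1] im[of \<i>] show ?thesis by (simp add: complex_eq_iff)
qed

text \<open>Positivity on T - c S at the minimising c = z / b; if b = 0, faithfulness gives S =
  0.\<close>

lemma tau_Cauchy_Schwarz: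
  assumes S: "S \<in> A" and T: "T \<in> A"
  shows "cmod (\<tau> (adj S o\<^sub>L T)) \<le> sqrt (Re (\<tau> (adj S o\<^sub>L S))) * sqrt (Re (\<tau> (adj T o\<^sub>L T)))"
proof -
  define a b z where "a = Re (\<tau> (adj T o\<^sub>L T))" and "b = Re (\<tau> (adj S o\<^sub>L S))" and "z = \<tau> (adj S o\<^sub>L T)"
  have ab: "0 \<le> a" "0 \<le> b" using assms by (auto simp: a_def b_def tau_square_nonneg)
  have key: "0 \<le> a - 2 * Re (cnj c * z) + (cmod c)\<^sup>2 * b" for c
  proof -
    let ?R = "T - scaleC_op c S"
    have R: "?R \<in> A" using assms by (auto intro!: A_intros)
    have e: "adj ?R o\<^sub>L ?R = (adj T o\<^sub>L T) - scaleC_op c (adj T o\<^sub>L S) - scaleC_op (cnj c) (adj S o\<^sub>L T)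
        + scaleC_op (cnj c * c) (adj S o\<^sub>L S)"
      using assms by (simp add: adj_diff adj_scaleC A_clin clin_scaleC adj_clin oL_bilinear scaleC_oL_left scaleC_oL_right scaleC_scaleC algebra_simps)
    have "adj T o\<^sub>L S = adj (adj S o\<^sub>L T)" using assms by (simp add: adj_oL adj_adj A_clin adj_clin)
    then have "\<tau> (adj T o\<^sub>L S) = cnj z" unfolding z_def using assms by (simp add: tau_adj A_intros)
    then have "\<tau> (adj ?R o\<^sub>L ?R) = \<tau> (adj T o\<^sub>L T) - c * cnj z - cnj c * z + cnj c * c * \<tau> (adj S o\<^sub>L S)"
      unfolding e using assms by (simp add: tau_add tau_diff tau_scaleC A_intros z_def)
    also have "cnj c * c = of_real ((cmod c)\<^sup>2)" by (subst complex_norm_square) (rule mult.commute)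
    finally have "Re (\<tau> (adj ?R o\<^sub>L ?R)) = a - 2 * Re (cnj c * z) + (cmod c)\<^sup>2 * b"
      by (simp add: a_def b_def)
    with tau_square_nonneg[OF R] show ?thesis by simp
  qed
  have "(cmod z)\<^sup>2 \<le> b * a"
  proof (cases "b = 0")
    case True
    then have "S = 0" using tau_faithful_Re[OF S] by (simp add: b_def)
    then have "z = 0" by (simp add: z_def adj_zero tau_zero)
    then show ?thesis using ab by simp
  next
    case False
    with ab have b: "b > 0" by simp
    have zz: "Re (cnj z * z) = (cmod z)\<^sup>2" unfolding cmod_power2 by (simp add: power2_eq_square)
    have r: "Re (cnj (z / of_real b) * z) = (cmod z)\<^sup>2 / b"
    proof -
      have "cnj (z / of_real b) * z = (cnj z * z) / of_real b" by simp
      then show ?thesis using zz by (metis Re_divide_of_real)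
    qed
    have "0 \<le> a - 2 * ((cmod z)\<^sup>2 / b) + (cmod z / b)\<^sup>2 * b"
      using key[of "z / of_real b"] b unfolding r by (simp add: norm_divide)
    also have "\<dots> = a - (cmod z)\<^sup>2 / b" using b by (simp add: field_simps power2_eq_square)
    finally show ?thesis using b by (simp add: field_simps)
  qed
  then have "sqrt ((cmod z)\<^sup>2) \<le> sqrt (b * a)" by (rule real_sqrt_le_mono)
  then show ?thesis by (simp add: real_sqrt_mult z_def a_def b_def)
qed

section \<open>Functional calculus inside the algebra, Hoelder-type inequalities and duality\<close>

lemma A_op_poly: "T \<in> A \<Longrightarrow> op_poly p T \<in> A"
  by (induction p) (auto simp: op_poly_pCons A_intros)

lemma sa_op_calc:
  assumes "T \<in> A" "positive_op T" "continuous_on {0..norm T} f"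
  shows "op_calc f T \<in> sa A"
  using assms by (intro saI op_calc_in_closed symmetric_op_calc closed_A A_op_poly)

text \<open>Positivity takes the form of being the square of a self-adjoint element of the algebra,
  because this is the form to which the axioms of the trace apply.\<close>

lemma op_calc_square:
  assumes T: "T \<in> A" "positive_op T" and f: "continuous_on {0..norm T} f" "\<And>x. 0 \<le> x \<Longrightarrow> x \<le> norm T \<Longrightarrow> 0 \<le> f x"
  obtains Q where "Q \<in> sa A" "op_calc f T = Q o\<^sub>L Q"
proof
  have c: "continuous_on {0..norm T} (\<lambda>x. sqrt (f x))" by (intro continuous_on_real_sqrt f(1))
  show "op_calc (\<lambda>x. sqrt (f x)) T \<in> sa A" by (rule sa_op_calc[OF T c])
  have "op_calc f T = op_calc (\<lambda>x. sqrt (f x) * sqrt (f x)) T"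
    by (rule op_calc_cong) (simp add: f(2))
  also have "\<dots> = op_calc (\<lambda>x. sqrt (f x)) T o\<^sub>L op_calc (\<lambda>x. sqrt (f x)) T"
    by (rule op_calc_mult[OF T(2) c c])
  finally show "op_calc f T = op_calc (\<lambda>x. sqrt (f x)) T o\<^sub>L op_calc (\<lambda>x. sqrt (f x)) T" .
qed

lemma op_calc_id: "positive_op T \<Longrightarrow> op_calc (\<lambda>x. x) T = T"
  using op_calc_poly[of T "\<lambda>x. x" "[:0, 1:]"] by (simp add: op_poly_pCons)

lemma op_calc_const: "positive_op T \<Longrightarrow> op_calc (\<lambda>x. c) T = c *\<^sub>R id_blinfun"
  using op_calc_poly[of T "\<lambda>x. c" "[:c:]"] by (simp add: op_poly_pCons)

lemma positive_root:
  assumes "T \<in> A" "positive_op T" obtains Q where "Q \<in> sa A" "T = Q o\<^sub>L Q"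
  using op_calc_square[OF assms, of "\<lambda>x. x"] op_calc_id[OF assms(2)] by (metis continuous_on_id)

lemma tau_sa_square_nonneg: "Q \<in> sa A \<Longrightarrow> 0 \<le> Re (\<tau> (Q o\<^sub>L Q))"
  using tau_square_nonneg[of Q] by (simp add: sa_A sa_adj)

lemma tau_op_calc_mono:
  assumes T: "T \<in> A" "positive_op T" and f: "continuous_on {0..norm T} f" and g: "continuous_on {0..norm T} g"
    and le: "\<And>x. 0 \<le> x \<Longrightarrow> x \<le> norm T \<Longrightarrow> f x \<le> g x"
  shows "Re (\<tau> (op_calc f T)) \<le> Re (\<tau> (op_calc g T))"
proof -
  have c: "continuous_on {0..norm T} (\<lambda>x. g x - f x)" by (intro continuous_intros f g)
  obtain Q where Q: "Q \<in> sa A" "op_calc (\<lambda>x. g x - f x) T = Q o\<^sub>L Q"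
    using op_calc_square[OF T c] le by (metis diff_ge_0_iff_ge)
  have "op_calc g T = op_calc f T + op_calc (\<lambda>x. g x - f x) T"
    using op_calc_add[OF T(2) f c] by simp
  with Q show ?thesis
    using tau_sa_square_nonneg[OF Q(1)] sa_op_calc[OF T f] by (simp add: tau_add sa_A A_oL)
qed

text \<open>(norm B)^2 - B^* B is positive, hence Q^2 with Q self-adjoint in the algebra, and
  \<tau>(S^* Q^2 S) is the trace of a square.\<close>

lemma tau_sandwich_le:
  assumes B: "B \<in> A" and S: "S \<in> A"
  shows "Re (\<tau> (adj (B o\<^sub>L S) o\<^sub>L (B o\<^sub>L S))) \<le> (norm B)\<^sup>2 * Re (\<tau> (adj S o\<^sub>L S))"
proof -
  let ?P = "(norm B)\<^sup>2 *\<^sub>R id_blinfun - (adj B o\<^sub>L B)"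
  have PA: "?P \<in> A" using B by (auto intro!: A_intros)
  have sq: "inner x (blinfun_apply (adj B o\<^sub>L B) x) = (norm (blinfun_apply B x))\<^sup>2" for x
    by (simp add: inner_adj_right A_clin B power2_norm_eq_inner)
  have "positive_op ?P"
    unfolding positive_op_def
  proof (intro conjI allI)
    show "symmetric_op ?P"
      using B by (simp add: symmetric_op_def blinfun.bilinear_simps inner_diff_left inner_diff_right inner_adj_left inner_adj_right A_clin)
    fix x
    have "(norm (blinfun_apply B x))\<^sup>2 \<le> (norm B * norm x)\<^sup>2"
      by (intro power_mono norm_blinfun) simp
    then show "0 \<le> inner x (blinfun_apply ?P x)"
      using sq[of x] by (simp add: blinfun.bilinear_simps inner_diff_right power_mult_distrib power2_norm_eq_inner[of x])
  qed
  then obtain Q where Q: "Q \<in> sa A" "?P = Q o\<^sub>L Q" using positive_root PA by blast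
  have "adj (Q o\<^sub>L S) o\<^sub>L (Q o\<^sub>L S) = adj S o\<^sub>L (?P o\<^sub>L S)"
    unfolding Q(2) using Q(1) S by (simp add: adj_oL A_clin sa_A sa_adj oL_assoc)
  also have "\<dots> = (norm B)\<^sup>2 *\<^sub>R (adj S o\<^sub>L S) - (adj (B o\<^sub>L S) o\<^sub>L (B o\<^sub>L S))"
    using B S by (simp add: adj_oL A_clin oL_bilinear oL_assoc)
  finally have "\<tau> (adj (Q o\<^sub>L S) o\<^sub>L (Q o\<^sub>L S))
      = of_real ((norm B)\<^sup>2) * \<tau> (adj S o\<^sub>L S) - \<tau> (adj (B o\<^sub>L S) o\<^sub>L (B o\<^sub>L S))"
    using B S by (simp add: tau_diff tau_scaleR A_intros)
  moreover have "0 \<le> Re (\<tau> (adj (Q o\<^sub>L S) o\<^sub>L (Q o\<^sub>L S)))"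
    by (intro tau_square_nonneg A_oL sa_A[OF Q(1)] S)
  ultimately show ?thesis by simp
qed

lemma tau_square_le_norm: "B \<in> A \<Longrightarrow> Re (\<tau> (adj B o\<^sub>L B)) \<le> (norm B)\<^sup>2"
  using tau_sandwich_le[of B id_blinfun] by (simp add: A_id adj_id tau_id)

lemma cmod_tau_le_norm:
  assumes "B \<in> A" shows "cmod (\<tau> B) \<le> norm B"
proof -
  have "cmod (\<tau> B) \<le> sqrt (Re (\<tau> (adj B o\<^sub>L B)))"
    using tau_Cauchy_Schwarz[OF A_id assms] by (simp add: adj_id tau_id)
  also have "\<dots> \<le> sqrt ((norm B)\<^sup>2)" by (intro real_sqrt_le_mono tau_square_le_norm assms)
  finally show ?thesis by simp
qed

text \<open>Nothing is known about \<tau> outside the algebra, whence the membership conditions;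
  inside, \<tau> is norm-decreasing.\<close>

lemma tendsto_tau:
  assumes "(f \<longlongrightarrow> L) F" "eventually (\<lambda>x. f x \<in> A) F" "L \<in> A"
  shows "((\<lambda>x. \<tau> (f x)) \<longlongrightarrow> \<tau> L) F"
proof (rule Lim_transform_bound[of "\<lambda>x. \<tau> (f x) - \<tau> L" "\<lambda>x. f x - L", THEN LIM_zero_cancel])
  show "\<forall>\<^sub>F x in F. norm (\<tau> (f x) - \<tau> L) \<le> norm (f x - L)"
    using assms(2) by (rule eventually_mono)
      (metis A_diff assms(3) cmod_tau_le_norm tau_diff)
  show "((\<lambda>x. f x - L) \<longlongrightarrow> 0) F" using assms(1) LIM_zero by blast
qed

text \<open>The Hoelder inequality for exponents 1 and \<infinity>, with the positive factor Q^2.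
  After Cauchy-Schwarz for Q and Q B, cyclicity turns \<tau>(B^* Q^2 B) into \<tau>(Q B B^* Q),
  which \<open>tau_sandwich_le\<close> estimates.\<close>

lemma cmod_tau_square_mult_le:
  assumes Q: "Q \<in> sa A" and B: "B \<in> A"
  shows "cmod (\<tau> (Q o\<^sub>L Q o\<^sub>L B)) \<le> norm B * Re (\<tau> (Q o\<^sub>L Q))"
proof -
  have QA: "Q \<in> A" using Q by (rule sa_A)
  let ?t = "Re (\<tau> (Q o\<^sub>L Q))"
  have t: "0 \<le> ?t" by (rule tau_sa_square_nonneg[OF Q])
  have "cmod (\<tau> (adj Q o\<^sub>L (Q o\<^sub>L B))) \<le> sqrt (Re (\<tau> (adj Q o\<^sub>L Q))) * sqrt (Re (\<tau> (adj (Q o\<^sub>L B) o\<^sub>L (Q o\<^sub>L B))))"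
    by (intro tau_Cauchy_Schwarz QA A_oL B)
  also have "\<tau> (adj (Q o\<^sub>L B) o\<^sub>L (Q o\<^sub>L B)) = \<tau> (adj (adj B o\<^sub>L Q) o\<^sub>L (adj B o\<^sub>L Q))"
    using tau_comm[of "adj (Q o\<^sub>L B)" "Q o\<^sub>L B"] Q B
    by (simp add: adj_oL adj_adj A_clin adj_clin QA sa_adj A_intros oL_assoc)
  also have "sqrt (Re (\<tau> (adj Q o\<^sub>L Q))) * sqrt (Re (\<tau> (adj (adj B o\<^sub>L Q) o\<^sub>L (adj B o\<^sub>L Q)))) \<le> sqrt ?t * sqrt ((norm B)\<^sup>2 * ?t)"
    using tau_sandwich_le[OF A_adj[OF B] QA] tau_square_nonneg[OF A_oL[OF A_adj[OF B] QA]] t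
    by (intro mult_mono real_sqrt_le_mono) (auto simp: sa_adj[OF Q] norm_adj A_clin B)
  also have "\<dots> = norm B * ?t" using t by (simp add: real_sqrt_mult)
  finally show ?thesis by (simp add: sa_adj[OF Q] oL_assoc)
qed

text \<open>
  In place of a polar decomposition: Cauchy-Schwarz for \<open>B = (B E) D\<close>, where \<open>D\<close> is the
  square root of \<open>|B| + d\<close> and \<open>E\<close> its inverse.
\<close>

lemma cmod_tau_le_tau_abs:
  assumes B: "B \<in> A"
  shows "cmod (\<tau> B) \<le> Re (\<tau> (op_powr (adj B o\<^sub>L B) (1/2)))"
proof -
  define T where "T = adj B o\<^sub>L B"
  have TA: "T \<in> A" using B by (auto simp: T_def intro!: A_intros)
  have Tpos: "positive_op T"
    using B by (auto simp: T_def positive_op_def symmetric_op_def inner_adj_left inner_adj_right A_clin)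
  define t where "t = Re (\<tau> (op_powr T (1/2)))"
  have root: "op_powr T (1/2) = op_calc sqrt T"
    unfolding op_powr_def by (rule op_calc_cong) (simp add: powr_half_sqrt)
  have csqrt: "continuous_on {0..norm T} sqrt" by (intro continuous_intros)
  have t0: "0 \<le> t"
  proof -
    obtain Q where "Q \<in> sa A" "op_calc sqrt T = Q o\<^sub>L Q" using op_calc_square[OF TA Tpos csqrt] by auto
    then show ?thesis unfolding t_def root using tau_sa_square_nonneg by simp
  qed
  have key: "(cmod (\<tau> B))\<^sup>2 \<le> (t + d) * t" if d: "d > 0" for d
  proof -
    define D where "D = op_calc (\<lambda>x. sqrt (sqrt x + d)) T"
    define E where "E = op_calc (\<lambda>x. 1 / sqrt (sqrt x + d)) T"
    have pos: "0 < sqrt x + d" if "0 \<le> x" for x using d that by (simp add: add_nonneg_pos)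
    have cD: "continuous_on {0..norm T} (\<lambda>x. sqrt (sqrt x + d))" by (intro continuous_intros)
    have cE: "continuous_on {0..norm T} (\<lambda>x. 1 / sqrt (sqrt x + d))"
      using pos by (intro continuous_intros) (auto simp: less_imp_neq[symmetric])
    have cI: "continuous_on {0..norm T} (\<lambda>x::real. x)" by (rule continuous_on_id)
    have D: "D \<in> sa A" and E: "E \<in> sa A" unfolding D_def E_def by (intro sa_op_calc TA Tpos cD cE)+
    have "E o\<^sub>L D = id_blinfun"
    proof -
      have "E o\<^sub>L D = op_calc (\<lambda>x. 1 / sqrt (sqrt x + d) * sqrt (sqrt x + d)) T"
        unfolding E_def D_def by (rule op_calc_mult[OF Tpos cE cD, symmetric])
      also have "\<dots> = op_calc (\<lambda>x. 1) T" by (rule op_calc_cong) (use pos in force)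
      finally show ?thesis by (simp add: op_calc_const Tpos)
    qed
    then have "\<tau> B = \<tau> ((B o\<^sub>L E) o\<^sub>L D)" by (simp add: oL_assoc)
    also have "\<dots> = \<tau> (adj D o\<^sub>L (B o\<^sub>L E))" using B D E by (simp add: tau_comm[of "B o\<^sub>L E"] A_oL sa_A sa_adj)
    finally have "cmod (\<tau> B) \<le> sqrt (Re (\<tau> (adj D o\<^sub>L D))) * sqrt (Re (\<tau> (adj (B o\<^sub>L E) o\<^sub>L (B o\<^sub>L E))))"
      using tau_Cauchy_Schwarz[of D "B o\<^sub>L E"] B D E by (simp add: A_oL sa_A)
    then have "(cmod (\<tau> B))\<^sup>2 \<le> (sqrt (Re (\<tau> (adj D o\<^sub>L D))) * sqrt (Re (\<tau> (adj (B o\<^sub>L E) o\<^sub>L (B o\<^sub>L E)))))\<^sup>2"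
      by (intro power_mono) auto
    also have "\<dots> = Re (\<tau> (adj D o\<^sub>L D)) * Re (\<tau> (adj (B o\<^sub>L E) o\<^sub>L (B o\<^sub>L E)))"
      using B D E by (simp add: power_mult_distrib tau_square_nonneg A_oL sa_A)
    also have "Re (\<tau> (adj D o\<^sub>L D)) = t + d"
    proof -
      have "adj D o\<^sub>L D = op_calc (\<lambda>x. sqrt (sqrt x + d) * sqrt (sqrt x + d)) T"
        unfolding sa_adj[OF D] unfolding D_def by (rule op_calc_mult[OF Tpos cD cD, symmetric])
      also have "\<dots> = op_calc (\<lambda>x. sqrt x + d) T" by (rule op_calc_cong) (use pos in \<open>simp add: less_imp_le\<close>)
      also have "\<dots> = op_calc sqrt T + d *\<^sub>R id_blinfun"
        using op_calc_add[OF Tpos csqrt continuous_on_const] by (simp add: op_calc_const Tpos)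
      finally show ?thesis
        using sa_op_calc[OF TA Tpos csqrt] by (simp add: tau_add tau_scaleR tau_id A_intros sa_A t_def root)
    qed
    also have "Re (\<tau> (adj (B o\<^sub>L E) o\<^sub>L (B o\<^sub>L E))) \<le> t"
    proof -
      have "adj (B o\<^sub>L E) o\<^sub>L (B o\<^sub>L E) = E o\<^sub>L (T o\<^sub>L E)"
        using B E by (simp add: adj_oL A_clin sa_A sa_adj T_def oL_assoc)
      also have "T o\<^sub>L E = op_calc (\<lambda>x. x * (1 / sqrt (sqrt x + d))) T"
        using op_calc_mult[OF Tpos cI cE] by (simp add: op_calc_id Tpos E_def)
      also have "E o\<^sub>L \<dots> = op_calc (\<lambda>x. 1 / sqrt (sqrt x + d) * (x * (1 / sqrt (sqrt x + d)))) T"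
        unfolding E_def by (rule op_calc_mult[OF Tpos cE continuous_on_mult[OF cI cE], symmetric])
      also have "Re (\<tau> \<dots>) \<le> Re (\<tau> (op_calc sqrt T))"
      proof (rule tau_op_calc_mono[OF TA Tpos continuous_on_mult[OF cE continuous_on_mult[OF cI cE]] csqrt])
        fix x :: real assume x: "0 \<le> x"
        have "1 / sqrt (sqrt x + d) * (x * (1 / sqrt (sqrt x + d))) = x / (sqrt x + d)"
          using pos[OF x] by (simp add: less_imp_le)
        also have "\<dots> \<le> sqrt x"
        proof -
          have "x \<le> sqrt x * sqrt x + sqrt x * d" using x d by simp
          then show ?thesis using pos[OF x] by (simp add: pos_divide_le_eq distrib_left)
        qed
        finally show "1 / sqrt (sqrt x + d) * (x * (1 / sqrt (sqrt x + d))) \<le> sqrt x" .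
      qed
      finally show ?thesis by (simp add: t_def root)
    qed
    finally show ?thesis using t0 d by (simp add: mult_left_mono)
  qed
  \<comment> \<open>The positive d serves only to make E exist; it now tends to 0.\<close>
  have "(cmod (\<tau> B))\<^sup>2 \<le> t\<^sup>2"
  proof (rule tendsto_lowerbound)
    show "((\<lambda>d. (t + d) * t) \<longlongrightarrow> t\<^sup>2) (at_right 0)"
      by (auto intro!: tendsto_eq_intros simp: power2_eq_square)
    show "\<forall>\<^sub>F d in at_right 0. (cmod (\<tau> B))\<^sup>2 \<le> (t + d) * t"
      using key by (auto simp: eventually_at_right_field intro!: exI[of _ 1])
  qed simp
  with t0 show ?thesis unfolding t_def T_def by (meson power2_le_imp_le)
qed

text \<open>S is tested against its own negative part N: since \<tau>(N S) = - \<tau>(N^2), the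
  assumption forces N = 0. As \<open>op_calc\<close> is available for positive operators, N is
  formed from the shift T = S + norm S, with the function max (c - x) 0.\<close>

lemma positive_by_duality:
  assumes S: "S \<in> sa A" and pos: "\<And>Q. Q \<in> sa A \<Longrightarrow> 0 \<le> Re (\<tau> (Q o\<^sub>L Q o\<^sub>L S))"
  shows "positive_op S"
proof -
  define c where "c = norm S"
  define T where "T = S + c *\<^sub>R id_blinfun"
  have TA: "T \<in> A" unfolding T_def by (intro A_add A_scaleR A_id sa_A S)
  have Tpos: "positive_op T" unfolding T_def c_def by (rule positive_op_norm_minus[OF sa_symmetric[OF S]])
  let ?f = "\<lambda>x. max (c - x) 0" and ?g = "\<lambda>x. max (x - c) 0"
  have cf: "continuous_on {0..norm T} ?f" and cg: "continuous_on {0..norm T} ?g"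
    and cI: "continuous_on {0..norm T} (\<lambda>x. x - c)" by (intro continuous_intros)+
  define N where "N = op_calc ?f T"
  have NA: "N \<in> sa A" unfolding N_def by (rule sa_op_calc[OF TA Tpos cf])
  obtain q where q: "q \<in> sa A" "N = q o\<^sub>L q"
    using op_calc_square[OF TA Tpos cf] unfolding N_def by auto
  have calcS: "op_calc (\<lambda>x. x - c) T = S"
    using op_calc_poly[OF Tpos, of "\<lambda>x. x - c" "[:-c, 1:]"] by (simp add: op_poly_pCons T_def)
  have "N o\<^sub>L S = op_calc (\<lambda>x. ?f x * (x - c)) T"
    unfolding N_def by (subst op_calc_mult[OF Tpos cf cI]) (simp add: calcS)
  also have "\<dots> = op_calc (\<lambda>x. (-1) * (?f x * ?f x)) T" by (rule op_calc_cong) (simp add: max_def algebra_simps)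
  also have "\<dots> = op_calc (\<lambda>x. -1) T o\<^sub>L op_calc (\<lambda>x. ?f x * ?f x) T"
    by (rule op_calc_mult[OF Tpos continuous_on_const continuous_on_mult[OF cf cf]])
  also have "\<dots> = (-1) *\<^sub>R (N o\<^sub>L N)"
    unfolding op_calc_mult[OF Tpos cf cf] op_calc_const[OF Tpos] N_def by (simp add: oL_bilinear)
  finally have "Re (\<tau> (N o\<^sub>L S)) = - Re (\<tau> (N o\<^sub>L N))"
    using NA by (simp only: tau_scaleR A_oL sa_A) simp
  with pos[OF q(1)] q(2) have "Re (\<tau> (N o\<^sub>L N)) \<le> 0" by simp
  with tau_sa_square_nonneg[OF NA] have "N = 0"
    using tau_faithful_Re[of N] NA by (simp add: sa_A sa_adj)
  have "op_calc ?g T = op_calc (\<lambda>x. (x - c) + ?f x) T" by (rule op_calc_cong) (simp add: max_def)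
  also have "\<dots> = S + N" using op_calc_add[OF Tpos cI cf] by (simp add: calcS N_def)
  finally have "S = op_calc ?g T" using \<open>N = 0\<close> by simp
  moreover obtain p where "p \<in> sa A" "op_calc ?g T = p o\<^sub>L p"
    using op_calc_square[OF TA Tpos cg] by auto
  ultimately show ?thesis by (simp add: positive_op_square sa_symmetric)
qed

lemma norm_sa_by_duality:
  assumes Z: "Z \<in> sa A" and e: "0 \<le> e"
    and b: "\<And>Q. Q \<in> sa A \<Longrightarrow> cmod (\<tau> (Q o\<^sub>L Q o\<^sub>L Z)) \<le> e * Re (\<tau> (Q o\<^sub>L Q))"
  shows "norm Z \<le> e"
proof -
  have "positive_op (e *\<^sub>R id_blinfun + s *\<^sub>R Z)" if s: "s = 1 \<or> s = -1" for s
  proof (rule positive_by_duality)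
    fix Q assume Q: "Q \<in> sa A"
    have "\<tau> (Q o\<^sub>L Q o\<^sub>L (e *\<^sub>R id_blinfun + s *\<^sub>R Z)) = of_real e * \<tau> (Q o\<^sub>L Q) + of_real s * \<tau> (Q o\<^sub>L Q o\<^sub>L Z)"
      using Q Z by (simp add: oL_bilinear tau_add tau_scaleR A_intros sa_A)
    moreover have "\<bar>Re (\<tau> (Q o\<^sub>L Q o\<^sub>L Z))\<bar> \<le> e * Re (\<tau> (Q o\<^sub>L Q))"
      using b[OF Q] abs_Re_le_cmod order_trans by blast
    ultimately show "0 \<le> Re (\<tau> (Q o\<^sub>L Q o\<^sub>L (e *\<^sub>R id_blinfun + s *\<^sub>R Z)))" using s by auto
  qed (auto intro!: sa_add sa_scaleR sa_id Z)
  from this[of 1] this[of "-1"] have p: "positive_op (e *\<^sub>R id_blinfun + 1 *\<^sub>R Z)" "positive_op (e *\<^sub>R id_blinfun + (-1) *\<^sub>R Z)"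
    by auto
  have "\<bar>inner x (blinfun_apply Z x)\<bar> \<le> e * (norm x)\<^sup>2" for x
  proof -
    have "0 \<le> inner x (blinfun_apply (e *\<^sub>R id_blinfun + 1 *\<^sub>R Z) x)"
      "0 \<le> inner x (blinfun_apply (e *\<^sub>R id_blinfun + (-1) *\<^sub>R Z) x)"
      using p by (auto simp: positive_op_def)
    then show ?thesis
      unfolding power2_norm_eq_inner by (simp add: blinfun.bilinear_simps inner_add_right inner_diff_right)
  qed
  then show ?thesis by (rule norm_le_numerical_radius[OF sa_symmetric[OF Z] e])
qed

text \<open>The factor 2 comes from treating the self-adjoint real and imaginary parts of Z
  separately. It does no harm: the lemma is applied only to errors that vanish or tend to 0.\<close>

lemma norm_by_duality:
  assumes Z: "Z \<in> A" and e: "0 \<le> e"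
    and b: "\<And>Q. Q \<in> sa A \<Longrightarrow> Re (\<tau> (Q o\<^sub>L Q)) \<le> 1 \<Longrightarrow> cmod (\<tau> (Q o\<^sub>L Q o\<^sub>L Z)) \<le> e"
  shows "norm Z \<le> 2 * e"
proof -
  have b': "cmod (\<tau> (Q o\<^sub>L Q o\<^sub>L Z)) \<le> e * Re (\<tau> (Q o\<^sub>L Q))" if Q: "Q \<in> sa A" for Q
  proof (cases "Re (\<tau> (Q o\<^sub>L Q)) = 0")
    case True
    then have "Q = 0" using tau_faithful_Re[of Q] Q by (simp add: sa_A sa_adj)
    then show ?thesis by (simp add: tau_zero)
  next
    case False
    define t where "t = Re (\<tau> (Q o\<^sub>L Q))"
    have t: "t > 0" using False tau_sa_square_nonneg[OF Q] by (simp add: t_def)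
    define r where "r = 1 / sqrt t"
    have rr: "r * r = 1 / t" using t by (simp add: r_def)
    have "cmod (\<tau> ((r *\<^sub>R Q) o\<^sub>L (r *\<^sub>R Q) o\<^sub>L Z)) \<le> e"
    proof (rule b)
      show "Re (\<tau> ((r *\<^sub>R Q) o\<^sub>L (r *\<^sub>R Q))) \<le> 1"
        using t Q rr by (simp add: oL_bilinear tau_scaleR A_oL sa_A t_def)
    qed (intro sa_scaleR Q)
    moreover have "\<tau> ((r *\<^sub>R Q) o\<^sub>L (r *\<^sub>R Q) o\<^sub>L Z) = of_real (1 / t) * \<tau> (Q o\<^sub>L Q o\<^sub>L Z)"
      using Q Z by (simp add: oL_bilinear tau_scaleR A_oL sa_A rr)
    ultimately show ?thesis using t unfolding t_def[symmetric] by (simp add: norm_mult norm_divide field_simps)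
  qed
  have bs: "cmod (\<tau> (Q o\<^sub>L Q o\<^sub>L adj Z)) \<le> e * Re (\<tau> (Q o\<^sub>L Q))" if Q: "Q \<in> sa A" for Q
  proof -
    have "\<tau> (Q o\<^sub>L Q o\<^sub>L adj Z) = \<tau> (adj (Z o\<^sub>L (Q o\<^sub>L Q)))"
      using Q Z by (simp add: adj_oL A_clin sa_A sa_adj clin_oL)
    also have "\<dots> = cnj (\<tau> (Q o\<^sub>L Q o\<^sub>L Z))"
      using Q Z by (simp add: tau_adj A_oL sa_A tau_comm[of Z])
    finally show ?thesis using b'[OF Q] by simp
  qed
  define Z1 where "Z1 = (1/2) *\<^sub>R (Z + adj Z)"
  define Z2 where "Z2 = scaleC_op (-\<i>/2) (Z - adj Z)"
  have Z1: "Z1 \<in> sa A" unfolding sa_def Z1_def using Z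
    by (simp add: A_intros adj_scaleR adj_add adj_adj A_clin adj_clin clin_add add.commute)
  have "adj Z2 = scaleC_op (\<i>/2) (adj Z - Z)"
    unfolding Z2_def using Z by (simp add: adj_scaleC adj_diff adj_adj A_clin A_diff A_adj)
  also have "\<dots> = Z2" unfolding Z2_def by (simp add: scaleC_op_def oL_bilinear algebra_simps)
  finally have Z2: "Z2 \<in> sa A" unfolding sa_def using Z by (simp add: Z2_def A_intros)
  have n1: "norm Z1 \<le> e"
  proof (rule norm_sa_by_duality[OF Z1 e])
    fix Q assume Q: "Q \<in> sa A"
    have "\<tau> (Q o\<^sub>L Q o\<^sub>L Z1) = (1/2) * (\<tau> (Q o\<^sub>L Q o\<^sub>L Z) + \<tau> (Q o\<^sub>L Q o\<^sub>L adj Z))"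
      using Q Z by (simp add: Z1_def oL_bilinear tau_scaleR tau_add A_intros sa_A)
    then have "cmod (\<tau> (Q o\<^sub>L Q o\<^sub>L Z1)) = (1/2) * cmod (\<tau> (Q o\<^sub>L Q o\<^sub>L Z) + \<tau> (Q o\<^sub>L Q o\<^sub>L adj Z))"
      by (simp only: norm_mult) simp
    with norm_triangle_ineq[of "\<tau> (Q o\<^sub>L Q o\<^sub>L Z)" "\<tau> (Q o\<^sub>L Q o\<^sub>L adj Z)"] b'[OF Q] bs[OF Q] show "cmod (\<tau> (Q o\<^sub>L Q o\<^sub>L Z1)) \<le> e * Re (\<tau> (Q o\<^sub>L Q))" by simp
  qed
  have n2: "norm Z2 \<le> e"
  proof (rule norm_sa_by_duality[OF Z2 e])
    fix Q assume Q: "Q \<in> sa A"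
    have "\<tau> (Q o\<^sub>L Q o\<^sub>L Z2) = (-\<i>/2) * (\<tau> (Q o\<^sub>L Q o\<^sub>L Z) - \<tau> (Q o\<^sub>L Q o\<^sub>L adj Z))"
    proof -
      have "Q o\<^sub>L Q o\<^sub>L Z2 = scaleC_op (-\<i>/2) ((Q o\<^sub>L Q o\<^sub>L Z) - (Q o\<^sub>L Q o\<^sub>L adj Z))"
        unfolding Z2_def using Q by (subst scaleC_oL_right) (auto simp: clin_oL A_clin sa_A oL_bilinear)
      then show ?thesis using Q Z by (simp only: tau_scaleC tau_diff A_intros sa_A)
    qed
    then have "cmod (\<tau> (Q o\<^sub>L Q o\<^sub>L Z2)) \<le> (1/2) * (cmod (\<tau> (Q o\<^sub>L Q o\<^sub>L Z)) + cmod (\<tau> (Q o\<^sub>L Q o\<^sub>L adj Z)))"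
      using norm_triangle_ineq4[of "\<tau> (Q o\<^sub>L Q o\<^sub>L Z)" "\<tau> (Q o\<^sub>L Q o\<^sub>L adj Z)"] by (simp add: norm_mult norm_divide)
    with b'[OF Q] bs[OF Q] show "cmod (\<tau> (Q o\<^sub>L Q o\<^sub>L Z2)) \<le> e * Re (\<tau> (Q o\<^sub>L Q))" by simp
  qed
  have i: "iop o\<^sub>L Z2 = (1/2) *\<^sub>R (Z - adj Z)"
    unfolding Z2_def by (simp add: scaleC_op_def oL_bilinear iop_squared algebra_simps flip: oL_assoc)
  have "Z = Z1 + (iop o\<^sub>L Z2)" unfolding i Z1_def
    by (simp add: scaleR_add_right scaleR_diff_right flip: scaleR_add_left)
  then have "norm Z \<le> norm Z1 + norm (iop o\<^sub>L Z2)" by (metis norm_triangle_ineq)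
  with n1 n2 norm_iop_oL[of Z2] show ?thesis by simp
qed

end

section \<open>Tuples and their norms\<close>

lemma Lp_norm_inf: "Lp_norm M \<infinity> X = Max (range (\<lambda>j. norm (X $ j)))"
  by (simp add: Lp_norm_def)

lemma norm_nth_le_Lp_inf: "norm (X $ j) \<le> Lp_norm M \<infinity> X"
  unfolding Lp_norm_inf by (rule Max_ge) auto

lemma Lp_inf_leI: "(\<And>j. norm (X $ j) \<le> R) \<Longrightarrow> Lp_norm M \<infinity> X \<le> R"
  unfolding Lp_norm_inf by (subst Max_le_iff) auto

context tracial_algebra begin

lemma tuples_nth: "X \<in> tuples M \<Longrightarrow> X $ j \<in> A"
  by (simp add: tuples_def)

lemma sa_tuples_nth: "X \<in> sa_tuples M \<Longrightarrow> X $ j \<in> sa A"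
  by (simp add: sa_tuples_def)

lemma sa_tuples_tuples: "X \<in> sa_tuples M \<Longrightarrow> X \<in> tuples M"
  by (auto simp: sa_tuples_def tuples_def sa_A)

lemma sa_tuples_intros:
  "X \<in> sa_tuples M \<Longrightarrow> Y \<in> sa_tuples M \<Longrightarrow> X + Y \<in> sa_tuples M"
  "X \<in> sa_tuples M \<Longrightarrow> Y \<in> sa_tuples M \<Longrightarrow> X - Y \<in> sa_tuples M"
  "X \<in> sa_tuples M \<Longrightarrow> r *\<^sub>R X \<in> sa_tuples M"
  "0 \<in> sa_tuples M"
  by (auto simp: sa_tuples_def sa_add sa_diff sa_scaleR sa_zero)

lemma tr_inner_self: "X \<in> tuples M \<Longrightarrow> tr_inner M X X = of_real (Re (tr_inner M X X))"
  unfolding tr_inner_def by (simp add: complex_eq_iff tau_square_real tuples_nth)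

lemma tr_inner_self_nonneg: "X \<in> tuples M \<Longrightarrow> 0 \<le> Re (tr_inner M X X)"
  unfolding tr_inner_def by (simp add: tau_square_nonneg tuples_nth sum_nonneg)

lemma tr_inner_eq_0: 
  assumes X: "X \<in> tuples M" and 0: "Re (tr_inner M X X) = 0"
  shows "X = 0"
proof -
  have "(\<Sum>j\<in>UNIV. Re (\<tau> (adj (X $ j) o\<^sub>L X $ j))) = 0"
    using 0 by (simp add: tr_inner_def)
  then have "Re (\<tau> (adj (X $ j) o\<^sub>L X $ j)) = 0" for j
    by (subst (asm) sum_nonneg_eq_0_iff) (auto simp: tau_square_nonneg tuples_nth X)
  then show ?thesis by (simp add: vec_eq_iff tau_faithful_Re tuples_nth X)
qed

lemma op_powr_1: "B \<in> A \<Longrightarrow> op_powr (adj B o\<^sub>L B) 1 = adj B o\<^sub>L B"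
proof -
  assume B: "B \<in> A"
  have pos: "positive_op (adj B o\<^sub>L B)"
    using B by (auto simp: positive_op_def symmetric_op_def inner_adj_left inner_adj_right A_clin)
  have "op_powr (adj B o\<^sub>L B) 1 = op_calc (\<lambda>x. x) (adj B o\<^sub>L B)"
    unfolding op_powr_def by (rule op_calc_cong) simp
  then show ?thesis by (simp add: op_calc_id pos)
qed

lemma Lp_norm_2: "X \<in> tuples M \<Longrightarrow> Lp_norm M 2 X = sqrt (Re (tr_inner M X X))"
proof -
  assume X: "X \<in> tuples M"
  have "Lp_norm M 2 X = (\<Sum>j\<in>UNIV. Re (\<tau> (adj (X $ j) o\<^sub>L X $ j))) powr (1/2)"
    by (simp add: Lp_norm_def op_powr_1 tuples_nth X)
  also have "\<dots> = sqrt (Re (tr_inner M X X))"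
    using tr_inner_self_nonneg[OF X] by (simp add: powr_half_sqrt tr_inner_def)
  finally show ?thesis .
qed

text \<open>Turns a test element Q^2 of \<open>norm_by_duality\<close> into a self-adjoint direction
  with known L1 norm, along which a derivative can be taken.\<close>

lemma Lp_norm_1_axis:
  assumes Q: "Q \<in> sa A" shows "Lp_norm M 1 (axis j (Q o\<^sub>L Q)) = Re (\<tau> (Q o\<^sub>L Q))"
proof -
  have sym: "symmetric_op (Q o\<^sub>L Q)" using positive_op_square[OF sa_symmetric[OF Q]] by (rule positive_op_symmetric)
  have "adj (Q o\<^sub>L Q) = Q o\<^sub>L Q" using sym Q by (simp add: sa_iff_symmetric A_oL sa_A)
  then have e: "op_powr (adj (axis j (Q o\<^sub>L Q) $ i) o\<^sub>L axis j (Q o\<^sub>L Q) $ i) (1/2) = (if i = j then Q o\<^sub>L Q else 0)" for i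
    using op_calc_sqrt_square[OF positive_op_square[OF sa_symmetric[OF Q]]]
      op_calc_sqrt_square[of 0]
    by (auto simp: axis_def op_powr_def adj_zero positive_op_def symmetric_op_def)
  have "Lp_norm M 1 (axis j (Q o\<^sub>L Q)) = (\<Sum>i\<in>UNIV. if i = j then Re (\<tau> (Q o\<^sub>L Q)) else 0) powr 1"
    unfolding Lp_norm_def by (simp add: e[simplified] if_distrib[of \<tau>] if_distrib[of Re] tau_zero cong: if_cong)
  then show ?thesis using tau_sa_square_nonneg[OF Q] by simp
qed

lemma cmod_tau_le_Lp_1:
  fixes X :: "bop ^ 1" assumes "X $ 1 \<in> A" shows "cmod (\<tau> (X $ 1)) \<le> Lp_norm M 1 X"
  using cmod_tau_le_tau_abs[OF assms] order_trans[OF norm_ge_zero cmod_tau_le_tau_abs[OF assms]]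
  by (simp add: Lp_norm_def)

lemma cmod_tau_le_Lp_inf:
  fixes X :: "bop ^ 1" assumes "X $ 1 \<in> A" shows "cmod (\<tau> (X $ 1)) \<le> Lp_norm M \<infinity> X"
  using cmod_tau_le_norm[OF assms] norm_nth_le_Lp_inf[of X 1 M] by linarith

lemma tr_inner_Cauchy_Schwarz:
  assumes X: "X \<in> tuples M" and Y: "Y \<in> tuples M"
  shows "cmod (tr_inner M X Y) \<le> sqrt (Re (tr_inner M X X)) * sqrt (Re (tr_inner M Y Y))"
proof -
  let ?n = "\<lambda>X :: bop ^ 'a. \<lambda>j. sqrt (Re (\<tau> (adj (X $ j) o\<^sub>L X $ j)))"
  have L2: "L2_set (?n Z) UNIV = sqrt (Re (tr_inner M Z Z))" if "Z \<in> tuples M" for Z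
    unfolding L2_set_def tr_inner_def using that by (simp add: tau_square_nonneg tuples_nth)
  have "cmod (tr_inner M X Y) \<le> (\<Sum>j\<in>UNIV. cmod (\<tau> (adj (X $ j) o\<^sub>L Y $ j)))"
    unfolding tr_inner_def by (rule norm_sum)
  also have "\<dots> \<le> (\<Sum>j\<in>UNIV. \<bar>?n X j\<bar> * \<bar>?n Y j\<bar>)"
    using X Y by (intro sum_mono) (simp add: tau_Cauchy_Schwarz tuples_nth tau_square_nonneg)
  also have "\<dots> \<le> L2_set (?n X) UNIV * L2_set (?n Y) UNIV" by (rule L2_set_mult_ineq)
  finally show ?thesis by (simp add: L2 X Y)
qed

lemma tr_inner_simps:
  assumes "X \<in> tuples M" "Y \<in> tuples M" "Z \<in> tuples M"
  shows "tr_inner M X (Y + Z) = tr_inner M X Y + tr_inner M X Z"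
    and "tr_inner M (X + Y) Z = tr_inner M X Z + tr_inner M Y Z"
    and "tr_inner M X (Y - Z) = tr_inner M X Y - tr_inner M X Z"
    and "tr_inner M (X - Y) Z = tr_inner M X Z - tr_inner M Y Z"
    and "tr_inner M X (r *\<^sub>R Y) = of_real r * tr_inner M X Y"
    and "tr_inner M (r *\<^sub>R X) Y = of_real r * tr_inner M X Y"
  unfolding tr_inner_def using assms
  by (simp_all add: tuples_nth A_intros adj_add adj_diff adj_scaleR A_clin oL_bilinear tau_add tau_diff tau_scaleR
      sum.distrib sum_subtractf sum_distrib_left)

lemma tr_inner_cnj:
  assumes "X \<in> tuples M" "Y \<in> tuples M" shows "tr_inner M Y X = cnj (tr_inner M X Y)"
proof -
  have "\<tau> (adj (Y $ j) o\<^sub>L X $ j) = cnj (\<tau> (adj (X $ j) o\<^sub>L Y $ j))" for j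
  proof -
    have "adj (Y $ j) o\<^sub>L X $ j = adj (adj (X $ j) o\<^sub>L Y $ j)"
      using assms by (simp add: adj_oL adj_adj A_clin adj_clin tuples_nth)
    then show ?thesis using assms by (simp add: tau_adj A_intros tuples_nth)
  qed
  then show ?thesis by (simp add: tr_inner_def)
qed

lemma tr_inner_real:
  assumes "X \<in> sa_tuples M" "Y \<in> sa_tuples M" shows "tr_inner M X Y \<in> \<real>"
proof -
  have "tr_inner M Y X = tr_inner M X Y"
    unfolding tr_inner_def using assms
    by (intro sum.cong) (simp_all add: sa_adj[OF sa_tuples_nth] tau_comm sa_A[OF sa_tuples_nth])
  then show ?thesis
    using tr_inner_cnj[OF assms[THEN sa_tuples_tuples]] by (simp add: Reals_cnj_iff)
qed

lemma tuples_intros: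
  "X \<in> tuples M \<Longrightarrow> Y \<in> tuples M \<Longrightarrow> X + Y \<in> tuples M"
  "X \<in> tuples M \<Longrightarrow> Y \<in> tuples M \<Longrightarrow> X - Y \<in> tuples M"
  "X \<in> tuples M \<Longrightarrow> r *\<^sub>R X \<in> tuples M"
  by (auto simp: tuples_def A_intros)

end

section \<open>Sums of trace monomials\<close>

text \<open>A triple \<open>(c, w, [w\<^sub>1, \<dots>, w\<^sub>n])\<close> stands for \<open>c w tr(w\<^sub>1) \<dots> tr(w\<^sub>n)\<close>.\<close>

type_synonym 'v trace_sum = "(complex \<times> 'v list \<times> 'v list list) list"

definition monomial_letters :: "complex \<times> 'v list \<times> 'v list list \<Rightarrow> 'v list" where
  "monomial_letters m = concat (fst (snd m) # snd (snd m))"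

definition monomial_eval :: "tracial \<Rightarrow> ('v \<Rightarrow> bop) \<Rightarrow> complex \<times> 'v list \<times> 'v list list \<Rightarrow> bop" where
  "monomial_eval M \<rho> m = scaleC_op (fst m * prod_list (map (\<lambda>w. snd M (word_eval \<rho> w)) (snd (snd m))))
     (word_eval \<rho> (fst (snd m)))"

definition trace_sum_eval :: "tracial \<Rightarrow> ('v \<Rightarrow> bop) \<Rightarrow> 'v trace_sum \<Rightarrow> bop" where
  "trace_sum_eval M \<rho> L = sum_list (map (monomial_eval M \<rho>) L)"

definition trace_sum_letters :: "'v trace_sum \<Rightarrow> 'v set" where
  "trace_sum_letters L = (\<Union>m\<in>set L. set (monomial_letters m))"

lemma trace_sum_simps [simp]:
  "trace_sum_eval M \<rho> [] = 0"
  "trace_sum_eval M \<rho> (m # L) = monomial_eval M \<rho> m + trace_sum_eval M \<rho> L"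
  "trace_sum_letters [] = {}"
  "trace_sum_letters (m # L) = set (monomial_letters m) \<union> trace_sum_letters L"
  by (simp_all add: trace_sum_eval_def trace_sum_letters_def)

lemma word_eval_simps [simp]:
  "word_eval \<rho> [] = id_blinfun" "word_eval \<rho> (v # w) = \<rho> v o\<^sub>L word_eval \<rho> w"
  by (simp_all add: word_eval_def)

lemma word_eval_append: "word_eval \<rho> (u @ v) = word_eval \<rho> u o\<^sub>L word_eval \<rho> v"
  by (induction u) (simp_all add: oL_assoc)

lemma word_eval_zero: "v \<in> set w \<Longrightarrow> \<rho> v = 0 \<Longrightarrow> word_eval \<rho> w = 0"
  by (induction w) (auto simp: oL_bilinear)

definition multilinear_sum :: "nat \<Rightarrow> 'n letter trace_sum \<Rightarrow> bool" where
  "multilinear_sum l L \<longleftrightarrow> (\<forall>m\<in>set L. \<forall>j. length (filter (letter_of_arg j) (monomial_letters m)) = (if j < l then 1 else 0))"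

lemma multilinear_sum_Cons:
  "multilinear_sum l (m # L) \<longleftrightarrow> (\<forall>j. length (filter (letter_of_arg j) (monomial_letters m)) = (if j < l then 1 else 0)) \<and> multilinear_sum l L"
  by (auto simp: multilinear_sum_def)

lemma multilinear_sum_letters:
  assumes "multilinear_sum l L" "YV j i \<in> trace_sum_letters L" shows "j < l"
proof (rule ccontr)
  assume "\<not> j < l"
  moreover obtain m where "m \<in> set L" "YV j i \<in> set (monomial_letters m)"
    using assms(2) by (auto simp: trace_sum_letters_def)
  ultimately have "length (filter (letter_of_arg j) (monomial_letters m)) = 0"
    using assms(1) by (simp add: multilinear_sum_def)
  then have "filter (letter_of_arg j) (monomial_letters m) = []" by simp
  with \<open>YV j i \<in> set (monomial_letters m)\<close> show False by (auto simp: filter_empty_conv)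
qed

text \<open>Lists of monomials replace finitely supported functions, so that trace polynomials
  become accessible to induction.\<close>

lemma tp_eval_trace_sum:
  assumes "tp_multilinear l p"
  obtains L where "multilinear_sum l L" "\<And>M X Ys. tp_eval p M X Ys = trace_sum_eval M (letter_eval X Ys) L"
proof -
  obtain xs where xs: "set xs = Poly_Mapping.keys p" "distinct xs"
    by (metis finite_distinct_list finite_keys)
  let ?L = "map (\<lambda>m. (Poly_Mapping.lookup p m, fst m, snd m)) xs"
  show ?thesis
  proof
    show "multilinear_sum l ?L"
      using assms xs(1) by (auto simp: multilinear_sum_def tp_multilinear_def monomial_letters_def)
    show "tp_eval p M X Ys = trace_sum_eval M (letter_eval X Ys) ?L" for M X Ys
      unfolding tp_eval_def trace_sum_eval_def xs(1)[symmetric] 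
      by (simp add: sum_list_distinct_conv_sum_set[OF xs(2)] monomial_eval_def o_def)
  qed
qed

text \<open>Every monomial has a letter of argument j, either in its leading word or inside a trace
  factor. This is what \<open>complex_ext_sa\<close> requires of the approximating
  polynomials.\<close>

lemma trace_sum_eval_zero_arg:
  assumes L: "multilinear_sum l L" and j: "j < l" "Ys ! j = 0" and M: "tracial_algebra M"
  shows "trace_sum_eval M (letter_eval X Ys) L = 0"
proof -
  interpret tracial_algebra M by (rule M)
  show ?thesis
    using L
  proof (induction L)
    case (Cons m L)
    have "length (filter (letter_of_arg j) (monomial_letters m)) = 1"
      using Cons.prems j by (simp add: multilinear_sum_Cons)
    then obtain v where v: "v \<in> set (monomial_letters m)" "letter_of_arg j v"
      by (metis filter_empty_conv list.size(3) zero_neq_one)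
    have z: "letter_eval X Ys v = 0"
    proof (cases v)
    qed (use v j in auto)
    note wz = word_eval_zero[of v _ "letter_eval X Ys", OF _ z]
    have "monomial_eval M (letter_eval X Ys) m = 0"
    proof (cases "v \<in> set (fst (snd m))")
      case True
      then show ?thesis by (simp add: monomial_eval_def wz scaleC_op_simps)
    next
      case False
      then obtain w where w: "w \<in> set (snd (snd m))" "v \<in> set w" using v by (auto simp: monomial_letters_def)
      then have "\<tau> (word_eval (letter_eval X Ys) w) = 0" by (simp add: wz tau_zero)
      then have "0 \<in> set (map (\<lambda>w. \<tau> (word_eval (letter_eval X Ys) w)) (snd (snd m)))"
        unfolding set_map by (intro image_eqI[OF _ w(1)]) simp
      then have "prod_list (map (\<lambda>w. \<tau> (word_eval (letter_eval X Ys) w)) (snd (snd m))) = 0"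
        by (simp add: prod_list_zero_iff)
      then show ?thesis by (simp add: monomial_eval_def scaleC_op_simps)
    qed
    with Cons show ?case by (simp add: multilinear_sum_Cons)
  qed simp
qed

context tracial_algebra begin

lemma word_eval_A: "(\<And>v. v \<in> set w \<Longrightarrow> \<rho> v \<in> A) \<Longrightarrow> word_eval \<rho> w \<in> A"
  by (induction w) (auto simp: A_intros)

lemma monomial_eval_A: "(\<And>v. v \<in> set (monomial_letters m) \<Longrightarrow> \<rho> v \<in> A) \<Longrightarrow> monomial_eval M \<rho> m \<in> A"
  unfolding monomial_eval_def by (intro A_scaleC word_eval_A) (auto simp: monomial_letters_def)

lemma trace_sum_eval_A: "(\<And>v. v \<in> trace_sum_letters L \<Longrightarrow> \<rho> v \<in> A) \<Longrightarrow> trace_sum_eval M \<rho> L \<in> A"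
  by (induction L) (auto simp: A_zero intro!: A_add monomial_eval_A)

lemma letter_eval_A:
  assumes "multilinear_sum l L" "X \<in> tuples M" "length Ys = l" "set Ys \<subseteq> tuples M" "v \<in> trace_sum_letters L"
  shows "letter_eval X Ys v \<in> A"
proof (cases v)
  case (YV j i)
  then have "Ys ! j \<in> tuples M" using multilinear_sum_letters[of l L j i] assms by (auto simp: subset_iff)
  with YV show ?thesis by (simp add: tuples_nth)
qed (use assms in \<open>simp add: tuples_nth\<close>)

lemma tau_monomial_eval:
  assumes "\<And>v. v \<in> set (monomial_letters m) \<Longrightarrow> \<rho> v \<in> A"
  shows "\<tau> (monomial_eval M \<rho> m) = fst m * prod_list (map (\<lambda>w. \<tau> (word_eval \<rho> w)) (fst (snd m) # snd (snd m)))"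
proof -
  have "word_eval \<rho> (fst (snd m)) \<in> A" using assms by (intro word_eval_A) (auto simp: monomial_letters_def)
  then show ?thesis by (simp add: monomial_eval_def tau_scaleC)
qed

end

text \<open>By traciality the word containing the distinguished letter can be rotated so that this letter comes first.\<close>

lemma monomial_extract:
  assumes "length (filter P (monomial_letters m)) = 1"
  shows "\<exists>v m'. P v \<and> v \<in> set (monomial_letters m) \<and>
    set (monomial_letters m') \<subseteq> set (monomial_letters m) - Collect P \<and>
    (\<forall>M \<rho>. tracial_algebra M \<longrightarrow> (\<forall>v\<in>set (monomial_letters m). \<rho> v \<in> fst M) \<longrightarrow>
      snd M (monomial_eval M \<rho> m) = snd M (\<rho> v o\<^sub>L monomial_eval M \<rho> m'))"
proof -
  let ?W = "fst (snd m) # snd (snd m)"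
  obtain v where v: "v \<in> set (monomial_letters m)" "P v"
    using assms by (metis filter_empty_conv list.size(3) zero_neq_one)
  then obtain x where "x \<in> set ?W" "v \<in> set x" by (auto simp: monomial_letters_def)
  then obtain As Bs u t where W: "?W = As @ x # Bs" and x: "x = u @ v # t"
    by (meson split_list)
  have letters: "monomial_letters m = concat As @ u @ v # t @ concat Bs"
    unfolding monomial_letters_def W x by simp
  \<comment> \<open>Under \<tau> the leading word is just one more trace factor, so whichever word
    contains v may become the leading one.\<close>
  define m' where "m' = (fst m, t @ u, As @ Bs)"
  have letters': "monomial_letters m' = (t @ u) @ concat As @ concat Bs"
    by (simp add: m'_def monomial_letters_def)
  have "filter P (concat As @ u @ t @ concat Bs) = []"
    using assms v(2) unfolding letters by simp
  then have "set (monomial_letters m') \<subseteq> set (monomial_letters m) - Collect P"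
    unfolding letters letters' filter_empty_conv by auto
  moreover have "snd M (monomial_eval M \<rho> m) = snd M (\<rho> v o\<^sub>L monomial_eval M \<rho> m')"
    if M: "tracial_algebra M" and \<rho>: "\<forall>v\<in>set (monomial_letters m). \<rho> v \<in> fst M" for M \<rho>
  proof -
    interpret tracial_algebra M by (rule M)
    let ?w = "word_eval \<rho>"
    let ?p = "\<lambda>ws. prod_list (map (\<lambda>w. \<tau> (?w w)) ws)"
    have in_A: "?w u \<in> A" "?w t \<in> A" "\<rho> v \<in> A" using \<rho> unfolding letters by (auto intro!: word_eval_A)
    have "\<tau> (?w x) = \<tau> (?w u o\<^sub>L (\<rho> v o\<^sub>L ?w t))" unfolding x by (simp add: word_eval_append)
    also have "\<dots> = \<tau> (\<rho> v o\<^sub>L ?w (t @ u))"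
      using in_A by (simp add: tau_comm[of "?w u"] A_oL word_eval_append oL_assoc)
    finally have x_eq: "\<tau> (?w x) = \<tau> (\<rho> v o\<^sub>L ?w (t @ u))" .
    have "\<tau> (monomial_eval M \<rho> m) = fst m * ?p (As @ x # Bs)"
      using tau_monomial_eval[of m \<rho>] \<rho> unfolding W by blast
    also have "\<dots> = (fst m * ?p (As @ Bs)) * \<tau> (\<rho> v o\<^sub>L ?w (t @ u))"
      using x_eq by (simp add: mult_ac)
    also have "\<dots> = \<tau> (\<rho> v o\<^sub>L monomial_eval M \<rho> m')"
      using in_A by (simp add: monomial_eval_def m'_def scaleC_oL_right A_clin tau_scaleC A_oL word_eval_append)
    finally show ?thesis .
  qed
  ultimately show ?thesis using v
    by (intro exI[of _ v] exI[of _ m'] conjI allI impI)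
qed

text \<open>Puts a form that is linear in argument 0 into gradient form: each monomial joins the one
  \<open>H i\<close> whose index i its letter \<open>YV 0 i\<close> carries.\<close>

lemma trace_sum_extract:
  fixes L :: "'n::finite letter trace_sum"
  assumes "multilinear_sum (Suc l) L"
  shows "\<exists>H :: 'n \<Rightarrow> 'n letter trace_sum.
    (\<forall>i. trace_sum_letters (H i) \<subseteq> trace_sum_letters L - Collect (letter_of_arg 0)) \<and>
    (\<forall>M \<rho>. tracial_algebra M \<longrightarrow> (\<forall>v\<in>trace_sum_letters L. \<rho> v \<in> fst M) \<longrightarrow>
      snd M (trace_sum_eval M \<rho> L) = (\<Sum>i\<in>UNIV. snd M (\<rho> (YV 0 i) o\<^sub>L trace_sum_eval M \<rho> (H i))))"
  using assms
proof (induction L)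
  case Nil
  have "snd M 0 = 0" if "tracial_algebra M" for M
    using that tracial_algebra.tau_zero by blast
  then show ?case by (intro exI[of _ "\<lambda>i. []"]) auto
next
  case (Cons m L)
  then have "multilinear_sum (Suc l) L" by (simp add: multilinear_sum_Cons)
  from Cons.IH[OF this] obtain H where HH: "(\<forall>i. trace_sum_letters (H i) \<subseteq> trace_sum_letters L - Collect (letter_of_arg 0)) \<and>
    (\<forall>M \<rho>. tracial_algebra M \<longrightarrow> (\<forall>v\<in>trace_sum_letters L. \<rho> v \<in> fst M) \<longrightarrow>
      snd M (trace_sum_eval M \<rho> L) = (\<Sum>i\<in>UNIV. snd M (\<rho> (YV 0 i) o\<^sub>L trace_sum_eval M \<rho> (H i))))" ..
  note H = conjunct1[OF HH, rule_format] and He = conjunct2[OF HH, rule_format]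
  have "length (filter (letter_of_arg 0) (monomial_letters m)) = 1"
    using Cons.prems by (simp add: multilinear_sum_Cons)
  from monomial_extract[OF this] obtain v m' where
    vm: "letter_of_arg 0 v \<and> v \<in> set (monomial_letters m) \<and>
    set (monomial_letters m') \<subseteq> set (monomial_letters m) - Collect (letter_of_arg 0) \<and>
    (\<forall>M \<rho>. tracial_algebra M \<longrightarrow> (\<forall>v\<in>set (monomial_letters m). \<rho> v \<in> fst M) \<longrightarrow>
      snd M (monomial_eval M \<rho> m) = snd M (\<rho> v o\<^sub>L monomial_eval M \<rho> m'))"
    by (elim exE) (rule that)
  note v = conjunct1[OF vm] conjunct1[OF conjunct2[OF vm]]
    and m' = conjunct1[OF conjunct2[OF conjunct2[OF vm]]]
    and me = conjunct2[OF conjunct2[OF conjunct2[OF vm]], rule_format]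
  obtain i0 where i0: "v = YV 0 i0" using v(1) by (cases v) auto
  define H' where "H' = (\<lambda>i. if i = i0 then m' # H i else H i)"
  show ?case
  proof (intro exI[of _ H'] conjI allI impI)
    show "trace_sum_letters (H' i) \<subseteq> trace_sum_letters (m # L) - Collect (letter_of_arg 0)" for i
      using H[of i] m' by (auto simp: H'_def)
    fix M and \<rho> :: "'n letter \<Rightarrow> bop"
    assume M: "tracial_algebra M" and \<rho>: "\<forall>v\<in>trace_sum_letters (m # L). \<rho> v \<in> fst M"
    interpret tracial_algebra M by (rule M)
    have HA: "trace_sum_eval M \<rho> (H i) \<in> A" for i using H[of i] \<rho> by (intro trace_sum_eval_A) auto
    have LA: "trace_sum_eval M \<rho> L \<in> A" using \<rho> by (intro trace_sum_eval_A) auto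
    have mA: "monomial_eval M \<rho> m \<in> A" "monomial_eval M \<rho> m' \<in> A"
      using \<rho> m' by (auto intro!: monomial_eval_A)
    have vA: "\<rho> (YV 0 i0) \<in> A" using \<rho> v i0 by auto
    have "\<tau> (\<rho> (YV 0 i) o\<^sub>L trace_sum_eval M \<rho> (H' i))
        = (if i = i0 then \<tau> (\<rho> v o\<^sub>L monomial_eval M \<rho> m') else 0) + \<tau> (\<rho> (YV 0 i) o\<^sub>L trace_sum_eval M \<rho> (H i))" for i
      using HA mA vA by (simp add: H'_def i0 oL_bilinear tau_add A_oL)
    then have "(\<Sum>i\<in>UNIV. \<tau> (\<rho> (YV 0 i) o\<^sub>L trace_sum_eval M \<rho> (H' i)))
        = \<tau> (\<rho> v o\<^sub>L monomial_eval M \<rho> m') + (\<Sum>i\<in>UNIV. \<tau> (\<rho> (YV 0 i) o\<^sub>L trace_sum_eval M \<rho> (H i)))"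
      by (simp add: sum.distrib)
    also have "\<dots> = \<tau> (monomial_eval M \<rho> m) + \<tau> (trace_sum_eval M \<rho> L)"
      using me[OF M, of \<rho>] He[OF M, of \<rho>] \<rho> by simp
    also have "\<dots> = \<tau> (trace_sum_eval M \<rho> (m # L))" using mA LA by (simp add: tau_add)
    finally show "\<tau> (trace_sum_eval M \<rho> (m # L)) = (\<Sum>i\<in>UNIV. \<tau> (\<rho> (YV 0 i) o\<^sub>L trace_sum_eval M \<rho> (H' i)))" ..
  qed
qed

lemma (in tracial_algebra) tendsto_trace_sum_eval:
  assumes lim: "\<And>v. v \<in> trace_sum_letters L \<Longrightarrow> ((\<lambda>x. \<rho> x v) \<longlongrightarrow> \<sigma> v) F"
    and ev: "\<And>x v. v \<in> trace_sum_letters L \<Longrightarrow> \<rho> x v \<in> A"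
    and in_A: "\<And>v. v \<in> trace_sum_letters L \<Longrightarrow> \<sigma> v \<in> A"
  shows "((\<lambda>x. trace_sum_eval M (\<rho> x) L) \<longlongrightarrow> trace_sum_eval M \<sigma> L) F"
  using assms
proof (induction L)
  case (Cons m L)
  have w: "((\<lambda>x. word_eval (\<rho> x) w) \<longlongrightarrow> word_eval \<sigma> w) F" if "set w \<subseteq> set (monomial_letters m)" for w
    using that Cons.prems(1) by (induction w) (auto intro!: tendsto_oL)
  have tw: "((\<lambda>x. \<tau> (word_eval (\<rho> x) w)) \<longlongrightarrow> \<tau> (word_eval \<sigma> w)) F" if "set w \<subseteq> set (monomial_letters m)" for w
    using that Cons.prems by (intro tendsto_tau w always_eventually allI word_eval_A) auto
  have p: "((\<lambda>x. prod_list (map (\<lambda>w. \<tau> (word_eval (\<rho> x) w)) ws)) \<longlongrightarrow> prod_list (map (\<lambda>w. \<tau> (word_eval \<sigma> w)) ws)) F"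
    if "set (concat ws) \<subseteq> set (monomial_letters m)" for ws
    using that by (induction ws) (auto intro!: tendsto_mult tw)
  have "((\<lambda>x. monomial_eval M (\<rho> x) m) \<longlongrightarrow> monomial_eval M \<sigma> m) F"
    unfolding monomial_eval_def
    by (intro tendsto_scaleC_op tendsto_mult tendsto_const w p) (auto simp: monomial_letters_def)
  moreover have "((\<lambda>x. trace_sum_eval M (\<rho> x) L) \<longlongrightarrow> trace_sum_eval M \<sigma> L) F"
    using Cons.prems by (intro Cons.IH) auto
  ultimately show ?case by (simp add: tendsto_add)
qed simp

section \<open>Pairs of operators with the same law\<close>

text \<open>
  The pairs \<open>(p(a), p(b))\<close> for non-commutative polynomials \<open>p\<close>: when \<open>a\<close> and \<open>b\<close> have the same law,
  the closure of this set plays the role of the isomorphism between the generated algebras.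
\<close>

inductive_set poly_pairs :: "('v \<Rightarrow> bop) \<Rightarrow> ('v \<Rightarrow> bop) \<Rightarrow> (bop \<times> bop) set" for a b where
  zero: "(0, 0) \<in> poly_pairs a b"
| step: "(S, T) \<in> poly_pairs a b \<Longrightarrow>
    (scaleC_op c (word_eval a w) + S, scaleC_op c (word_eval b w) + T) \<in> poly_pairs a b"

definition law_pairs :: "('v \<Rightarrow> bop) \<Rightarrow> ('v \<Rightarrow> bop) \<Rightarrow> (bop \<times> bop) set" where
  "law_pairs a b = closure (poly_pairs a b)"

locale same_law = M: tracial_algebra M + N: tracial_algebra N for M N +
  fixes a b :: "'v \<Rightarrow> bop"
  assumes a: "\<And>v. a v \<in> fst M" and b: "\<And>v. b v \<in> fst N"
    and law: "\<And>w. snd M (word_eval a w) = snd N (word_eval b w)"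
begin

lemma aw: "word_eval a w \<in> fst M" and bw: "word_eval b w \<in> fst N"
  by (auto intro!: M.word_eval_A N.word_eval_A a b)

lemma poly_pairs_A: "(S, T) \<in> poly_pairs a b \<Longrightarrow> S \<in> fst M \<and> T \<in> fst N"
  by (induction rule: poly_pairs.induct) (auto intro!: M.A_intros N.A_intros aw bw)

lemma poly_pairs_tau: "(S, T) \<in> poly_pairs a b \<Longrightarrow> snd M S = snd N T"
proof (induction rule: poly_pairs.induct)
  case (step S T c w)
  then show ?case using poly_pairs_A[OF step(1)]
    by (simp add: M.tau_add N.tau_add M.tau_scaleC N.tau_scaleC M.A_intros N.A_intros aw bw law)
qed (simp add: M.tau_zero N.tau_zero)

lemma poly_pairs_add:
  "(S, T) \<in> poly_pairs a b \<Longrightarrow> (S', T') \<in> poly_pairs a b \<Longrightarrow> (S + S', T + T') \<in> poly_pairs a b"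
  by (induction rule: poly_pairs.induct) (auto simp: add.assoc intro!: poly_pairs.step)

lemma poly_pairs_word_mult:
  "(S, T) \<in> poly_pairs a b \<Longrightarrow>
    (scaleC_op c (word_eval a w) o\<^sub>L S, scaleC_op c (word_eval b w) o\<^sub>L T) \<in> poly_pairs a b"
proof (induction rule: poly_pairs.induct)
  case (step S T d u)
  have "scaleC_op c (word_eval a w) o\<^sub>L (scaleC_op d (word_eval a u) + S)
      = scaleC_op (c * d) (word_eval a (w @ u)) + (scaleC_op c (word_eval a w) o\<^sub>L S)"
    using aw[THEN M.A_clin] by (simp add: oL_bilinear scaleC_oL_left scaleC_oL_right scaleC_scaleC word_eval_append)
  moreover have "scaleC_op c (word_eval b w) o\<^sub>L (scaleC_op d (word_eval b u) + T)
      = scaleC_op (c * d) (word_eval b (w @ u)) + (scaleC_op c (word_eval b w) o\<^sub>L T)"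
    using bw[THEN N.A_clin] by (simp add: oL_bilinear scaleC_oL_left scaleC_oL_right scaleC_scaleC word_eval_append)
  ultimately show ?case using poly_pairs.step[OF step.IH] by simp
qed (simp add: poly_pairs.zero)

lemma poly_pairs_mult:
  "(S, T) \<in> poly_pairs a b \<Longrightarrow> (S', T') \<in> poly_pairs a b \<Longrightarrow> (S o\<^sub>L S', T o\<^sub>L T') \<in> poly_pairs a b"
proof (induction rule: poly_pairs.induct)
  case (step S T d u)
  then show ?case using poly_pairs_add[OF poly_pairs_word_mult[OF step.prems]] by (simp add: oL_bilinear)
qed (simp add: poly_pairs.zero)

lemma law_pairs_seq:
  assumes "(S, T) \<in> law_pairs a b"
  obtains s t where "\<And>n. (s n, t n) \<in> poly_pairs a b" "s \<longlonglongrightarrow> S" "t \<longlonglongrightarrow> T"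
proof -
  obtain x where x: "\<And>n. x n \<in> poly_pairs a b" "x \<longlonglongrightarrow> (S, T)"
    using assms unfolding law_pairs_def closure_sequential by blast
  show ?thesis
    by (rule that[of "fst \<circ> x" "snd \<circ> x"])
      (use x tendsto_fst[OF x(2)] tendsto_snd[OF x(2)] in \<open>auto simp: o_def\<close>)
qed

lemma law_pairsI:
  assumes "\<And>n. (s n, t n) \<in> poly_pairs a b" "s \<longlonglongrightarrow> S" "t \<longlonglongrightarrow> T"
  shows "(S, T) \<in> law_pairs a b"
  unfolding law_pairs_def closure_sequential using assms
  by (intro exI[of _ "\<lambda>n. (s n, t n)"]) (auto intro!: tendsto_Pair)

lemma law_pairs_A:
  assumes "(S, T) \<in> law_pairs a b" shows "S \<in> fst M" "T \<in> fst N"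
proof -
  obtain s t where st: "\<And>n. (s n, t n) \<in> poly_pairs a b" "s \<longlonglongrightarrow> S" "t \<longlonglongrightarrow> T"
    using law_pairs_seq[OF assms] by blast
  show "S \<in> fst M" "T \<in> fst N"
    using closed_sequentially[OF M.closed_A _ st(2)] closed_sequentially[OF N.closed_A _ st(3)]
      poly_pairs_A[OF st(1)] by blast+
qed

lemma law_pairs_tau:
  assumes "(S, T) \<in> law_pairs a b" shows "snd M S = snd N T"
proof -
  obtain s t where st: "\<And>n. (s n, t n) \<in> poly_pairs a b" "s \<longlonglongrightarrow> S" "t \<longlonglongrightarrow> T"
    using law_pairs_seq[OF assms] by blast
  have "(\<lambda>n. snd M (s n)) \<longlonglongrightarrow> snd M S"
    using poly_pairs_A[OF st(1)] law_pairs_A[OF assms] by (intro M.tendsto_tau st) auto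
  moreover have "(\<lambda>n. snd N (t n)) \<longlonglongrightarrow> snd N T"
    using poly_pairs_A[OF st(1)] law_pairs_A[OF assms] by (intro N.tendsto_tau st) auto
  ultimately show ?thesis using LIMSEQ_unique by (simp add: poly_pairs_tau[OF st(1)])
qed

lemma law_pairs_add:
  assumes "(S, T) \<in> law_pairs a b" "(S', T') \<in> law_pairs a b" shows "(S + S', T + T') \<in> law_pairs a b"
proof -
  obtain s t where st: "\<And>n. (s n, t n) \<in> poly_pairs a b" "s \<longlonglongrightarrow> S" "t \<longlonglongrightarrow> T"
    using law_pairs_seq[OF assms(1)] by blast
  obtain s' t' where st': "\<And>n. (s' n, t' n) \<in> poly_pairs a b" "s' \<longlonglongrightarrow> S'" "t' \<longlonglongrightarrow> T'"
    using law_pairs_seq[OF assms(2)] by blast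
  show ?thesis 
    by (rule law_pairsI[of "\<lambda>n. s n + s' n" "\<lambda>n. t n + t' n"])
      (intro poly_pairs_add tendsto_add st st')+
qed

lemma law_pairs_mult:
  assumes "(S, T) \<in> law_pairs a b" "(S', T') \<in> law_pairs a b" shows "(S o\<^sub>L S', T o\<^sub>L T') \<in> law_pairs a b"
proof -
  obtain s t where st: "\<And>n. (s n, t n) \<in> poly_pairs a b" "s \<longlonglongrightarrow> S" "t \<longlonglongrightarrow> T"
    using law_pairs_seq[OF assms(1)] by blast
  obtain s' t' where st': "\<And>n. (s' n, t' n) \<in> poly_pairs a b" "s' \<longlonglongrightarrow> S'" "t' \<longlonglongrightarrow> T'"
    using law_pairs_seq[OF assms(2)] by blast
  show ?thesis 
    by (rule law_pairsI[of "\<lambda>n. s n o\<^sub>L s' n" "\<lambda>n. t n o\<^sub>L t' n"])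
      (intro poly_pairs_mult tendsto_oL st st')+
qed

lemma law_pairs_closed: "closed (law_pairs a b)"
  by (simp add: law_pairs_def)

lemma law_pairs_word: "(scaleC_op c (word_eval a w), scaleC_op c (word_eval b w)) \<in> law_pairs a b"
  using closure_subset poly_pairs.step[OF poly_pairs.zero, of c a w b] by (auto simp: law_pairs_def)

lemma law_pairs_id: "(id_blinfun, id_blinfun) \<in> law_pairs a b"
  using law_pairs_word[of 1 "[]"] by (simp add: scaleC_op_simps)

lemma law_pairs_base: "(a v, b v) \<in> law_pairs a b"
  using law_pairs_word[of 1 "[v]"] by (simp add: scaleC_op_simps)

lemma law_pairs_zero: "(0, 0) \<in> law_pairs a b"
  using law_pairs_word[of 0] by (simp add: scaleC_op_simps)

lemma law_pairs_scaleC: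
  assumes "(S, T) \<in> law_pairs a b" shows "(scaleC_op c S, scaleC_op c T) \<in> law_pairs a b"
  using law_pairs_mult[OF law_pairs_word[of c "[]"] assms] by (simp add: scaleC_oL_left)

lemma law_pairs_scaleR: "(S, T) \<in> law_pairs a b \<Longrightarrow> (r *\<^sub>R S, r *\<^sub>R T) \<in> law_pairs a b"
  using law_pairs_scaleC[of S T "of_real r"] by (simp add: scaleC_op_of_real)

lemma law_pairs_diff:
  "(S, T) \<in> law_pairs a b \<Longrightarrow> (S', T') \<in> law_pairs a b \<Longrightarrow> (S - S', T - T') \<in> law_pairs a b"
  using law_pairs_add[of S T "-1 *\<^sub>R S'" "-1 *\<^sub>R T'"] law_pairs_scaleR[of S' T' "-1"] by simp

lemma law_pairs_word_eval:
  "(\<And>v. v \<in> set w \<Longrightarrow> (\<rho> v, \<sigma> v) \<in> law_pairs a b) \<Longrightarrow> (word_eval \<rho> w, word_eval \<sigma> w) \<in> law_pairs a b"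
  by (induction w) (auto simp: law_pairs_id intro!: law_pairs_mult)

text \<open>The trace factors have equal values on both sides by \<open>law_pairs_tau\<close>, so a
  monomial acts as a word times the same scalar in both algebras.\<close>

lemma law_pairs_trace_sum:
  assumes "\<And>v. v \<in> trace_sum_letters L \<Longrightarrow> (\<rho> v, \<sigma> v) \<in> law_pairs a b"
  shows "(trace_sum_eval M \<rho> L, trace_sum_eval N \<sigma> L) \<in> law_pairs a b"
  using assms
proof (induction L)
  case (Cons m L)
  have w: "(word_eval \<rho> w, word_eval \<sigma> w) \<in> law_pairs a b" if "set w \<subseteq> set (monomial_letters m)" for w
    using that Cons.prems by (intro law_pairs_word_eval) auto
  have "map (\<lambda>w. snd M (word_eval \<rho> w)) (snd (snd m)) = map (\<lambda>w. snd N (word_eval \<sigma> w)) (snd (snd m))"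
    by (auto intro!: law_pairs_tau w simp: monomial_letters_def)
  then have "(monomial_eval M \<rho> m, monomial_eval N \<sigma> m) \<in> law_pairs a b"
    unfolding monomial_eval_def by (simp only:) (rule law_pairs_scaleC, rule w, auto simp: monomial_letters_def)
  with Cons show ?case by (auto intro!: law_pairs_add)
qed (simp add: law_pairs_zero)

text \<open>The letters a and b may fail to be self-adjoint, so \<open>law_pairs\<close> need not
  respect adjoints; hence the assumptions on S and T.\<close>

lemma law_pairs_adj_oL_tau:
  assumes "(S, T) \<in> law_pairs a b" "(S', T') \<in> law_pairs a b" "adj S = S" "adj T = T"
  shows "snd M (adj S o\<^sub>L S') = snd N (adj T o\<^sub>L T')"
  using law_pairs_tau[OF law_pairs_mult[OF assms(1,2)]] assms(3,4) by simp

end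

section \<open>Approximation by trace polynomials\<close>

lemma Lp_le_fam_norm:
  assumes "M \<in> W" "X \<in> sa_tuples M" "Lp_norm M \<infinity> X \<le> R"
    and "1 \<le> \<alpha>" "length \<alpha>s = l" "\<forall>a\<in>set \<alpha>s. 1 \<le> a" "inverse \<alpha> = (\<Sum>j<l. inverse (\<alpha>s ! j))"
    and "length Ys = l" "set Ys \<subseteq> tuples M" "\<forall>j<l. Lp_norm M (\<alpha>s ! j) (Ys ! j) \<le> 1"
  shows "ennreal (Lp_norm M \<alpha> (complex_ext l (f M X) Ys)) \<le> fam_norm W l R f"
proof -
  have "ennreal (Lp_norm M \<alpha> (complex_ext l (f M X) Ys)) \<le> multi_norm M l (f M X)"
    unfolding multi_norm_def using assms(4-) by (intro Sup_upper) blast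
  also have "\<dots> \<le> (SUP X\<in>{X \<in> sa_tuples M. Lp_norm M \<infinity> X \<le> R}. multi_norm M l (f M X))"
    using assms(2,3) by (intro SUP_upper) simp
  also have "\<dots> \<le> fam_norm W l R f"
    unfolding fam_norm_def using assms(1) by (intro SUP_upper)
  finally show ?thesis .
qed

lemma trace_sum_eval_cong:
  assumes "\<And>v. v \<in> trace_sum_letters L \<Longrightarrow> \<rho> v = \<sigma> v"
  shows "trace_sum_eval M \<rho> L = trace_sum_eval M \<sigma> L"
  using assms
proof (induction L)
  case (Cons m L)
  have w: "word_eval \<rho> w = word_eval \<sigma> w" if "set w \<subseteq> set (monomial_letters m)" for w
    using that Cons.prems by (induction w) auto
  have "map (\<lambda>w. snd M (word_eval \<rho> w)) (snd (snd m)) = map (\<lambda>w. snd M (word_eval \<sigma> w)) (snd (snd m))"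
    by (intro map_cong refl arg_cong[of _ _ "snd M"] w) (auto simp: monomial_letters_def)
  moreover have "word_eval \<rho> (fst (snd m)) = word_eval \<sigma> (fst (snd m))"
    by (intro w) (auto simp: monomial_letters_def)
  ultimately have "monomial_eval M \<rho> m = monomial_eval M \<sigma> m" unfolding monomial_eval_def by (simp only:)
  with Cons show ?case by simp
qed simp

lemma has_dir_deriv_unique: "has_dir_deriv F X Y L \<Longrightarrow> has_dir_deriv F X Y L' \<Longrightarrow> L = L'"
  unfolding has_dir_deriv_def using tendsto_unique trivial_limit_at by blast

context tracial_algebra begin

text \<open>A self-adjoint argument has imaginary part 0, so only the summand for the empty set
  survives.\<close>

lemma complex_ext_sa:
  assumes Ys: "length Ys = l" "set Ys \<subseteq> sa_tuples M"
    and 0: "\<And>Zs j. length Zs = l \<Longrightarrow> j < l \<Longrightarrow> Zs ! j = 0 \<Longrightarrow> set Zs \<subseteq> sa_tuples M \<Longrightarrow> \<Lambda> Zs = 0"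
  shows "complex_ext l \<Lambda> Ys = \<Lambda> Ys"
proof -
  have re: "re_part Y = Y" and im: "im_part Y = 0" if "Y \<in> set Ys" for Y
  proof -
    have "adj (Y $ i) = Y $ i" for i
      using Ys(2) that by (intro sa_adj sa_tuples_nth) auto
    then show "re_part Y = Y" "im_part Y = 0"
      by (simp_all add: re_part_def im_part_def vec_eq_iff scaleC_op_simps flip: scaleR_2)
  qed
  let ?t = "\<lambda>S. \<chi> i. scaleC_op (\<i> ^ card S) (\<Lambda> (map (\<lambda>j. if j \<in> S then im_part (Ys ! j) else re_part (Ys ! j)) [0..<l]) $ i)"
  have "complex_ext l \<Lambda> Ys = (\<Sum>S\<in>{{}}. ?t S)"
    unfolding complex_ext_def
  proof (rule sum.mono_neutral_right)
    show "\<forall>S\<in>Pow {..<l} - {{}}. ?t S = 0"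
    proof
      fix S assume S: "S \<in> Pow {..<l} - {{}}"
      then obtain j where j: "j \<in> S" "j < l" by blast
      let ?Zs = "map (\<lambda>j. if j \<in> S then im_part (Ys ! j) else re_part (Ys ! j)) [0..<l]"
      have "\<Lambda> ?Zs = 0"
      proof (rule 0[OF _ j(2)])
        show "?Zs ! j = 0" using j Ys by (simp add: im)
        show "set ?Zs \<subseteq> sa_tuples M"
          using Ys re im by (auto simp: sa_tuples_intros(4))
      qed simp
      then show "?t S = 0" by (simp add: vec_eq_iff scaleC_op_simps)
    qed
  qed auto
  moreover have "map (\<lambda>j. if j \<in> {} then im_part (Ys ! j) else re_part (Ys ! j)) [0..<l] = Ys"
    using Ys by (intro nth_equalityI) (auto simp: re)
  ultimately show ?thesis by (simp add: scaleC_op_simps vec_lambda_eta)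
qed

lemma real_multilinear_zero:
  assumes "real_multilinear M l \<Lambda>" "length Ys = l" "set Ys \<subseteq> sa_tuples M" "j < l" "Ys ! j = 0"
  shows "\<Lambda> Ys = 0"
proof -
  have "\<Lambda> (Ys[j := 0 *\<^sub>R 0 + 0 *\<^sub>R 0]) = 0 *\<^sub>R \<Lambda> (Ys[j := 0]) + 0 *\<^sub>R \<Lambda> (Ys[j := 0])"
    using assms(1-4) sa_tuples_intros(4) unfolding real_multilinear_def by blast
  moreover have "Ys[j := 0] = Ys" using assms(5) by (metis list_update_id)
  ultimately show ?thesis by simp
qed

lemma tr_inner_axis: "tr_inner M (axis j B) G = \<tau> (adj B o\<^sub>L G $ j)"
proof -
  have "tr_inner M (axis j B) G = (\<Sum>i\<in>UNIV. if i = j then \<tau> (adj B o\<^sub>L G $ j) else 0)"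
    unfolding tr_inner_def by (intro sum.cong) (auto simp: axis_def adj_zero tau_zero)
  then show ?thesis by simp
qed

lemma adj_square: "Q \<in> sa A \<Longrightarrow> adj (Q o\<^sub>L Q) = Q o\<^sub>L Q"
  by (simp add: adj_oL A_clin sa_A sa_adj)

lemma axis_square_sa: "Q \<in> sa A \<Longrightarrow> axis j (Q o\<^sub>L Q) \<in> sa_tuples M"
  using sa_zero by (auto simp: sa_tuples_def axis_def sa_def adj_square A_oL)

end

text \<open>The condition \<open>fam_norm < \<epsilon>\<close> made pointwise and restricted to
  self-adjoint arguments, where the complex extension disappears.\<close>

definition approximates ::
  "tracial set \<Rightarrow> nat \<Rightarrow> real \<Rightarrow> real \<Rightarrow> ('n::finite, 1) family \<Rightarrow> 'n letter trace_sum \<Rightarrow> bool" where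
  "approximates W l R \<epsilon> f L \<longleftrightarrow> (\<forall>M\<in>W. \<forall>X\<in>sa_tuples M. \<forall>\<alpha> \<alpha>s Ys.
    Lp_norm M \<infinity> X \<le> R \<longrightarrow> 1 \<le> \<alpha> \<longrightarrow> length \<alpha>s = l \<longrightarrow> (\<forall>a\<in>set \<alpha>s. 1 \<le> a) \<longrightarrow>
    inverse \<alpha> = (\<Sum>j<l. inverse (\<alpha>s ! j)) \<longrightarrow> length Ys = l \<longrightarrow> set Ys \<subseteq> sa_tuples M \<longrightarrow>
    (\<forall>j<l. Lp_norm M (\<alpha>s ! j) (Ys ! j) \<le> 1) \<longrightarrow>
    Lp_norm M \<alpha> (f M X Ys - (\<chi> i. trace_sum_eval M (letter_eval X Ys) L) :: bop ^ 1) < \<epsilon>)"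

lemma C_tr_approx:
  fixes f :: "('n::finite, 1) family"
  assumes W: "\<forall>M\<in>W. tracial_algebra M" and f: "f \<in> C_tr W l" and "0 < R" "0 < \<epsilon>"
  obtains L where "multilinear_sum l L" "approximates W l R \<epsilon> f L"
proof -
  obtain g :: "1 \<Rightarrow> 'n trace_poly" where g: "\<And>i. tp_multilinear l (g i)"
    and lt: "fam_norm W l R (\<lambda>M X Ys. f M X Ys - (\<chi> i. tp_eval (g i) M X Ys)) < ennreal \<epsilon>"
    using f assms(3,4) unfolding C_tr_def by blast
  obtain L where L: "multilinear_sum l L" and gL: "\<And>M X Ys. tp_eval (g 1) M X Ys = trace_sum_eval M (letter_eval X Ys) L"
    using tp_eval_trace_sum[OF g] by blast
  have gi: "tp_eval (g i) M X Ys = trace_sum_eval M (letter_eval X Ys) L" for i M X Ys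
  proof -
    have "i = 1" by (rule num1_eq1)
    then show ?thesis by (simp only: gL)
  qed
  have "Lp_norm M \<alpha> (f M X Ys - (\<chi> i. trace_sum_eval M (letter_eval X Ys) L) :: bop ^ 1) < \<epsilon>"
    if M: "M \<in> W" and X: "X \<in> sa_tuples M" "Lp_norm M \<infinity> X \<le> R"
      and a: "1 \<le> \<alpha>" "length \<alpha>s = l" "\<forall>a\<in>set \<alpha>s. 1 \<le> a" "inverse \<alpha> = (\<Sum>j<l. inverse (\<alpha>s ! j))"
      and Ys: "length Ys = l" "set Ys \<subseteq> sa_tuples M" "\<forall>j<l. Lp_norm M (\<alpha>s ! j) (Ys ! j) \<le> 1"
    for M X \<alpha> \<alpha>s and Ys :: "(bop ^ 'n) list"
  proof -
    interpret tracial_algebra M by (rule bspec[OF W M])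
    let ?\<Lambda> = "\<lambda>Ys. f M X Ys - (\<chi> i. tp_eval (g i) M X Ys)"
    have ml: "real_multilinear M l (f M X)" using f M X unfolding C_tr_def by blast
    have "set Ys \<subseteq> tuples M" using Ys(2) sa_tuples_tuples by blast
    from Lp_le_fam_norm[OF M X a Ys(1) this Ys(3), of "\<lambda>M X Ys. f M X Ys - (\<chi> i. tp_eval (g i) M X Ys)"] lt
    have "ennreal (Lp_norm M \<alpha> (complex_ext l ?\<Lambda> Ys)) < ennreal \<epsilon>" by (rule le_less_trans)
    moreover have "complex_ext l ?\<Lambda> Ys = ?\<Lambda> Ys"
    proof (rule complex_ext_sa[OF Ys(1,2)])
      fix Zs :: "(bop ^ 'n) list" and j assume Z: "length Zs = l" "j < l" "Zs ! j = 0" "set Zs \<subseteq> sa_tuples M"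
      show "?\<Lambda> Zs = 0"
        using real_multilinear_zero[OF ml Z(1,4,2,3)] trace_sum_eval_zero_arg[OF L Z(2,3) bspec[OF W M]]
        by (simp add: vec_eq_iff gi)
    qed
    moreover have "?\<Lambda> Ys = f M X Ys - (\<chi> i. trace_sum_eval M (letter_eval X Ys) L)"
      by (simp add: vec_eq_iff gi)
    \<comment> \<open>\<open>ennreal\<close> sends negative reals to 0, so a negative value is
      covered by 0 < \<epsilon> instead.\<close>
    ultimately show ?thesis using \<open>0 < \<epsilon>\<close>
      by (cases "0 \<le> Lp_norm M \<alpha> (?\<Lambda> Ys)") (auto simp: ennreal_less_iff)
  qed
  then have "approximates W l R \<epsilon> f L"
    unfolding approximates_def by (intro ballI allI impI)
  with L show ?thesis by (rule that)
qed

lemma scalar_approx_0: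
  fixes f :: "('n::finite, 1) family"
  assumes W: "\<forall>M\<in>W. tracial_algebra M" and f: "f \<in> C_tr W 0" and R: "0 < R" "0 < \<epsilon>"
  shows "\<exists>L. multilinear_sum 0 L \<and> (\<forall>M\<in>W. \<forall>X\<in>sa_tuples M. Lp_norm M \<infinity> X \<le> R \<longrightarrow>
    norm (f M X [] $ 1 - trace_sum_eval M (letter_eval X []) L) < \<epsilon>)"
proof -
  obtain L where L: "multilinear_sum 0 L" and b: "approximates W 0 R \<epsilon> f L"
    using C_tr_approx[OF W f R] .
  have "norm (f M X [] $ 1 - trace_sum_eval M (letter_eval X []) L) < \<epsilon>"
    if "M \<in> W" "X \<in> sa_tuples M" "Lp_norm M \<infinity> X \<le> R" for M X
  proof -
    have "Lp_norm M \<infinity> (f M X [] - (\<chi> i. trace_sum_eval M (letter_eval X []) L) :: bop ^ 1) < \<epsilon>"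
      by (rule b[unfolded approximates_def, rule_format, OF that(1,2,3), of \<infinity> "[]" "[]"]) auto
    then show ?thesis
      using norm_nth_le_Lp_inf[of "f M X [] - (\<chi> i. trace_sum_eval M (letter_eval X []) L) :: bop ^ 1" 1 M] by simp
  qed
  with L show ?thesis by (intro exI[of _ L] conjI ballI allI impI)
qed

text \<open>The exponents are \<open>(1, \<infinity>, \<dots>, \<infinity>)\<close> or \<open>(\<infinity>, \<dots>, \<infinity>)\<close>.\<close>

lemma scalar_approx_Suc:
  fixes f :: "('n::finite, 1) family"
  assumes W: "\<forall>M\<in>W. tracial_algebra M" and f: "f \<in> C_tr W (Suc l)" and R: "0 < R" "0 < \<epsilon>"
  shows "\<exists>H :: 'n \<Rightarrow> 'n letter trace_sum. (\<forall>i. \<forall>v\<in>trace_sum_letters (H i). \<forall>j i. v = YV j i \<longrightarrow> 0 < j \<and> j < Suc l) \<and>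
    (\<forall>M\<in>W. \<forall>X\<in>sa_tuples M. \<forall>Y\<in>sa_tuples M. \<forall>Zs. length Zs = l \<longrightarrow> set Zs \<subseteq> sa_tuples M \<longrightarrow>
      Lp_norm M \<infinity> X \<le> R \<longrightarrow> (Lp_norm M 1 Y \<le> 1 \<or> Lp_norm M \<infinity> Y \<le> 1) \<longrightarrow> (\<forall>Z\<in>set Zs. Lp_norm M \<infinity> Z \<le> 1) \<longrightarrow>
      cmod (snd M (f M X (Y # Zs) $ 1) - tr_inner M Y (\<chi> i. trace_sum_eval M (letter_eval X (0 # Zs)) (H i))) < \<epsilon>)"
proof -
  obtain L where L: "multilinear_sum (Suc l) L" and b: "approximates W (Suc l) R \<epsilon> f L"
    using C_tr_approx[OF W f R] .
  note b = b[unfolded approximates_def, rule_format]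
  from trace_sum_extract[OF L] obtain H :: "'n \<Rightarrow> 'n letter trace_sum" where
    HH: "(\<forall>i. trace_sum_letters (H i) \<subseteq> trace_sum_letters L - Collect (letter_of_arg 0)) \<and>
    (\<forall>M \<rho>. tracial_algebra M \<longrightarrow> (\<forall>v\<in>trace_sum_letters L. \<rho> v \<in> fst M) \<longrightarrow>
      snd M (trace_sum_eval M \<rho> L) = (\<Sum>i\<in>UNIV. snd M (\<rho> (YV 0 i) o\<^sub>L trace_sum_eval M \<rho> (H i))))" ..
  note H = conjunct1[OF HH, rule_format] and He = conjunct2[OF HH, rule_format]
  have HXV: "0 < j \<and> j < Suc l" if "v \<in> trace_sum_letters (H i)" "v = YV j i'" for v i i' j
  proof -
    have "v \<in> trace_sum_letters L" "\<not> letter_of_arg 0 v" using H that(1) by auto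
    with that(2) multilinear_sum_letters[OF L, of j i'] show ?thesis by simp
  qed
  have "cmod (snd M (f M X (Y # Zs) $ 1) - tr_inner M Y (\<chi> i. trace_sum_eval M (letter_eval X (0 # Zs)) (H i))) < \<epsilon>"
    if M: "M \<in> W" and X: "X \<in> sa_tuples M" and Y: "Y \<in> sa_tuples M" and Zs: "length Zs = l" "set Zs \<subseteq> sa_tuples M"
      and XR: "Lp_norm M \<infinity> X \<le> R" and Yn: "Lp_norm M 1 Y \<le> 1 \<or> Lp_norm M \<infinity> Y \<le> 1"
      and Zn: "\<forall>Z\<in>set Zs. Lp_norm M \<infinity> Z \<le> 1" for M X Y Zs
  proof -
    interpret tracial_algebra M by (rule bspec[OF W M])
    let ?\<rho> = "letter_eval X (Y # Zs)"
    let ?D = "f M X (Y # Zs) - (\<chi> i. trace_sum_eval M ?\<rho> L) :: bop ^ 1"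
    have YZ: "length (Y # Zs) = Suc l" "set (Y # Zs) \<subseteq> sa_tuples M" using Y Zs by auto
    have \<rho>A: "?\<rho> v \<in> A" if "v \<in> trace_sum_letters L" for v
      using X YZ sa_tuples_tuples by (intro letter_eval_A[OF L _ _ _ that]) blast+
    have LA: "trace_sum_eval M ?\<rho> L \<in> A" by (intro trace_sum_eval_A \<rho>A)
    have "f M X (Y # Zs) \<in> tuples M" using f M X YZ unfolding C_tr_def by blast
    then have fA: "f M X (Y # Zs) $ 1 \<in> A" by (rule tuples_nth)
    then have DA: "?D $ 1 \<in> A" using LA by (simp add: A_diff)
    have D: "Lp_norm M a ?D < \<epsilon>" if "Lp_norm M a Y \<le> 1" "1 \<le> a" for a
    proof (rule b[OF M X XR _ _ _ _ YZ, of a "a # replicate l \<infinity>"])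
      show "inverse a = (\<Sum>j<Suc l. inverse ((a # replicate l \<infinity>) ! j))"
        by (simp add: sum.lessThan_Suc_shift del: sum.lessThan_Suc)
      show "Lp_norm M ((a # replicate l \<infinity>) ! j) ((Y # Zs) ! j) \<le> 1" if "j < Suc l" for j
        using that \<open>Lp_norm M a Y \<le> 1\<close> Zn Zs(1) by (cases j) auto
    qed (use that in auto)
    have "cmod (\<tau> (?D $ 1)) < \<epsilon>"
      using Yn D[of 1] D[of \<infinity>] cmod_tau_le_Lp_1[OF DA] cmod_tau_le_Lp_inf[OF DA] by force
    moreover have "\<tau> (?D $ 1) = \<tau> (f M X (Y # Zs) $ 1) - \<tau> (trace_sum_eval M ?\<rho> L)"
      using fA LA by (simp add: tau_diff)
    moreover have "\<tau> (trace_sum_eval M ?\<rho> L) = (\<Sum>i\<in>UNIV. \<tau> (?\<rho> (YV 0 i) o\<^sub>L trace_sum_eval M ?\<rho> (H i)))"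
      by (rule He[OF bspec[OF W M]]) (rule \<rho>A)
    moreover have "(\<Sum>i\<in>UNIV. \<tau> (?\<rho> (YV 0 i) o\<^sub>L trace_sum_eval M ?\<rho> (H i)))
        = tr_inner M Y (\<chi> i. trace_sum_eval M (letter_eval X (0 # Zs)) (H i))"
      unfolding tr_inner_def
    proof (rule sum.cong)
      fix i
      \<comment> \<open>\<open>H i\<close> has no letter of argument 0; the 0 in front of
        \<open>Zs\<close> is a place holder that preserves the numbering of the other
        arguments.\<close>
      have "?\<rho> v = letter_eval X (0 # Zs) v" if "v \<in> trace_sum_letters (H i)" for v
        using HXV[OF that] by (cases v) (auto simp: nth_Cons')
      then have "trace_sum_eval M ?\<rho> (H i) = trace_sum_eval M (letter_eval X (0 # Zs)) (H i)"
        by (rule trace_sum_eval_cong)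
      then show "\<tau> (?\<rho> (YV 0 i) o\<^sub>L trace_sum_eval M ?\<rho> (H i))
        = \<tau> (adj (Y $ i) o\<^sub>L (\<chi> i. trace_sum_eval M (letter_eval X (0 # Zs)) (H i)) $ i)"
        using Y by (simp add: sa_adj sa_tuples_nth)
    qed simp
    ultimately show ?thesis by simp
  qed
  note B = this
  have A: "\<forall>i. \<forall>v\<in>trace_sum_letters (H i). \<forall>j i. v = YV j i \<longrightarrow> 0 < j \<and> j < Suc l"
    using HXV by blast
  show ?thesis
    by (rule exI[of _ H], rule conjI[OF A], intro ballI allI impI) (rule B; assumption)
qed

lemma scalar_approx_1:
  fixes f :: "('n::finite, 1) family"
  assumes W: "\<forall>M\<in>W. tracial_algebra M" and f: "f \<in> C_tr W 1" and R: "0 < R" "0 < \<epsilon>"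
  shows "\<exists>H :: 'n \<Rightarrow> 'n letter trace_sum. (\<forall>i. trace_sum_letters (H i) \<subseteq> range XV) \<and>
    (\<forall>M\<in>W. \<forall>X\<in>sa_tuples M. \<forall>Y\<in>sa_tuples M. Lp_norm M \<infinity> X \<le> R \<longrightarrow>
      (Lp_norm M 1 Y \<le> 1 \<or> Lp_norm M \<infinity> Y \<le> 1) \<longrightarrow>
      cmod (snd M (f M X [Y] $ 1) - tr_inner M Y (\<chi> i. trace_sum_eval M (letter_eval X [0]) (H i))) < \<epsilon>)"
proof -
  have "f \<in> C_tr W (Suc 0)" using f by simp
  from scalar_approx_Suc[OF W this R] obtain H :: "'n \<Rightarrow> 'n letter trace_sum" where
    HH: "(\<forall>i. \<forall>v\<in>trace_sum_letters (H i). \<forall>j i. v = YV j i \<longrightarrow> 0 < j \<and> j < Suc 0) \<and>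
    (\<forall>M\<in>W. \<forall>X\<in>sa_tuples M. \<forall>Y\<in>sa_tuples M. \<forall>Zs. length Zs = 0 \<longrightarrow> set Zs \<subseteq> sa_tuples M \<longrightarrow>
      Lp_norm M \<infinity> X \<le> R \<longrightarrow> (Lp_norm M 1 Y \<le> 1 \<or> Lp_norm M \<infinity> Y \<le> 1) \<longrightarrow> (\<forall>Z\<in>set Zs. Lp_norm M \<infinity> Z \<le> 1) \<longrightarrow>
      cmod (snd M (f M X (Y # Zs) $ 1) - tr_inner M Y (\<chi> i. trace_sum_eval M (letter_eval X (0 # Zs)) (H i))) < \<epsilon>)" ..
  have "v \<in> range XV" if "v \<in> trace_sum_letters (H i)" for v i
    using conjunct1[OF HH] that by (cases v) fastforce+
  with conjunct2[OF HH] show ?thesis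
    by (intro exI[of _ H] conjI ballI allI impI subsetI) auto
qed

section \<open>Directional derivatives\<close>

lemma has_dir_deriv_zero: "has_dir_deriv F X 0 0"
  by (simp add: has_dir_deriv_def)

lemma has_dir_deriv_scale:
  assumes "has_dir_deriv F X Y L" shows "has_dir_deriv F X (c *\<^sub>R Y) (c *\<^sub>R L)"
proof (cases "c = 0")
  case False
  have l: "((\<lambda>t::real. c * t) \<longlongrightarrow> 0) (at 0)" by (auto intro!: tendsto_eq_intros)
  have "eventually (\<lambda>t. c * t \<noteq> 0) (at 0)"
    using False by (auto simp: eventually_at intro: exI[of _ 1])
  from tendsto_compose_eventually[OF assms[unfolded has_dir_deriv_def] l this]
  have "((\<lambda>t. c *\<^sub>R ((F (X + (c * t) *\<^sub>R Y) - F X) /\<^sub>R (c * t))) \<longlongrightarrow> c *\<^sub>R L) (at 0)"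
    by (intro tendsto_scaleR tendsto_const)
  moreover have "c *\<^sub>R ((F (X + (c * t) *\<^sub>R Y) - F X) /\<^sub>R (c * t)) = (F (X + t *\<^sub>R (c *\<^sub>R Y)) - F X) /\<^sub>R t" for t
    using False by (simp add: mult.commute)
  ultimately show ?thesis by (simp add: has_dir_deriv_def)
qed (simp add: has_dir_deriv_zero)

lemma dir_deriv_DERIV:
  fixes G :: "'a::real_vector \<Rightarrow> complex"
  assumes "has_dir_deriv G (X + t *\<^sub>R Y) Y L"
  shows "((\<lambda>t. Re (G (X + t *\<^sub>R Y))) has_real_derivative Re L) (at t)"
proof -
  have "((\<lambda>h. Re ((G ((X + t *\<^sub>R Y) + h *\<^sub>R Y) - G (X + t *\<^sub>R Y)) /\<^sub>R h)) \<longlongrightarrow> Re L) (at 0)"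
    using assms unfolding has_dir_deriv_def by (rule tendsto_Re)
  moreover have "Re ((G ((X + t *\<^sub>R Y) + h *\<^sub>R Y) - G (X + t *\<^sub>R Y)) /\<^sub>R h)
      = (Re (G (X + (t + h) *\<^sub>R Y)) - Re (G (X + t *\<^sub>R Y))) / h" for h
    by (simp add: scaleR_add_left add.assoc divide_inverse mult.commute)
  ultimately show ?thesis by (simp add: DERIV_def)
qed

lemma dir_deriv_eq: "has_dir_deriv F X Y L \<Longrightarrow> dir_deriv F X Y = L"
  unfolding dir_deriv_def by (rule the_equality) (auto dest: has_dir_deriv_unique)

text \<open>The limit is found along 1/(n+1); the Cauchy condition then transfers it to all small
  arguments.\<close>

lemma limit_at_0_from_Cauchy:
  fixes D :: "real \<Rightarrow> 'a::complete_space"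
  assumes C: "\<And>e. 0 < e \<Longrightarrow> \<exists>d>0. \<forall>s t. s \<noteq> 0 \<longrightarrow> t \<noteq> 0 \<longrightarrow> \<bar>s\<bar> < d \<longrightarrow> \<bar>t\<bar> < d \<longrightarrow> dist (D s) (D t) \<le> e"
  shows "\<exists>L. (D \<longlongrightarrow> L) (at 0)"
proof -
  define u where "u n = inverse (real (Suc n))" for n
  have u: "u n > 0" for n by (simp add: u_def)
  have small: "\<exists>N. \<forall>n\<ge>N. u n < d" if d: "0 < d" for d
  proof -
    obtain N where N: "inverse (real (Suc N)) < d" using reals_Archimedean[OF d] by blast
    have "u n < d" if "n \<ge> N" for n
    proof -
      have "u n \<le> inverse (real (Suc N))" unfolding u_def using that by (simp add: field_simps)
      with N show ?thesis by simp
    qed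
    then show ?thesis by blast
  qed
  have "Cauchy (\<lambda>n. D (u n))"
  proof (rule metric_CauchyI)
    fix e :: real assume e: "0 < e"
    then obtain d where d: "d > 0" "\<And>s t. s \<noteq> 0 \<Longrightarrow> t \<noteq> 0 \<Longrightarrow> \<bar>s\<bar> < d \<Longrightarrow> \<bar>t\<bar> < d \<Longrightarrow> dist (D s) (D t) \<le> e/2"
      using C[of "e/2"] by auto
    obtain N where N: "\<And>n. n \<ge> N \<Longrightarrow> u n < d" using small[OF d(1)] by blast
    have "dist (D (u m)) (D (u n)) < e" if "m \<ge> N" "n \<ge> N" for m n
    proof -
      have "dist (D (u m)) (D (u n)) \<le> e/2"
        using N[OF that(1)] N[OF that(2)] u[of m] u[of n] by (intro d(2)) auto
      with e show ?thesis by simp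
    qed
    then show "\<exists>N. \<forall>m\<ge>N. \<forall>n\<ge>N. dist (D (u m)) (D (u n)) < e" by blast
  qed
  then obtain L where L: "(\<lambda>n. D (u n)) \<longlonglongrightarrow> L" using Cauchy_convergent convergent_def by blast
  have "(D \<longlongrightarrow> L) (at 0)"
  proof (rule tendstoI)
    fix e :: real assume e: "0 < e"
    then obtain d where d: "d > 0" "\<And>s t. s \<noteq> 0 \<Longrightarrow> t \<noteq> 0 \<Longrightarrow> \<bar>s\<bar> < d \<Longrightarrow> \<bar>t\<bar> < d \<Longrightarrow> dist (D s) (D t) \<le> e/2"
      using C[of "e/2"] by auto
    obtain N where N: "\<And>n. n \<ge> N \<Longrightarrow> u n < d" using small[OF d(1)] by blast
    have "dist (D s) L < e" if s: "s \<noteq> 0" "\<bar>s\<bar> < d" for s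
    proof -
      have "dist (D s) L \<le> e/2"
      proof (rule LIMSEQ_le_const2)
        show "(\<lambda>n. dist (D s) (D (u n))) \<longlonglongrightarrow> dist (D s) L" by (intro tendsto_intros L)
        have "dist (D s) (D (u n)) \<le> e/2" if "n \<ge> N" for n
          using N[OF that] u[of n] s by (intro d(2)) auto
        then show "\<exists>N. \<forall>n\<ge>N. dist (D s) (D (u n)) \<le> e/2" by blast
      qed
      with e show ?thesis by simp
    qed
    then show "\<forall>\<^sub>F s in at 0. dist (D s) L < e"
      using d(1) by (auto simp: eventually_at)
  qed
  then show ?thesis by blast
qed

context tracial_algebra begin

lemma has_dir_deriv_tau:
  assumes d: "has_dir_deriv G X Y L" and G: "\<And>t. G (X + t *\<^sub>R Y) \<in> tuples M" and L: "L \<in> tuples M"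
  shows "has_dir_deriv (\<lambda>X. \<tau> (G X $ i)) X Y (\<tau> (L $ i))"
proof -
  have G0: "G X \<in> tuples M" using G[of 0] by simp
  have "((\<lambda>t. ((G (X + t *\<^sub>R Y) - G X) /\<^sub>R t) $ i) \<longlongrightarrow> L $ i) (at 0)"
    using d unfolding has_dir_deriv_def by (rule tendsto_vec_nth)
  then have "((\<lambda>t. \<tau> (((G (X + t *\<^sub>R Y) - G X) /\<^sub>R t) $ i)) \<longlongrightarrow> \<tau> (L $ i)) (at 0)"
    using G G0 L by (intro tendsto_tau always_eventually allI) (simp_all add: A_intros tuples_nth)
  moreover have "\<tau> (((G (X + t *\<^sub>R Y) - G X) /\<^sub>R t) $ i) = (\<tau> (G (X + t *\<^sub>R Y) $ i) - \<tau> (G X $ i)) /\<^sub>R t" for t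
  proof -
    have "\<tau> (((G (X + t *\<^sub>R Y) - G X) /\<^sub>R t) $ i) = of_real (inverse t) * (\<tau> (G (X + t *\<^sub>R Y) $ i) - \<tau> (G X $ i))"
      using G[of t] G0 by (simp only: vector_scaleR_component vector_minus_component tau_scaleR tau_diff A_diff tuples_nth)
    then show ?thesis by (simp add: scaleR_conv_of_real)
  qed
  ultimately show ?thesis by (simp add: has_dir_deriv_def)
qed

lemma has_dir_deriv_tr_inner:
  assumes d: "has_dir_deriv G X Y L" and G: "\<And>t. G (X + t *\<^sub>R Y) \<in> tuples M" and L: "L \<in> tuples M" and V: "V \<in> tuples M"
  shows "has_dir_deriv (\<lambda>X. tr_inner M V (G X)) X Y (tr_inner M V L)"
proof -
  have G0: "G X \<in> tuples M" using G[of 0] by simp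
  have lim: "((\<lambda>t. ((G (X + t *\<^sub>R Y) - G X) /\<^sub>R t) $ i) \<longlongrightarrow> L $ i) (at 0)" for i
    using d unfolding has_dir_deriv_def by (rule tendsto_vec_nth)
  have "((\<lambda>t. tr_inner M V ((G (X + t *\<^sub>R Y) - G X) /\<^sub>R t)) \<longlongrightarrow> tr_inner M V L) (at 0)"
    unfolding tr_inner_def using G G0 L V
    by (intro tendsto_sum tendsto_tau tendsto_oL tendsto_const lim always_eventually allI) (simp_all add: A_intros tuples_nth)
  moreover have "tr_inner M V ((G (X + t *\<^sub>R Y) - G X) /\<^sub>R t) = (tr_inner M V (G (X + t *\<^sub>R Y)) - tr_inner M V (G X)) /\<^sub>R t" for t
    using tr_inner_simps(5)[OF V tuples_intros(2)[OF G[of t] G0] V, of "inverse t"] tr_inner_simps(3)[OF V G[of t] G0]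
    by (simp add: scaleR_conv_of_real)
  ultimately show ?thesis by (simp add: has_dir_deriv_def)
qed

lemma Lp_inf_scaleR: "Lp_norm M \<infinity> (r *\<^sub>R X) = \<bar>r\<bar> * Lp_norm M \<infinity> X"
proof (rule antisym)
  show "Lp_norm M \<infinity> (r *\<^sub>R X) \<le> \<bar>r\<bar> * Lp_norm M \<infinity> X"
    by (rule Lp_inf_leI, unfold vector_scaleR_component norm_scaleR)
      (intro mult_left_mono norm_nth_le_Lp_inf abs_ge_zero)
  show "\<bar>r\<bar> * Lp_norm M \<infinity> X \<le> Lp_norm M \<infinity> (r *\<^sub>R X)"
  proof (cases "r = 0")
    case False
    have "Lp_norm M \<infinity> X \<le> Lp_norm M \<infinity> (r *\<^sub>R X) / \<bar>r\<bar>"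
    proof (rule Lp_inf_leI)
      fix j show "norm (X $ j) \<le> Lp_norm M \<infinity> (r *\<^sub>R X) / \<bar>r\<bar>"
        using norm_nth_le_Lp_inf[of "r *\<^sub>R X" j M] False by (simp add: field_simps)
    qed
    with False show ?thesis by (simp add: field_simps)
  next
    case True
    then show ?thesis using norm_nth_le_Lp_inf[of "0 :: bop ^ 'a" undefined M] by simp
  qed
qed

text \<open>The approximations are uniform only over unit balls of directions; homogeneity of
  derivatives and this scaling cover the remaining directions.\<close>

lemma unit_direction:
  assumes "Y \<in> sa_tuples M"
  obtains r Y' where "Y = r *\<^sub>R Y'" "Y' \<in> sa_tuples M" "Lp_norm M \<infinity> Y' \<le> 1"
proof -
  define r where "r = max 1 (Lp_norm M \<infinity> Y)"
  have r: "r > 0" "Lp_norm M \<infinity> Y \<le> r" by (auto simp: r_def)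
  show ?thesis
  proof
    show "Y = r *\<^sub>R ((1 / r) *\<^sub>R Y)" using r by simp
    show "(1 / r) *\<^sub>R Y \<in> sa_tuples M" by (intro sa_tuples_intros assms)
    show "Lp_norm M \<infinity> ((1 / r) *\<^sub>R Y) \<le> 1" unfolding Lp_inf_scaleR using r by simp
  qed
qed

end

section \<open>Gradient and Hessian of a trace-smooth potential\<close>

text \<open>F consists of the first stages of a derivative chain as in \<open>Ck_tr\<close>; fixing
  it gives names to the derivatives.\<close>

locale potential =
  fixes W :: "tracial set" and \<phi> :: "'n::finite scalar_family" and F :: "nat \<Rightarrow> ('n, 1) family"
  assumes W: "\<forall>M\<in>W. tracial_algebra M"
    and F0: "F 0 = scalar_embed \<phi>"
    and C0: "F 0 \<in> C_tr W 0" and C1: "F 1 \<in> C_tr W 1" and C2: "F 2 \<in> C_tr W 2"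
    and D1: "\<And>M X Y. M \<in> W \<Longrightarrow> X \<in> sa_tuples M \<Longrightarrow> Y \<in> sa_tuples M \<Longrightarrow>
      has_dir_deriv (\<lambda>X. F 0 M X []) X Y (F 1 M X [Y])"
    and D2: "\<And>M X Y Y'. M \<in> W \<Longrightarrow> X \<in> sa_tuples M \<Longrightarrow> Y \<in> sa_tuples M \<Longrightarrow> Y' \<in> sa_tuples M \<Longrightarrow>
      has_dir_deriv (\<lambda>X. F 1 M X [Y]) X Y' (F 2 M X [Y, Y'])"
    and real: "\<And>M X. M \<in> W \<Longrightarrow> X \<in> sa_tuples M \<Longrightarrow> \<phi> M X \<in> \<real>"

locale potential_at = potential W \<phi> F + tracial_algebra M
  for W and \<phi> :: "'n::finite scalar_family" and F and M +
  assumes M: "M \<in> W"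
begin

lemma F0_tuples: "X \<in> sa_tuples M \<Longrightarrow> F 0 M X [] \<in> tuples M"
  and F1_tuples: "X \<in> sa_tuples M \<Longrightarrow> Y \<in> sa_tuples M \<Longrightarrow> F 1 M X [Y] \<in> tuples M"
  and F2_tuples: "X \<in> sa_tuples M \<Longrightarrow> Y \<in> sa_tuples M \<Longrightarrow> Y' \<in> sa_tuples M \<Longrightarrow> F 2 M X [Y, Y'] \<in> tuples M"
  using C0 C1 C2 M by (auto simp: C_tr_def)

lemma line_sa: "X \<in> sa_tuples M \<Longrightarrow> Y \<in> sa_tuples M \<Longrightarrow> X + t *\<^sub>R Y \<in> sa_tuples M"
  by (intro sa_tuples_intros)

text \<open>The chain F has operator values. The scalar \<phi> is recovered from its multiple of the
  identity by \<tau>, so its derivatives are traces of the later stages.\<close>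

lemma has_dir_deriv_phi:
  assumes X: "X \<in> sa_tuples M" and Y: "Y \<in> sa_tuples M"
  shows "has_dir_deriv (\<phi> M) X Y (\<tau> (F 1 M X [Y] $ 1))"
proof -
  have "\<tau> (F 0 M X [] $ 1) = \<phi> M X" for X
    by (simp add: F0 scalar_embed_def tau_scaleC A_id tau_id)
  moreover have "has_dir_deriv (\<lambda>X. \<tau> (F 0 M X [] $ 1)) X Y (\<tau> (F 1 M X [Y] $ 1))"
    by (intro has_dir_deriv_tau D1 M F0_tuples F1_tuples line_sa X Y)
  ultimately show ?thesis by simp
qed

lemma has_dir_deriv_F1:
  assumes "X \<in> sa_tuples M" "Y \<in> sa_tuples M" "Y' \<in> sa_tuples M"
  shows "has_dir_deriv (\<lambda>X. \<tau> (F 1 M X [Y] $ 1)) X Y' (\<tau> (F 2 M X [Y, Y'] $ 1))"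
  by (intro has_dir_deriv_tau D2 M F1_tuples F2_tuples line_sa assms)

lemma tau_F1_scaleR:
  assumes "X \<in> sa_tuples M" "Y \<in> sa_tuples M"
  shows "\<tau> (F 1 M X [r *\<^sub>R Y] $ 1) = of_real r * \<tau> (F 1 M X [Y] $ 1)"
proof -
  have "has_dir_deriv (\<phi> M) X (r *\<^sub>R Y) (r *\<^sub>R \<tau> (F 1 M X [Y] $ 1))"
    by (intro has_dir_deriv_scale has_dir_deriv_phi assms)
  moreover have "has_dir_deriv (\<phi> M) X (r *\<^sub>R Y) (\<tau> (F 1 M X [r *\<^sub>R Y] $ 1))"
    by (intro has_dir_deriv_phi sa_tuples_intros assms)
  ultimately show ?thesis using has_dir_deriv_unique by (metis scaleR_conv_of_real)
qed

section \<open>Existence, uniqueness and self-adjointness of the gradient\<close>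

definition is_gradient :: "bop ^ 'n \<Rightarrow> bop ^ 'n \<Rightarrow> bool" where
  "is_gradient X G \<longleftrightarrow> G \<in> tuples M \<and> (\<forall>Y\<in>sa_tuples M. \<tau> (F 1 M X [Y] $ 1) = tr_inner M Y G)"

lemma is_gradient_iff:
  assumes X: "X \<in> sa_tuples M"
  shows "is_gradient X G \<longleftrightarrow> G \<in> tuples M \<and> (\<forall>Y\<in>sa_tuples M. has_dir_deriv (\<phi> M) X Y (tr_inner M Y G))"
  unfolding is_gradient_def using has_dir_deriv_phi[OF X] has_dir_deriv_unique by metis

lemma is_gradient_unique:
  assumes "is_gradient X G" "is_gradient X G'" shows "G = G'"
proof -
  have G: "G \<in> tuples M" "G' \<in> tuples M" using assms by (auto simp: is_gradient_def)
  have "norm (G $ j - G' $ j) \<le> 2 * 0" for j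
  proof (rule norm_by_duality)
    show "G $ j - G' $ j \<in> A" using G by (simp add: A_diff tuples_nth)
    fix Q assume Q: "Q \<in> sa A"
    have "tr_inner M (axis j (Q o\<^sub>L Q)) G = tr_inner M (axis j (Q o\<^sub>L Q)) G'"
      using assms axis_square_sa[OF Q, of j] unfolding is_gradient_def by metis
    then have "\<tau> (Q o\<^sub>L Q o\<^sub>L (G $ j - G' $ j)) = 0"
      using G Q unfolding tr_inner_axis adj_square[OF Q] by (simp add: oL_bilinear tau_diff A_oL sa_A tuples_nth)
    then show "cmod (\<tau> (Q o\<^sub>L Q o\<^sub>L (G $ j - G' $ j))) \<le> 0" by simp
  qed simp
  then show ?thesis by (simp add: vec_eq_iff)
qed

text \<open>An error in the derivative that is uniform over directions in the L1 ball becomes an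
  operator norm error in the gradient.\<close>

lemma gradient_approx_error:
  assumes X: "X \<in> sa_tuples M" and G: "is_gradient X G" and h: "h \<in> tuples M" and e: "0 \<le> e"
    and b: "\<And>Y. Y \<in> sa_tuples M \<Longrightarrow> Lp_norm M 1 Y \<le> 1 \<Longrightarrow> cmod (\<tau> (F 1 M X [Y] $ 1) - tr_inner M Y h) \<le> e"
  shows "norm (G $ j - h $ j) \<le> 2 * e"
proof (rule norm_by_duality[OF _ e])
  have GA: "G \<in> tuples M" using G by (simp add: is_gradient_def)
  show "G $ j - h $ j \<in> A" using GA h by (simp add: A_diff tuples_nth)
  fix Q assume Q: "Q \<in> sa A" "Re (\<tau> (Q o\<^sub>L Q)) \<le> 1"
  let ?Y = "axis j (Q o\<^sub>L Q)"
  have "\<tau> (F 1 M X [?Y] $ 1) = tr_inner M ?Y G"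
    using G axis_square_sa[OF Q(1)] unfolding is_gradient_def by blast
  moreover have "cmod (\<tau> (F 1 M X [?Y] $ 1) - tr_inner M ?Y h) \<le> e"
    by (intro b axis_square_sa Q(1)) (simp add: Lp_norm_1_axis Q)
  ultimately have "cmod (tr_inner M ?Y G - tr_inner M ?Y h) \<le> e" by simp
  then show "cmod (\<tau> (Q o\<^sub>L Q o\<^sub>L (G $ j - h $ j))) \<le> e"
    using GA h Q(1) unfolding tr_inner_axis adj_square[OF Q(1)] by (simp add: oL_bilinear tau_diff A_oL sa_A tuples_nth)
qed

lemma XV_sum_tuples:
  assumes "X \<in> sa_tuples M" "\<And>i. trace_sum_letters (H i) \<subseteq> range XV"
  shows "(\<chi> i. trace_sum_eval M (letter_eval X [0]) (H i)) \<in> tuples M"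
proof -
  have "trace_sum_eval M (letter_eval X [0]) (H i) \<in> A" for i
    using assms(2)[of i] by (intro trace_sum_eval_A) (auto simp: tuples_nth[OF sa_tuples_tuples[OF assms(1)]])
  then show ?thesis by (simp add: tuples_def)
qed

text \<open>Trace polynomials g n represent the derivative up to u n. On L1 unit directions this
  makes each component of g Cauchy in operator norm; on directions of operator norm at most 1 it
  identifies the limit as a gradient, and homogeneity extends this to all directions.\<close>

lemma ex_gradient:
  assumes X: "X \<in> sa_tuples M" shows "\<exists>G. is_gradient X G"
proof -
  define R where "R = max 1 (Lp_norm M \<infinity> X)"
  have R: "0 < R" "Lp_norm M \<infinity> X \<le> R" by (auto simp: R_def)
  define u where "u n = inverse (real (Suc n))" for n
  have u0: "0 < u n" for n by (simp add: u_def)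
  have u_lim: "u \<longlonglongrightarrow> 0" unfolding u_def by (rule LIMSEQ_inverse_real_of_nat)
  have "\<exists>g\<in>tuples M. \<forall>Y\<in>sa_tuples M. (Lp_norm M 1 Y \<le> 1 \<or> Lp_norm M \<infinity> Y \<le> 1) \<longrightarrow>
      cmod (\<tau> (F 1 M X [Y] $ 1) - tr_inner M Y g) < u n" for n
  proof -
    from scalar_approx_1[OF W C1 R(1) u0[of n]] obtain H :: "'n \<Rightarrow> 'n letter trace_sum" where
      HH: "(\<forall>i. trace_sum_letters (H i) \<subseteq> range XV) \<and>
    (\<forall>M\<in>W. \<forall>X\<in>sa_tuples M. \<forall>Y\<in>sa_tuples M. Lp_norm M \<infinity> X \<le> R \<longrightarrow>
      (Lp_norm M 1 Y \<le> 1 \<or> Lp_norm M \<infinity> Y \<le> 1) \<longrightarrow>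
      cmod (snd M (F 1 M X [Y] $ 1) - tr_inner M Y (\<chi> i. trace_sum_eval M (letter_eval X [0]) (H i))) < u n)" ..
    then show ?thesis using XV_sum_tuples[OF X, of H] M X R(2)
      by (intro bexI[of _ "\<chi> i. trace_sum_eval M (letter_eval X [0]) (H i)"]) auto
  qed
  then obtain g where g: "\<And>n. g n \<in> tuples M" and
    b: "\<And>n Y. Y \<in> sa_tuples M \<Longrightarrow> Lp_norm M 1 Y \<le> 1 \<or> Lp_norm M \<infinity> Y \<le> 1 \<Longrightarrow>
      cmod (\<tau> (F 1 M X [Y] $ 1) - tr_inner M Y (g n)) < u n" by metis
  have diff: "norm (g m $ j - g n $ j) \<le> 2 * (u m + u n)" for m n j
  proof (rule norm_by_duality)
    show "g m $ j - g n $ j \<in> A" using g by (simp add: A_diff tuples_nth)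
    show "0 \<le> u m + u n" using u0[of m] u0[of n] by simp
    fix Q assume Q: "Q \<in> sa A" "Re (\<tau> (Q o\<^sub>L Q)) \<le> 1"
    let ?Y = "axis j (Q o\<^sub>L Q)"
    have "Lp_norm M 1 ?Y \<le> 1" using Q by (simp add: Lp_norm_1_axis)
    then have "cmod (\<tau> (F 1 M X [?Y] $ 1) - tr_inner M ?Y (g m)) < u m"
      "cmod (\<tau> (F 1 M X [?Y] $ 1) - tr_inner M ?Y (g n)) < u n"
      using b[OF axis_square_sa[OF Q(1)]] by auto
    moreover have "tr_inner M ?Y (g m) - tr_inner M ?Y (g n)
      = (\<tau> (F 1 M X [?Y] $ 1) - tr_inner M ?Y (g n)) - (\<tau> (F 1 M X [?Y] $ 1) - tr_inner M ?Y (g m))" by simp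
    ultimately have "cmod (tr_inner M ?Y (g m) - tr_inner M ?Y (g n)) \<le> u m + u n"
      by (smt (verit) norm_triangle_ineq4)
    then show "cmod (\<tau> (Q o\<^sub>L Q o\<^sub>L (g m $ j - g n $ j))) \<le> u m + u n"
      using g Q(1) unfolding tr_inner_axis adj_square[OF Q(1)] by (simp add: oL_bilinear tau_diff A_oL sa_A tuples_nth)
  qed
  have "\<exists>l. (\<lambda>n. g n $ j) \<longlonglongrightarrow> l" for j
  proof -
    have "Cauchy (\<lambda>n. g n $ j)"
    proof (rule metric_CauchyI)
      fix e :: real assume "0 < e"
      then obtain N where N: "\<forall>n\<ge>N. u n < e / 4"
        using order_tendstoD(2)[OF u_lim, of "e/4"] by (auto simp: eventually_sequentially)
      have "dist (g m $ j) (g n $ j) < e" if "m \<ge> N" "n \<ge> N" for m n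
      proof -
        have "u m < e/4" "u n < e/4" using N that by auto
        then have "2 * (u m + u n) < e" by simp
        with diff[where m = m and n = n and j = j] show ?thesis unfolding dist_norm by (rule le_less_trans)
      qed
      then show "\<exists>N. \<forall>m\<ge>N. \<forall>n\<ge>N. dist (g m $ j) (g n $ j) < e" by blast
    qed
    then show ?thesis using Cauchy_convergent convergent_def by blast
  qed
  then obtain G0 where G0: "\<And>j. (\<lambda>n. g n $ j) \<longlonglongrightarrow> G0 j" by metis
  define G where "G = (\<chi> j. G0 j)"
  have GA: "G $ j \<in> A" for j
    unfolding G_def using closed_sequentially[OF closed_A _ G0[of j]] g by (simp add: tuples_nth)
  have unit: "\<tau> (F 1 M X [Y] $ 1) = tr_inner M Y G" if Y: "Y \<in> sa_tuples M" "Lp_norm M \<infinity> Y \<le> 1" for Y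
  proof -
    have "(\<lambda>n. tr_inner M Y (g n)) \<longlonglongrightarrow> tr_inner M Y G"
      unfolding tr_inner_def using g GA Y
      by (intro tendsto_sum tendsto_tau tendsto_oL tendsto_const always_eventually allI)
        (simp_all add: G0 G_def A_intros tuples_nth sa_tuples_tuples)
    moreover have "(\<lambda>n. tr_inner M Y (g n) - \<tau> (F 1 M X [Y] $ 1)) \<longlonglongrightarrow> 0"
    proof (rule Lim_null_comparison[OF _ u_lim])
      show "\<forall>\<^sub>F n in sequentially. norm (tr_inner M Y (g n) - \<tau> (F 1 M X [Y] $ 1)) \<le> u n"
        using b[OF Y(1)] Y(2) by (intro always_eventually allI) (simp add: norm_minus_commute less_imp_le)
    qed
    then have "(\<lambda>n. tr_inner M Y (g n)) \<longlonglongrightarrow> \<tau> (F 1 M X [Y] $ 1)" by (rule LIM_zero_cancel)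
    ultimately show ?thesis using LIMSEQ_unique by blast
  qed
  have Gt: "G \<in> tuples M" using GA by (simp add: tuples_def)
  have "\<tau> (F 1 M X [Y] $ 1) = tr_inner M Y G" if Y: "Y \<in> sa_tuples M" for Y
  proof -
    obtain r Y' where r: "Y = r *\<^sub>R Y'" "Y' \<in> sa_tuples M" "Lp_norm M \<infinity> Y' \<le> 1"
      using unit_direction[OF Y] .
    then show ?thesis using tau_F1_scaleR[OF X r(2)] unit[OF r(2,3)] tr_inner_simps(6)[OF sa_tuples_tuples[OF r(2)] Gt Gt]
      by simp
  qed
  with Gt show ?thesis unfolding is_gradient_def by blast
qed

lemma nabla_is_gradient:
  assumes X: "X \<in> sa_tuples M" shows "is_gradient X (nabla \<phi> M X)"
proof -
  obtain G where G: "is_gradient X G" using ex_gradient[OF X] by blast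
  have "nabla \<phi> M X = G"
    unfolding nabla_def is_gradient_iff[OF X, symmetric]
    using G is_gradient_unique by blast
  with G show ?thesis by simp
qed

lemma tau_F1_eq: "X \<in> sa_tuples M \<Longrightarrow> Y \<in> sa_tuples M \<Longrightarrow> \<tau> (F 1 M X [Y] $ 1) = tr_inner M Y (nabla \<phi> M X)"
  using nabla_is_gradient by (simp add: is_gradient_def)

text \<open>\<phi> is real, so its derivatives along self-adjoint directions are real; hence the
  componentwise adjoint of the gradient is again a gradient, and uniqueness applies.\<close>

lemma nabla_sa:
  assumes X: "X \<in> sa_tuples M" shows "nabla \<phi> M X \<in> sa_tuples M"
proof -
  let ?G = "nabla \<phi> M X"
  have G: "?G \<in> tuples M" using nabla_is_gradient[OF X] by (simp add: is_gradient_def)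
  define G' where "G' = (\<chi> j. adj (?G $ j))"
  have G': "G' \<in> tuples M" using G by (simp add: G'_def tuples_def A_adj)
  have "\<tau> (F 1 M X [Y] $ 1) = tr_inner M Y G'" if Y: "Y \<in> sa_tuples M" for Y
  proof -
    have "\<tau> (F 1 M X [Y] $ 1) \<in> \<real>"
    proof (rule Lim_in_closed_set[OF closed_complex_Reals _ _ has_dir_deriv_phi[OF X Y, unfolded has_dir_deriv_def]])
      show "\<forall>\<^sub>F t in at 0. (\<phi> M (X + t *\<^sub>R Y) - \<phi> M X) /\<^sub>R t \<in> \<real>"
        using real[OF M line_sa[OF X Y]] real[OF M X] by (intro always_eventually allI) (auto simp: scaleR_conv_of_real)
    qed simp
    then have "cnj (tr_inner M Y ?G) = tr_inner M Y ?G" 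
      unfolding tau_F1_eq[OF X Y] by (simp add: Reals_cnj_iff)
    moreover have "tr_inner M Y G' = cnj (tr_inner M Y ?G)"
    proof -
      have "\<tau> (adj (Y $ j) o\<^sub>L adj (?G $ j)) = cnj (\<tau> (adj (Y $ j) o\<^sub>L ?G $ j))" for j
      proof -
        have a: "adj (Y $ j) = Y $ j" "Y $ j \<in> A" "?G $ j \<in> A" 
          using Y G sa_tuples_nth sa_adj sa_A tuples_nth by blast+
        then have "\<tau> (adj (Y $ j) o\<^sub>L ?G $ j) = \<tau> (?G $ j o\<^sub>L Y $ j)" by (simp add: tau_comm)
        moreover have "adj (?G $ j o\<^sub>L Y $ j) = Y $ j o\<^sub>L adj (?G $ j)" using a by (simp add: adj_oL A_clin)
        ultimately show ?thesis using a tau_adj[OF A_oL[OF a(3,2)]] by simp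
      qed
      then show ?thesis by (simp add: tr_inner_def G'_def)
    qed
    ultimately show ?thesis using tau_F1_eq[OF X Y] by simp
  qed
  with G' have "is_gradient X G'" by (simp add: is_gradient_def)
  then have "?G = G'" using is_gradient_unique nabla_is_gradient[OF X] by blast
  then have "adj (?G $ j) = ?G $ j" for j unfolding G'_def by (metis vec_lambda_beta)
  then show ?thesis using G by (simp add: sa_tuples_def sa_def tuples_nth)
qed

text \<open>
  By the mean value theorem the difference quotients of the gradient, tested against \<open>Y\<close> with \<open>\<parallel>Y\<parallel>\<^sub>1 \<le> 1\<close>,
  are values of the second derivative, which is continuous along the line uniformly in \<open>Y\<close>.
\<close>

lemma nabla_differentiable_unit:
  assumes X: "X \<in> sa_tuples M" and Y: "Y \<in> sa_tuples M" and Yn: "Lp_norm M \<infinity> Y \<le> 1"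
  shows "\<exists>L. has_dir_deriv (nabla \<phi> M) X Y L"
proof -
  define D where "D = (\<lambda>t. (nabla \<phi> M (X + t *\<^sub>R Y) - nabla \<phi> M X) /\<^sub>R t)"
  have Dsa: "D t \<in> sa_tuples M" for t
    unfolding D_def by (intro sa_tuples_intros nabla_sa line_sa X Y)
  have key: "\<exists>d>0. \<forall>s t. s \<noteq> 0 \<longrightarrow> t \<noteq> 0 \<longrightarrow> \<bar>s\<bar> < d \<longrightarrow> \<bar>t\<bar> < d \<longrightarrow> dist (D s $ j) (D t $ j) \<le> e"
    if e: "0 < e" for e j
  proof -
    \<comment> \<open>Each difference quotient costs 2 \<epsilon>, two of them 4 \<epsilon>, and
      \<open>norm_by_duality\<close> doubles this to 8 \<epsilon>.\<close>
    define \<epsilon> where "\<epsilon> = e / 8"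
    have \<epsilon>: "0 < \<epsilon>" using e by (simp add: \<epsilon>_def)
    \<comment> \<open>Large enough for all points X + s Y with \<bar>s\<bar> \<le> 1, so that one
      approximation serves the whole segment.\<close>
    define R where "R = \<bar>Lp_norm M \<infinity> X\<bar> + 1"
    have R: "0 < R" by (simp add: R_def)
    have XR: "Lp_norm M \<infinity> (X + s *\<^sub>R Y) \<le> R" if "\<bar>s\<bar> \<le> 1" for s
    proof (rule Lp_inf_leI)
      fix j
      have "norm ((X + s *\<^sub>R Y) $ j) \<le> norm (X $ j) + \<bar>s\<bar> * norm (Y $ j)"
        using norm_triangle_ineq[of "X $ j" "s *\<^sub>R Y $ j"] by simp
      also have "\<dots> \<le> Lp_norm M \<infinity> X + 1 * 1"
        using that Yn norm_nth_le_Lp_inf[of Y j M] by (intro add_mono mult_mono norm_nth_le_Lp_inf) auto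
      finally show "norm ((X + s *\<^sub>R Y) $ j) \<le> R" by (simp add: R_def)
    qed
    have C2': "F 2 \<in> C_tr W (Suc 1)" using C2 by (simp add: numeral_2_eq_2)
    from scalar_approx_Suc[OF W C2' R \<epsilon>] obtain H :: "'n \<Rightarrow> 'n letter trace_sum" where
      HH: "(\<forall>i. \<forall>v\<in>trace_sum_letters (H i). \<forall>j i. v = YV j i \<longrightarrow> 0 < j \<and> j < Suc 1) \<and>
      (\<forall>M\<in>W. \<forall>X\<in>sa_tuples M. \<forall>Y\<in>sa_tuples M. \<forall>Zs. length Zs = 1 \<longrightarrow> set Zs \<subseteq> sa_tuples M \<longrightarrow>
        Lp_norm M \<infinity> X \<le> R \<longrightarrow> (Lp_norm M 1 Y \<le> 1 \<or> Lp_norm M \<infinity> Y \<le> 1) \<longrightarrow> (\<forall>Z\<in>set Zs. Lp_norm M \<infinity> Z \<le> 1) \<longrightarrow>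
        cmod (snd M (F 2 M X (Y # Zs) $ 1) - tr_inner M Y (\<chi> i. trace_sum_eval M (letter_eval X (0 # Zs)) (H i))) < \<epsilon>)" ..
    note Hl = conjunct1[OF HH, rule_format] and Hb = conjunct2[OF HH, rule_format, OF M]
    \<comment> \<open>Tested along the j-th axis tuple of Q^2, the approximate second derivative is
      \<tau>(Q^2 h(s)), and h does not involve Q: continuity of h at 0 is therefore uniform over all
      tests.\<close>
    define h where "h = (\<lambda>s. trace_sum_eval M (letter_eval (X + s *\<^sub>R Y) [0, Y]) (H j))"
    have letA: "letter_eval (X + s *\<^sub>R Y) [0, Y] v \<in> A" if "v \<in> trace_sum_letters (H j)" for v s
    proof (cases v)
      case (YV k i)
      have "k = 1" using Hl[OF that YV] by linarith
      with YV show ?thesis by (simp add: tuples_nth[OF sa_tuples_tuples[OF Y]])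
    qed (use tuples_nth[OF sa_tuples_tuples[OF line_sa[OF X Y, of s]]] in simp)
    have hA: "h s \<in> A" for s unfolding h_def by (intro trace_sum_eval_A letA)
    have "(h \<longlongrightarrow> h 0) (at 0)"
      unfolding h_def
    proof (rule tendsto_trace_sum_eval)
      fix v assume v: "v \<in> trace_sum_letters (H j)"
      show "((\<lambda>s. letter_eval (X + s *\<^sub>R Y) [0, Y] v) \<longlongrightarrow> letter_eval (X + 0 *\<^sub>R Y) [0, Y] v) (at 0)"
      proof (cases v)
        case (XV i)
        have "((\<lambda>s. X $ i + s *\<^sub>R Y $ i) \<longlongrightarrow> X $ i + 0 *\<^sub>R Y $ i) (at 0)" by (intro tendsto_intros)
        with XV show ?thesis by simp
      qed simp
    qed (use letA letA[of _ 0] in auto)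
    then have "\<forall>\<^sub>F s in at 0. dist (h s) (h 0) < \<epsilon>" using \<epsilon> tendstoD by blast
    then obtain d0 where d0: "d0 > 0" "\<And>s. s \<noteq> 0 \<Longrightarrow> \<bar>s\<bar> < d0 \<Longrightarrow> dist (h s) (h 0) < \<epsilon>"
      by (auto simp: eventually_at)
    define d where "d = min 1 d0"
    have d: "d > 0" using d0 by (simp add: d_def)
    have one: "cmod (\<tau> (Q o\<^sub>L Q o\<^sub>L D t $ j) - of_real (Re (\<tau> (Q o\<^sub>L Q o\<^sub>L h 0)))) \<le> 2 * \<epsilon>"
      if Q: "Q \<in> sa A" "Re (\<tau> (Q o\<^sub>L Q)) \<le> 1" and t: "t \<noteq> 0" "\<bar>t\<bar> < d" for Q t
    proof -
      let ?V = "axis j (Q o\<^sub>L Q)"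
      have V: "?V \<in> sa_tuples M" by (rule axis_square_sa[OF Q(1)])
      let ?f = "\<lambda>s. Re (\<tau> (F 1 M (X + s *\<^sub>R Y) [?V] $ 1))"
      let ?f' = "\<lambda>s. Re (\<tau> (F 2 M (X + s *\<^sub>R Y) [?V, Y] $ 1))"
      \<comment> \<open>The mean value theorem is applied to the scalar s -> <V, grad \<phi>(X + s
        Y)>, whose derivative is the trace of \<open>F 2\<close>; its intermediate point depends on
        Q, but stays within d of 0.\<close>
      have der: "(?f has_real_derivative ?f' s) (at s)" for s
        by (rule dir_deriv_DERIV[OF has_dir_deriv_F1[OF line_sa[OF X Y] V Y]])
      obtain s where s: "\<bar>s\<bar> < d" "?f t - ?f 0 = t * ?f' s"
      proof (cases "t > 0")
        case True
        then obtain z where "0 < z" "z < t" "?f t - ?f 0 = (t - 0) * ?f' z"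
          using MVT2[of 0 t ?f ?f'] der by blast
        with t show ?thesis by (intro that[of z]) auto
      next
        case False
        with t have "t < 0" by simp
        then obtain z where "t < z" "z < 0" "?f 0 - ?f t = (0 - t) * ?f' z"
          using MVT2[of t 0 ?f ?f'] der by blast
        with t show ?thesis by (intro that[of z]) (auto simp: algebra_simps)
      qed
      have fe: "?f s = Re (tr_inner M ?V (nabla \<phi> M (X + s *\<^sub>R Y)))" for s
        by (simp only: tau_F1_eq[OF line_sa[OF X Y] V])
      have n: "nabla \<phi> M (X + t *\<^sub>R Y) \<in> tuples M" "nabla \<phi> M X \<in> tuples M" "?V \<in> tuples M"
        by (intro sa_tuples_tuples nabla_sa line_sa X Y V)+
      have "tr_inner M ?V (D t) = of_real (inverse t) * (tr_inner M ?V (nabla \<phi> M (X + t *\<^sub>R Y)) - tr_inner M ?V (nabla \<phi> M X))"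
        unfolding D_def
        by (simp only: tr_inner_simps(5)[OF n(3) tuples_intros(2)[OF n(1,2)] n(3)] tr_inner_simps(3)[OF n(3,1,2)])
      then have "Re (tr_inner M ?V (D t)) = inverse t * (?f t - ?f 0)"
        by (simp only: fe times_complex.simps(1) Re_complex_of_real Im_complex_of_real mult_zero_left diff_zero
            minus_complex.simps(1) scaleR_zero_left add_0_right tau_F1_eq[OF X V])
      also have "\<dots> = ?f' s" using s t by simp
      finally have "Re (tr_inner M ?V (D t)) = ?f' s" .
      moreover have "tr_inner M ?V (D t) \<in> \<real>" by (intro tr_inner_real V Dsa)
      ultimately have Dt: "\<tau> (Q o\<^sub>L Q o\<^sub>L D t $ j) = of_real (?f' s)"
        unfolding tr_inner_axis adj_square[OF Q(1)] by (metis of_real_Re)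
      have "cmod (\<tau> (F 2 M (X + s *\<^sub>R Y) [?V, Y] $ 1) - tr_inner M ?V (\<chi> i. trace_sum_eval M (letter_eval (X + s *\<^sub>R Y) [0, Y]) (H i))) < \<epsilon>"
        using s d_def Q Y Yn by (intro Hb line_sa X V XR) (auto simp: Lp_norm_1_axis)
      then have "cmod (\<tau> (F 2 M (X + s *\<^sub>R Y) [?V, Y] $ 1) - \<tau> (Q o\<^sub>L Q o\<^sub>L h s)) < \<epsilon>"
        unfolding tr_inner_axis adj_square[OF Q(1)] h_def by simp
      then have a: "\<bar>?f' s - Re (\<tau> (Q o\<^sub>L Q o\<^sub>L h s))\<bar> < \<epsilon>"
        unfolding minus_complex.simps(1)[symmetric] by (rule le_less_trans[OF abs_Re_le_cmod])
      have "norm (h s - h 0) \<le> \<epsilon>"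
        using d0(2)[of s] s \<epsilon> by (cases "s = 0") (auto simp: d_def dist_norm less_imp_le)
      then have "norm (h s - h 0) * Re (\<tau> (Q o\<^sub>L Q)) \<le> \<epsilon> * 1"
        using Q tau_sa_square_nonneg[OF Q(1)] \<epsilon> by (intro mult_mono) auto
      with cmod_tau_square_mult_le[OF Q(1) A_diff[OF hA hA], of s 0]
      have "cmod (\<tau> (Q o\<^sub>L Q o\<^sub>L (h s - h 0))) \<le> \<epsilon> * 1" by (rule order_trans)
      moreover have "\<tau> (Q o\<^sub>L Q o\<^sub>L (h s - h 0)) = \<tau> (Q o\<^sub>L Q o\<^sub>L h s) - \<tau> (Q o\<^sub>L Q o\<^sub>L h 0)"
        using hA Q(1) by (simp add: oL_bilinear tau_diff A_oL sa_A)
      ultimately have "\<bar>Re (\<tau> (Q o\<^sub>L Q o\<^sub>L h s)) - Re (\<tau> (Q o\<^sub>L Q o\<^sub>L h 0))\<bar> \<le> \<epsilon>"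
        using abs_Re_le_cmod[of "\<tau> (Q o\<^sub>L Q o\<^sub>L h s) - \<tau> (Q o\<^sub>L Q o\<^sub>L h 0)"] by simp
      with a have "\<bar>?f' s - Re (\<tau> (Q o\<^sub>L Q o\<^sub>L h 0))\<bar> \<le> 2 * \<epsilon>" by linarith
      then show ?thesis unfolding Dt by (metis norm_of_real of_real_diff real_norm_def)
    qed
    have "dist (D s $ j) (D t $ j) \<le> e" if st: "s \<noteq> 0" "t \<noteq> 0" "\<bar>s\<bar> < d" "\<bar>t\<bar> < d" for s t
    proof -
      have "norm (D s $ j - D t $ j) \<le> 2 * (4 * \<epsilon>)"
      proof (rule norm_by_duality)
        have DA: "D t $ j \<in> A" for t by (rule sa_A[OF sa_tuples_nth[OF Dsa]])
        show "D s $ j - D t $ j \<in> A" by (intro A_diff DA)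
        fix Q assume Q: "Q \<in> sa A" "Re (\<tau> (Q o\<^sub>L Q)) \<le> 1"
        have "\<tau> (Q o\<^sub>L Q o\<^sub>L (D s $ j - D t $ j)) = \<tau> (Q o\<^sub>L Q o\<^sub>L D s $ j) - \<tau> (Q o\<^sub>L Q o\<^sub>L D t $ j)"
          using DA Q(1) by (simp add: oL_bilinear tau_diff A_oL sa_A)
        then show "cmod (\<tau> (Q o\<^sub>L Q o\<^sub>L (D s $ j - D t $ j))) \<le> 4 * \<epsilon>"
          using one[OF Q st(1,3)] one[OF Q st(2,4)]
          by (smt (verit) norm_diff_triangle_ineq norm_minus_commute diff_add_cancel add_diff_cancel norm_triangle_sub
            norm_triangle_ineq4 diff_diff_eq2)
      qed (use \<epsilon> in simp)
      then show ?thesis by (simp add: dist_norm \<epsilon>_def)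
    qed
    with d show ?thesis by blast
  qed
  have "\<exists>L. ((\<lambda>t. D t $ j) \<longlongrightarrow> L) (at 0)" for j
    by (rule limit_at_0_from_Cauchy) (rule key)
  then obtain L where "\<And>j. ((\<lambda>t. D t $ j) \<longlongrightarrow> L j) (at 0)" by metis
  then have "(D \<longlongrightarrow> (\<chi> j. L j)) (at 0)" by (intro vec_tendstoI) simp
  then show ?thesis unfolding has_dir_deriv_def D_def by blast
qed

section \<open>The Hessian as directional derivative of the gradient\<close>

abbreviation "hess \<equiv> dir_deriv (nabla \<phi> M)"

lemma hess_deriv:
  assumes X: "X \<in> sa_tuples M" and Y: "Y \<in> sa_tuples M"
  shows "has_dir_deriv (nabla \<phi> M) X Y (hess X Y)"
proof -
  obtain r Y' where r: "Y = r *\<^sub>R Y'" "Y' \<in> sa_tuples M" "Lp_norm M \<infinity> Y' \<le> 1"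
    using unit_direction[OF Y] .
  obtain L where "has_dir_deriv (nabla \<phi> M) X Y' L" using nabla_differentiable_unit[OF X r(2,3)] by blast
  then have "has_dir_deriv (nabla \<phi> M) X Y (r *\<^sub>R L)" unfolding r(1) by (rule has_dir_deriv_scale)
  then show ?thesis by (simp add: dir_deriv_eq)
qed

lemma hess_sa:
  assumes X: "X \<in> sa_tuples M" and Y: "Y \<in> sa_tuples M" shows "hess X Y \<in> sa_tuples M"
proof -
  have "hess X Y $ j \<in> sa A" for j
  proof (rule Lim_in_closed_set[OF closed_sa])
    show "((\<lambda>t. ((nabla \<phi> M (X + t *\<^sub>R Y) - nabla \<phi> M X) /\<^sub>R t) $ j) \<longlongrightarrow> hess X Y $ j) (at 0)"
      using hess_deriv[OF X Y] unfolding has_dir_deriv_def by (rule tendsto_vec_nth)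
    show "\<forall>\<^sub>F t in at 0. ((nabla \<phi> M (X + t *\<^sub>R Y) - nabla \<phi> M X) /\<^sub>R t) $ j \<in> sa A"
      by (intro always_eventually allI sa_tuples_nth sa_tuples_intros nabla_sa line_sa X Y)
  qed simp
  then show ?thesis by (simp add: sa_tuples_def)
qed

lemma hess_scaleR: "X \<in> sa_tuples M \<Longrightarrow> Y \<in> sa_tuples M \<Longrightarrow> hess X (r *\<^sub>R Y) = r *\<^sub>R hess X Y"
  by (intro dir_deriv_eq has_dir_deriv_scale hess_deriv)

end

section \<open>The \<open>L\<^sup>2\<close> norm, convexity and contraction\<close>

context tracial_algebra begin

text \<open>By \<open>Lp_norm_2\<close> this is \<open>Lp_norm M 2\<close>, in a form free of
  functional calculus.\<close>

definition L2 :: "bop ^ 'n::finite \<Rightarrow> real" where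
  "L2 X = sqrt (Re (tr_inner M X X))"

lemma L2_nonneg: "X \<in> tuples M \<Longrightarrow> 0 \<le> L2 X"
  by (simp add: L2_def tr_inner_self_nonneg)

lemma L2_squared: "X \<in> tuples M \<Longrightarrow> (L2 X)\<^sup>2 = Re (tr_inner M X X)"
  by (simp add: L2_def tr_inner_self_nonneg)

lemma L2_scaleR: "X \<in> tuples M \<Longrightarrow> L2 (r *\<^sub>R X) = \<bar>r\<bar> * L2 X"
proof -
  assume X: "X \<in> tuples M"
  have "tr_inner M (r *\<^sub>R X) (r *\<^sub>R X) = of_real (r * r) * tr_inner M X X"
    using X by (simp add: tr_inner_simps tuples_intros)
  then have "Re (tr_inner M (r *\<^sub>R X) (r *\<^sub>R X)) = (r * r) * Re (tr_inner M X X)"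
    by (simp only: times_complex.simps(1) Re_complex_of_real Im_complex_of_real mult_zero_left diff_zero)
  then show ?thesis by (simp add: L2_def real_sqrt_mult)
qed

lemma Re_tr_inner_le: "X \<in> tuples M \<Longrightarrow> Y \<in> tuples M \<Longrightarrow> \<bar>Re (tr_inner M X Y)\<bar> \<le> L2 X * L2 Y"
  using tr_inner_Cauchy_Schwarz[of X Y] abs_Re_le_cmod[of "tr_inner M X Y"] unfolding L2_def by linarith

lemma L2_diff_squared:
  assumes "X \<in> tuples M" "Y \<in> tuples M"
  shows "(L2 (X - Y))\<^sup>2 = (L2 X)\<^sup>2 - 2 * Re (tr_inner M X Y) + (L2 Y)\<^sup>2"
  using assms tr_inner_cnj[OF assms] by (simp add: L2_squared tuples_intros tr_inner_simps)

lemma L2_triangle_diff: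
  assumes "X \<in> tuples M" "Y \<in> tuples M" shows "L2 (X - Y) \<le> L2 X + L2 Y"
proof (rule power2_le_imp_le)
  show "(L2 (X - Y))\<^sup>2 \<le> (L2 X + L2 Y)\<^sup>2"
    using Re_tr_inner_le[OF assms] unfolding L2_diff_squared[OF assms] power2_sum by linarith
qed (simp add: L2_nonneg assms)

lemma L2_minus_commute:
  assumes "X \<in> tuples M" "Y \<in> tuples M" shows "L2 (X - Y) = L2 (Y - X)"
  using L2_scaleR[OF tuples_intros(2)[OF assms(2,1)], of "-1"] by simp

end

text \<open>c is a real bound for the norm in the hypothesis; a fixed c < K makes c / K a
  contraction factor below 1.\<close>

locale convex_potential = potential W \<phi> F
  for W and \<phi> :: "'n::finite scalar_family" and F +
  fixes K c :: real
  assumes K: "0 < K" and c: "0 \<le> c" "c < K"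
    and BC: "BC_norm W 1 (\<lambda>M X Ys. dir_deriv (nabla \<phi> M) X (Ys ! 0) - K *\<^sub>R (Ys ! 0)) \<le> ennreal c"

locale convex_potential_at = convex_potential W \<phi> F K c + potential_at W \<phi> F M
  for W and \<phi> :: "'n::finite scalar_family" and F K c M
begin

text \<open>The case \<alpha> = \<alpha>_1 = 2 of the norm in the hypothesis, at Y scaled to L2 norm
  1. The value 0 of the Hessian at direction 0 lets \<open>complex_ext_sa\<close> remove the complex
  extension.\<close>

lemma hess_bound:
  assumes X: "X \<in> sa_tuples M" and Y: "Y \<in> sa_tuples M"
  shows "L2 (hess X Y - K *\<^sub>R Y) \<le> c * L2 Y"
proof (cases "L2 Y = 0")
  case True
  then have "Y = 0" using tr_inner_eq_0[OF sa_tuples_tuples[OF Y]] by (simp add: L2_def)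
  then have "hess X Y - K *\<^sub>R Y = 0" using dir_deriv_eq[OF has_dir_deriv_zero, of "nabla \<phi> M" X] by simp
  then show ?thesis using True by (simp only: L2_def) (simp add: tr_inner_def adj_zero tau_zero)
next
  case False
  define r where "r = L2 Y"
  have r: "r > 0" using False L2_nonneg[OF sa_tuples_tuples[OF Y]] by (simp add: r_def)
  define Z where "Z = (1 / r) *\<^sub>R Y"
  have Z: "Z \<in> sa_tuples M" unfolding Z_def by (intro sa_tuples_intros Y)
  have YZ: "Y = r *\<^sub>R Z" using r by (simp add: Z_def)
  have LZ: "Lp_norm M 2 Z \<le> 1"
    using L2_scaleR[OF sa_tuples_tuples[OF Y], of "1 / r"] r Lp_norm_2[OF sa_tuples_tuples[OF Z]]
    by (simp add: L2_def[symmetric] Z_def[symmetric] r_def[symmetric])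
  let ?\<Lambda> = "\<lambda>M X (Ys :: (bop ^ 'n) list). dir_deriv (nabla \<phi> M) X (Ys ! 0) - K *\<^sub>R (Ys ! 0)"
  define R where "R = max 1 (Lp_norm M \<infinity> X)"
  have "ennreal (Lp_norm M 2 (complex_ext 1 (?\<Lambda> M X) [Z])) \<le> fam_norm W 1 R ?\<Lambda>"
    by (rule Lp_le_fam_norm[OF M X, of R 2 "[2]"])
      (use LZ sa_tuples_tuples[OF Z] in \<open>auto simp: R_def\<close>)
  also have "\<dots> \<le> BC_norm W 1 ?\<Lambda>" unfolding BC_norm_def by (rule SUP_upper) (simp add: R_def)
  also have "\<dots> \<le> ennreal c" by (rule BC)
  also have "complex_ext 1 (?\<Lambda> M X) [Z] = ?\<Lambda> M X [Z]"
  proof (rule complex_ext_sa)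
    fix Zs :: "(bop ^ 'n) list" and j assume "j < 1" "Zs ! j = 0"
    then show "?\<Lambda> M X Zs = 0"
      using dir_deriv_eq[OF has_dir_deriv_zero, of "nabla \<phi> M" X] by simp
  qed (use Z in auto)
  finally have "Lp_norm M 2 (hess X Z - K *\<^sub>R Z) \<le> c" using c(1) by (simp add: ennreal_le_iff)
  moreover have t: "hess X Z - K *\<^sub>R Z \<in> tuples M"
    by (intro sa_tuples_tuples sa_tuples_intros hess_sa X Z)
  ultimately have "L2 (hess X Z - K *\<^sub>R Z) \<le> c" by (simp add: Lp_norm_2 L2_def)
  moreover have "hess X Y - K *\<^sub>R Y = r *\<^sub>R (hess X Z - K *\<^sub>R Z)"
    unfolding YZ hess_scaleR[OF X Z] by (simp add: scaleR_diff_right mult.commute)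
  ultimately show ?thesis using r L2_scaleR[OF t, of r] r_def by (simp add: mult.commute)
qed

text \<open>Along the segment from U to V the second derivative is <Y, Hess Y> \<ge> (K - c) L2(Y)^2
  \<ge> 0; applying the mean value theorem to the function and then to its derivative gives the
  tangent inequality.\<close>

lemma gradient_inequality:
  assumes U: "U \<in> sa_tuples M" and V: "V \<in> sa_tuples M"
  shows "Re (\<phi> M U) + Re (tr_inner M (V - U) (nabla \<phi> M U)) \<le> Re (\<phi> M V)"
proof -
  define Y where "Y = V - U"
  have Y: "Y \<in> sa_tuples M" unfolding Y_def by (intro sa_tuples_intros U V)
  note Yt = sa_tuples_tuples[OF Y]
  let ?p = "\<lambda>t. Re (\<phi> M (U + t *\<^sub>R Y))"
  let ?p' = "\<lambda>t. Re (tr_inner M Y (nabla \<phi> M (U + t *\<^sub>R Y)))"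
  let ?p'' = "\<lambda>t. Re (tr_inner M Y (hess (U + t *\<^sub>R Y) Y))"
  have l: "U + t *\<^sub>R Y \<in> sa_tuples M" for t by (rule line_sa[OF U Y])
  have "has_dir_deriv (\<phi> M) (U + t *\<^sub>R Y) Y (tr_inner M Y (nabla \<phi> M (U + t *\<^sub>R Y)))" for t
    using has_dir_deriv_phi[OF l Y] unfolding tau_F1_eq[OF l Y] .
  then have d1: "(?p has_real_derivative ?p' t) (at t)" for t by (rule dir_deriv_DERIV)
  have "has_dir_deriv (\<lambda>X. tr_inner M Y (nabla \<phi> M X)) (U + t *\<^sub>R Y) Y (tr_inner M Y (hess (U + t *\<^sub>R Y) Y))" for t
    by (intro has_dir_deriv_tr_inner hess_deriv l Y sa_tuples_tuples nabla_sa hess_sa line_sa)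
  then have d2: "(?p' has_real_derivative ?p'' t) (at t)" for t by (rule dir_deriv_DERIV)
  have pos: "0 \<le> ?p'' t" for t
  proof -
    have h: "hess (U + t *\<^sub>R Y) Y \<in> tuples M" by (intro sa_tuples_tuples hess_sa l Y)
    have "?p'' t = Re (tr_inner M Y (hess (U + t *\<^sub>R Y) Y - K *\<^sub>R Y)) + K * (L2 Y)\<^sup>2"
      using h Yt by (simp add: tr_inner_simps tuples_intros L2_squared)
    moreover have "\<bar>Re (tr_inner M Y (hess (U + t *\<^sub>R Y) Y - K *\<^sub>R Y))\<bar> \<le> L2 Y * L2 (hess (U + t *\<^sub>R Y) Y - K *\<^sub>R Y)"
      by (intro Re_tr_inner_le tuples_intros h Yt)
    moreover have "L2 Y * L2 (hess (U + t *\<^sub>R Y) Y - K *\<^sub>R Y) \<le> L2 Y * (c * L2 Y)"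
      by (intro mult_left_mono hess_bound l Y L2_nonneg Yt)
    moreover have "L2 Y * (c * L2 Y) \<le> K * (L2 Y)\<^sup>2"
      using mult_right_mono[of c K "(L2 Y)\<^sup>2"] c by (simp add: power2_eq_square mult_ac)
    ultimately show ?thesis by linarith
  qed
  obtain s where s: "0 < s" "?p 1 - ?p 0 = (1 - 0) * ?p' s"
    using MVT2[of 0 1 ?p ?p'] d1 by auto
  obtain z where z: "?p' s - ?p' 0 = (s - 0) * ?p'' z"
    using MVT2[of 0 s ?p' ?p''] d2 s(1) by blast
  have "0 \<le> (s - 0) * ?p'' z" using s(1) pos by simp
  with s(2) z have "?p 0 + ?p' 0 \<le> ?p 1" by simp
  then show ?thesis by (simp add: Y_def)
qed

text \<open>The mean value theorem is available for scalars only, so the map G is tested along the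
  segment against its own increment Z = G U - G V. This yields L2(Z)^2 = <Z, Y - Hess Y / K> at an
  intermediate point, and Y - Hess Y / K = - (Hess Y - K Y) / K.\<close>

lemma gradient_step_contraction:
  assumes U: "U \<in> sa_tuples M" and V: "V \<in> sa_tuples M"
  shows "L2 ((U - (1 / K) *\<^sub>R nabla \<phi> M U) - (V - (1 / K) *\<^sub>R nabla \<phi> M V)) \<le> (c / K) * L2 (U - V)"
proof -
  define Y where "Y = U - V"
  define G where "G X = X - (1 / K) *\<^sub>R nabla \<phi> M X" for X
  define Z where "Z = G U - G V"
  have Y: "Y \<in> sa_tuples M" unfolding Y_def by (intro sa_tuples_intros U V)
  have l: "V + t *\<^sub>R Y \<in> sa_tuples M" for t by (rule line_sa[OF V Y])
  have Gsa: "G X \<in> sa_tuples M" if "X \<in> sa_tuples M" for X unfolding G_def by (intro sa_tuples_intros nabla_sa that)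
  have Z: "Z \<in> sa_tuples M" unfolding Z_def by (intro sa_tuples_intros Gsa U V)
  let ?D = "\<lambda>t. Y - (1 / K) *\<^sub>R hess (V + t *\<^sub>R Y) Y"
  have D: "?D t \<in> tuples M" for t by (intro sa_tuples_tuples sa_tuples_intros hess_sa l Y)
  have dG: "has_dir_deriv G X Y (Y - (1 / K) *\<^sub>R hess X Y)" if X: "X \<in> sa_tuples M" for X
  proof -
    have "((\<lambda>t. Y - (1 / K) *\<^sub>R ((nabla \<phi> M (X + t *\<^sub>R Y) - nabla \<phi> M X) /\<^sub>R t)) \<longlongrightarrow> Y - (1 / K) *\<^sub>R hess X Y) (at 0)"
      using hess_deriv[OF X Y] unfolding has_dir_deriv_def by (intro tendsto_intros)
    then show ?thesis
      unfolding has_dir_deriv_def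
    proof (rule Lim_transform_eventually)
      show "\<forall>\<^sub>F t in at 0. Y - (1 / K) *\<^sub>R ((nabla \<phi> M (X + t *\<^sub>R Y) - nabla \<phi> M X) /\<^sub>R t) = (G (X + t *\<^sub>R Y) - G X) /\<^sub>R t"
        unfolding eventually_at_filter
      proof (intro always_eventually allI impI)
        fix t :: real assume "t \<noteq> 0"
        have "G (X + t *\<^sub>R Y) - G X = t *\<^sub>R Y - (1 / K) *\<^sub>R (nabla \<phi> M (X + t *\<^sub>R Y) - nabla \<phi> M X)"
          by (simp add: G_def scaleR_diff_right)
        then show "Y - (1 / K) *\<^sub>R ((nabla \<phi> M (X + t *\<^sub>R Y) - nabla \<phi> M X) /\<^sub>R t) = (G (X + t *\<^sub>R Y) - G X) /\<^sub>R t"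
          using \<open>t \<noteq> 0\<close> by (simp add: scaleR_diff_right mult.commute)
      qed
    qed
  qed
  let ?f = "\<lambda>t. Re (tr_inner M Z (G (V + t *\<^sub>R Y)))"
  have "has_dir_deriv (\<lambda>X. tr_inner M Z (G X)) (V + t *\<^sub>R Y) Y (tr_inner M Z (?D t))" for t
    by (intro has_dir_deriv_tr_inner dG l D sa_tuples_tuples Gsa Z line_sa Y)
  then have "(?f has_real_derivative Re (tr_inner M Z (?D t))) (at t)" for t by (rule dir_deriv_DERIV)
  then obtain s where "?f 1 - ?f 0 = (1 - 0) * Re (tr_inner M Z (?D s))"
    using MVT2[of 0 1 ?f "\<lambda>t. Re (tr_inner M Z (?D t))"] by auto
  moreover have "?f 1 - ?f 0 = (L2 Z)\<^sup>2"
  proof -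
    have "V + 1 *\<^sub>R Y = U" by (simp add: Y_def)
    then have "?f 1 - ?f 0 = Re (tr_inner M Z (G U) - tr_inner M Z (G V))" by simp
    also have "tr_inner M Z (G U) - tr_inner M Z (G V) = tr_inner M Z Z"
      unfolding Z_def by (rule tr_inner_simps(3)[symmetric]) (intro sa_tuples_tuples sa_tuples_intros Gsa U V)+
    finally show ?thesis by (simp add: L2_squared sa_tuples_tuples[OF Z])
  qed
  ultimately have "(L2 Z)\<^sup>2 = Re (tr_inner M Z (?D s))" by simp
  also have "\<dots> \<le> L2 Z * L2 (?D s)"
    using Re_tr_inner_le[OF sa_tuples_tuples[OF Z] D[of s]] by linarith
  also have "?D s = (- (1 / K)) *\<^sub>R (hess (V + s *\<^sub>R Y) Y - K *\<^sub>R Y)"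
    using K by (simp add: scaleR_diff_right)
  also have "L2 \<dots> = (1 / K) * L2 (hess (V + s *\<^sub>R Y) Y - K *\<^sub>R Y)"
    using K by (subst L2_scaleR) (auto intro!: sa_tuples_tuples sa_tuples_intros hess_sa l Y)
  also have "L2 Z * \<dots> \<le> L2 Z * ((1 / K) * (c * L2 Y))"
    using K by (intro mult_left_mono hess_bound l Y L2_nonneg sa_tuples_tuples Z) auto
  finally have "L2 Z * L2 Z \<le> L2 Z * ((c / K) * L2 Y)" by (simp add: power2_eq_square)
  moreover have "0 \<le> (c / K) * L2 Y" using c K L2_nonneg[OF sa_tuples_tuples[OF Y]] by simp
  ultimately have "L2 Z \<le> (c / K) * L2 Y"
  proof (cases "L2 Z = 0")
    case False
    then have "0 < L2 Z" using L2_nonneg[OF sa_tuples_tuples[OF Z]] by simp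
    then show ?thesis if "L2 Z * L2 Z \<le> L2 Z * ((c / K) * L2 Y)" using that by (rule mult_left_le_imp_le[rotated])
  qed simp
  then show ?thesis by (simp add: Z_def G_def Y_def)
qed

end

section \<open>Invariance under equality of laws\<close>

lemma (in potential) at: "M \<in> W \<Longrightarrow> potential_at W \<phi> F M"
  by (intro potential_at.intro potential_at_axioms.intro potential_axioms bspec[OF W])

text \<open>One choice of H serves all algebras of W at once; this uniformity is what makes the
  gradient depend on laws only.\<close>

lemma (in potential) nabla_approx:
  assumes R: "0 < R" "0 < \<epsilon>"
  shows "\<exists>H :: 'n \<Rightarrow> 'n letter trace_sum. (\<forall>i. trace_sum_letters (H i) \<subseteq> range XV) \<and>
    (\<forall>M\<in>W. \<forall>X\<in>sa_tuples M. Lp_norm M \<infinity> X \<le> R \<longrightarrow>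
      (\<forall>j. norm (nabla \<phi> M X $ j - trace_sum_eval M (letter_eval X [0]) (H j)) \<le> 2 * \<epsilon>))"
proof -
  from scalar_approx_1[OF W C1 R] obtain H :: "'n \<Rightarrow> 'n letter trace_sum" where
    HH: "(\<forall>i. trace_sum_letters (H i) \<subseteq> range XV) \<and>
    (\<forall>M\<in>W. \<forall>X\<in>sa_tuples M. \<forall>Y\<in>sa_tuples M. Lp_norm M \<infinity> X \<le> R \<longrightarrow>
      (Lp_norm M 1 Y \<le> 1 \<or> Lp_norm M \<infinity> Y \<le> 1) \<longrightarrow>
      cmod (snd M (F 1 M X [Y] $ 1) - tr_inner M Y (\<chi> i. trace_sum_eval M (letter_eval X [0]) (H i))) < \<epsilon>)" ..
  note Hl = conjunct1[OF HH, rule_format] and Hb = conjunct2[OF HH, rule_format]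
  have "norm (nabla \<phi> M X $ j - trace_sum_eval M (letter_eval X [0]) (H j)) \<le> 2 * \<epsilon>"
    if M: "M \<in> W" and X: "X \<in> sa_tuples M" "Lp_norm M \<infinity> X \<le> R" for M X j
  proof -
    interpret potential_at W \<phi> F M by (rule at[OF M])
    let ?h = "\<chi> i. trace_sum_eval M (letter_eval X [0]) (H i)"
    have "norm (nabla \<phi> M X $ j - ?h $ j) \<le> 2 * \<epsilon>"
    proof (rule gradient_approx_error[OF X(1) nabla_is_gradient[OF X(1)]])
      show "?h \<in> tuples M" by (rule XV_sum_tuples[OF X(1) Hl])
      fix Y :: "bop ^ 'n" assume "Y \<in> sa_tuples M" "Lp_norm M 1 Y \<le> 1"
      then show "cmod (snd M (F 1 M X [Y] $ 1) - tr_inner M Y ?h) \<le> \<epsilon>"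
        by (intro less_imp_le Hb M X) auto
    qed (use R in simp)
    then show ?thesis by simp
  qed
  with Hl show ?thesis by (intro exI[of _ H] conjI ballI allI impI)
qed

locale potential_same_law = potential W \<phi> F + same_law M N a b
  for W and \<phi> :: "'n::finite scalar_family" and F M N and a b :: "'v \<Rightarrow> bop" +
  assumes MW: "M \<in> W" and NW: "N \<in> W"
begin

lemma law_pairs_limit:
  assumes "\<And>n. \<exists>s t. (s, t) \<in> law_pairs a b \<and> norm (S - s) \<le> inverse (real (Suc n)) \<and> norm (T - t) \<le> inverse (real (Suc n))"
  shows "(S, T) \<in> law_pairs a b"
proof -
  obtain s t where st: "\<And>n. (s n, t n) \<in> law_pairs a b"
    "\<And>n. norm (S - s n) \<le> inverse (real (Suc n))" "\<And>n. norm (T - t n) \<le> inverse (real (Suc n))"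
    using assms by metis
  have lim: "r \<longlonglongrightarrow> B" if "\<And>n. norm (B - r n) \<le> inverse (real (Suc n))" for r and B :: bop
  proof -
    have "(\<lambda>n. r n - B) \<longlonglongrightarrow> 0"
      by (rule Lim_null_comparison[OF _ LIMSEQ_inverse_real_of_nat])
        (use that in \<open>simp add: norm_minus_commute\<close>)
    then show ?thesis by (rule LIM_zero_cancel)
  qed
  show ?thesis
    by (rule closed_sequentially[OF law_pairs_closed, of "\<lambda>n. (s n, t n)"])
      (auto intro!: tendsto_Pair lim st)
qed

text \<open>The same trace sum approximates the gradient (or \<phi>) in both algebras, its two
  values form a law pair, and the set of law pairs is closed. X and X' need not be the generators a
  and b: the lemma is also applied to iterates built from them.\<close>

lemma
  assumes X: "X \<in> sa_tuples M" and X': "X' \<in> sa_tuples N" and pairs: "\<And>i. (X $ i, X' $ i) \<in> law_pairs a b"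
  shows nabla_law_pairs: "(nabla \<phi> M X $ j, nabla \<phi> N X' $ j) \<in> law_pairs a b"
    and phi_eq: "\<phi> M X = \<phi> N X'"
proof -
  define R where "R = max 1 (max (Lp_norm M \<infinity> X) (Lp_norm N \<infinity> X'))"
  have R: "0 < R" "Lp_norm M \<infinity> X \<le> R" "Lp_norm N \<infinity> X' \<le> R" by (auto simp: R_def)
  show "(nabla \<phi> M X $ j, nabla \<phi> N X' $ j) \<in> law_pairs a b"
  proof (rule law_pairs_limit)
    fix n
    define e where "e = inverse (real (Suc n)) / 2"
    have e: "0 < e" "2 * e = inverse (real (Suc n))" by (auto simp: e_def)
    from nabla_approx[OF R(1) e(1)] obtain H :: "'n \<Rightarrow> 'n letter trace_sum" where
      HH: "(\<forall>i. trace_sum_letters (H i) \<subseteq> range XV) \<and>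
      (\<forall>M\<in>W. \<forall>X\<in>sa_tuples M. Lp_norm M \<infinity> X \<le> R \<longrightarrow>
      (\<forall>j. norm (nabla \<phi> M X $ j - trace_sum_eval M (letter_eval X [0]) (H j)) \<le> 2 * e))" ..
    note Hl = conjunct1[OF HH, rule_format] and Hb = conjunct2[OF HH, rule_format]
    have "(trace_sum_eval M (letter_eval X [0]) (H j), trace_sum_eval N (letter_eval X' [0]) (H j)) \<in> law_pairs a b"
      by (rule law_pairs_trace_sum) (use Hl[of j] pairs in auto)
    then show "\<exists>s t. (s, t) \<in> law_pairs a b \<and> norm (nabla \<phi> M X $ j - s) \<le> inverse (real (Suc n))
        \<and> norm (nabla \<phi> N X' $ j - t) \<le> inverse (real (Suc n))"
      using Hb[OF MW X R(2)] Hb[OF NW X' R(3)] unfolding e(2) by blast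
  qed
  have "(F 0 M X [] $ 1, F 0 N X' [] $ 1) \<in> law_pairs a b"
  proof (rule law_pairs_limit)
    fix n
    have "0 < inverse (real (Suc n))" by simp
    from scalar_approx_0[OF W C0 R(1) this] obtain L where
      HH: "multilinear_sum 0 L \<and> (\<forall>M\<in>W. \<forall>X\<in>sa_tuples M. Lp_norm M \<infinity> X \<le> R \<longrightarrow>
    norm (F 0 M X [] $ 1 - trace_sum_eval M (letter_eval X []) L) < inverse (real (Suc n)))" ..
    note Hl = conjunct1[OF HH] and Hb = conjunct2[OF HH, rule_format]
    have "(trace_sum_eval M (letter_eval X []) L, trace_sum_eval N (letter_eval X' []) L) \<in> law_pairs a b"
    proof (rule law_pairs_trace_sum)
      fix v assume v: "v \<in> trace_sum_letters L"
      show "(letter_eval X [] v, letter_eval X' [] v) \<in> law_pairs a b"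
      proof (cases v)
        case (YV j i)
        then show ?thesis using multilinear_sum_letters[OF Hl, of j i] v by simp
      qed (simp add: pairs)
    qed
    then show "\<exists>s t. (s, t) \<in> law_pairs a b \<and> norm (F 0 M X [] $ 1 - s) \<le> inverse (real (Suc n))
        \<and> norm (F 0 N X' [] $ 1 - t) \<le> inverse (real (Suc n))"
      using Hb[OF MW X R(2)] Hb[OF NW X' R(3)] less_imp_le by blast
  qed
  from law_pairs_tau[OF this] show "\<phi> M X = \<phi> N X'"
    by (simp add: F0 scalar_embed_def M.tau_scaleC N.tau_scaleC M.A_id N.A_id M.tau_id N.tau_id)
qed

lemma tr_inner_law_pairs:
  assumes "X \<in> sa_tuples M" "X' \<in> sa_tuples N" "\<And>i. (X $ i, X' $ i) \<in> law_pairs a b" "\<And>i. (Y $ i, Y' $ i) \<in> law_pairs a b"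
  shows "tr_inner M X Y = tr_inner N X' Y'"
  unfolding tr_inner_def
  by (intro sum.cong refl law_pairs_adj_oL_tau assms M.sa_adj N.sa_adj M.sa_tuples_nth N.sa_tuples_nth)

end

lemma nc_law_words:
  assumes "nc_law M X = nc_law N X'"
  shows "snd M (word_eval (\<lambda>i. X $ i) w) = snd N (word_eval (\<lambda>i. X' $ i) w)"
proof -
  have "ncp_eval (Poly_Mapping.single w 1) X = word_eval (\<lambda>i. X $ i) w" for X :: "bop ^ 'a"
    by (simp add: ncp_eval_def lookup_single scaleC_op_simps)
  then show ?thesis using fun_cong[OF assms, of "Poly_Mapping.single w 1"] by (simp add: nc_law_def)
qed

lemma nc_law_eqI:
  assumes M: "tracial_algebra M" and N: "tracial_algebra N"
    and X: "X \<in> tuples M" and X': "X' \<in> tuples N"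
    and eq: "\<And>w. snd M (word_eval (\<lambda>i. X $ i) w) = snd N (word_eval (\<lambda>i. X' $ i) w)"
  shows "nc_law M X = nc_law N X'"
proof
  fix p
  interpret M: tracial_algebra M by (rule M)
  interpret N: tracial_algebra N by (rule N)
  have "word_eval (\<lambda>i. X $ i) w \<in> fst M" "word_eval (\<lambda>i. X' $ i) w \<in> fst N" for w
    by (auto intro!: M.word_eval_A N.word_eval_A simp: M.tuples_nth[OF X] N.tuples_nth[OF X'])
  then show "nc_law M X p = nc_law N X' p"
    by (simp add: nc_law_def ncp_eval_def M.tau_sum N.tau_sum M.tau_scaleC N.tau_scaleC M.A_scaleC N.A_scaleC eq)
qed

lemma same_law_tuples:
  assumes "tracial_algebra M" "tracial_algebra N" "X \<in> sa_tuples M" "X' \<in> sa_tuples N" "nc_law M X = nc_law N X'"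
  shows "same_law M N (\<lambda>i. X $ i) (\<lambda>i. X' $ i)"
proof -
  interpret M: tracial_algebra M by (rule assms)
  interpret N: tracial_algebra N by (rule assms)
  show ?thesis
    by unfold_locales
      (use assms nc_law_words M.sa_A M.sa_tuples_nth N.sa_A N.sa_tuples_nth in blast)+
qed

section \<open>The coupling inequality\<close>

text \<open>The fixed point iteration for the equation \<open>g(U) = Z\<close>.\<close>

primrec grad_iter :: "real \<Rightarrow> (bop ^ 'n \<Rightarrow> bop ^ 'n) \<Rightarrow> bop ^ 'n \<Rightarrow> nat \<Rightarrow> bop ^ 'n" where
  "grad_iter K g Z 0 = 0"
| "grad_iter K g Z (Suc n) = grad_iter K g Z n + (1 / K) *\<^sub>R (Z - g (grad_iter K g Z n))"

context convex_potential_at begin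

lemma grad_iter_sa: "Z \<in> sa_tuples M \<Longrightarrow> grad_iter K (nabla \<phi> M) Z n \<in> sa_tuples M"
  by (induction n) (auto intro!: sa_tuples_intros nabla_sa)

text \<open>X is a fixed point of the iteration map for the right-hand side grad \<phi>(X), and the
  start 0 is at distance L2 X from it.\<close>

lemma grad_iter_converges:
  assumes X: "X \<in> sa_tuples M"
  shows "L2 (grad_iter K (nabla \<phi> M) (nabla \<phi> M X) n - X) \<le> (c / K) ^ n * L2 X"
proof (induction n)
  case 0
  show ?case using L2_scaleR[OF sa_tuples_tuples[OF X], of "-1"] by simp
next
  case (Suc n)
  let ?U = "grad_iter K (nabla \<phi> M) (nabla \<phi> M X) n"
  have U: "?U \<in> sa_tuples M" by (intro grad_iter_sa nabla_sa X)
  have e: "grad_iter K (nabla \<phi> M) (nabla \<phi> M X) (Suc n) - X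
      = (?U - (1 / K) *\<^sub>R nabla \<phi> M ?U) - (X - (1 / K) *\<^sub>R nabla \<phi> M X)"
    by (simp add: scaleR_diff_right)
  have "L2 (grad_iter K (nabla \<phi> M) (nabla \<phi> M X) (Suc n) - X) \<le> (c / K) * L2 (?U - X)"
    unfolding e by (rule gradient_step_contraction[OF U X])
  also have "\<dots> \<le> (c / K) * ((c / K) ^ n * L2 X)"
    using c K by (intro mult_left_mono Suc.IH) simp
  finally show ?case by simp
qed

end

context convex_potential begin

lemma convex_at: "M \<in> W \<Longrightarrow> convex_potential_at W \<phi> F K c M"
  by (intro convex_potential_at.intro convex_potential_axioms at)

lemma same_law_at:
  assumes "M \<in> W" "N \<in> W" "X \<in> sa_tuples M" "X' \<in> sa_tuples N" "nc_law M X = nc_law N X'"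
  shows "potential_same_law W \<phi> F M N (\<lambda>i. X $ i) (\<lambda>i. X' $ i)"
  using assms W by (intro potential_same_law.intro potential_same_law_axioms.intro potential_axioms same_law_tuples) auto

text \<open>
  If \<open>Y'\<close> has the law of \<open>Z = \<nabla>\<phi>(X)\<close>, the iterations \<open>U\<close> and \<open>U'\<close> for \<open>Z\<close> and \<open>Y'\<close> have the same law, and \<open>U\<close>
  converges to \<open>X\<close>; so \<open>Y'\<close> is asymptotically the gradient at \<open>U'\<close>, and the inequality follows from the convexity
  inequalities between \<open>U'\<close> and \<open>X'\<close> and between \<open>X\<close> and \<open>U\<close>.
\<close>

lemma coupling_inequality:
  assumes M: "M \<in> W" and N: "N \<in> W" and X: "X \<in> sa_tuples M" and X': "X' \<in> sa_tuples N" and Y': "Y' \<in> sa_tuples N"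
    and lX: "nc_law M X = nc_law N X'" and lY: "nc_law M (nabla \<phi> M X) = nc_law N Y'"
  shows "Re (tr_inner N X' Y') \<le> Re (tr_inner M X (nabla \<phi> M X))"
proof -
  interpret A: convex_potential_at W \<phi> F K c M by (rule convex_at[OF M])
  interpret B: convex_potential_at W \<phi> F K c N by (rule convex_at[OF N])
  define Z where "Z = nabla \<phi> M X"
  have Z: "Z \<in> sa_tuples M" unfolding Z_def by (rule A.nabla_sa[OF X])
  \<comment> \<open>X corresponds to X' and Z to Y', but no joint correspondence of (X, Z) with (X',
    Y') is available. P transports \<phi> at X, S everything built from Z alone, such as the
    iterates.\<close>
  interpret P: potential_same_law W \<phi> F M N "\<lambda>i. X $ i" "\<lambda>i. X' $ i"
    by (rule same_law_at[OF M N X X' lX])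
  interpret S: potential_same_law W \<phi> F M N "\<lambda>i. Z $ i" "\<lambda>i. Y' $ i"
    by (rule same_law_at[OF M N Z Y']) (simp add: Z_def lY)
  define U where "U n = grad_iter K (nabla \<phi> M) Z n" for n
  define U' where "U' n = grad_iter K (nabla \<phi> N) Y' n" for n
  have U: "U n \<in> sa_tuples M" and U': "U' n \<in> sa_tuples N" for n
    unfolding U_def U'_def by (intro A.grad_iter_sa B.grad_iter_sa Z Y')+
  note At = A.sa_tuples_tuples and Bt = B.sa_tuples_tuples
  have pairs: "\<forall>i. (U n $ i, U' n $ i) \<in> law_pairs (\<lambda>i. Z $ i) (\<lambda>i. Y' $ i)" for n
  proof (induction n)
    case 0
    show ?case by (simp add: U_def U'_def S.law_pairs_zero)
  next
    case (Suc n)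
    have "(nabla \<phi> M (U n) $ i, nabla \<phi> N (U' n) $ i) \<in> law_pairs (\<lambda>i. Z $ i) (\<lambda>i. Y' $ i)" for i
      using Suc by (intro S.nabla_law_pairs U U') auto
    with Suc show ?case
      using S.law_pairs_base unfolding U_def U'_def
      by (auto intro!: S.law_pairs_add S.law_pairs_scaleR S.law_pairs_diff)
  qed
  define q where "q = c / K"
  have q: "0 \<le> q" "q < 1" using c K by (auto simp: q_def)
  define x where "x = A.L2 X"
  \<comment> \<open>Collects the bounds L2(U n) \<le> 2 x and L2(D) \<le> 2 x q^n for the error K
    (<X', D'> - <U n, D>).\<close>
  define C where "C = K * (B.L2 X' + 2 * x) * (2 * x)"
  have x0: "0 \<le> x" unfolding x_def by (intro A.L2_nonneg At X)
  have x'0: "0 \<le> B.L2 X'" by (intro B.L2_nonneg Bt X')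
  have conv: "A.L2 (U n - X) \<le> q ^ n * x" for n
    using A.grad_iter_converges[OF X, of n] by (simp add: U_def Z_def q_def x_def)
  have main: "Re (tr_inner N X' Y') \<le> Re (tr_inner M X Z) + C * q ^ n" for n
  proof -
    \<comment> \<open>D and D' are the residuals Z - grad \<phi>(U n) and Y' - grad \<phi>(U' n)
      divided by K, so replacing these gradients by Z and Y' costs K times an inner product with D
      or D'.\<close>
    define D where "D = U (Suc n) - U n"
    define D' where "D' = U' (Suc n) - U' n"
    have D: "D \<in> sa_tuples M" and D': "D' \<in> sa_tuples N"
      unfolding D_def D'_def by (intro A.sa_tuples_intros B.sa_tuples_intros U U')+
    have gU: "nabla \<phi> M (U n) = Z - K *\<^sub>R D" and gU': "nabla \<phi> N (U' n) = Y' - K *\<^sub>R D'"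
      using K by (simp_all add: D_def D'_def U_def U'_def)
    have "\<phi> M X = \<phi> N X'" by (intro P.phi_eq X X' P.law_pairs_base)
    moreover have "\<phi> M (U n) = \<phi> N (U' n)" using pairs[of n] by (intro S.phi_eq U U') auto
    moreover have "Re (tr_inner M (U n) (nabla \<phi> M (U n))) = Re (tr_inner N (U' n) (nabla \<phi> N (U' n)))"
      using pairs[of n] by (intro arg_cong[of _ _ Re] S.tr_inner_law_pairs S.nabla_law_pairs U U') auto
    moreover have "Re (\<phi> N (U' n)) + Re (tr_inner N (X' - U' n) (nabla \<phi> N (U' n))) \<le> Re (\<phi> N X')"
      by (rule B.gradient_inequality[OF U' X'])
    moreover have "Re (tr_inner N (X' - U' n) (nabla \<phi> N (U' n)))
        = Re (tr_inner N X' Y') - K * Re (tr_inner N X' D') - Re (tr_inner N (U' n) (nabla \<phi> N (U' n)))"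
      unfolding B.tr_inner_simps(4)[OF Bt[OF X'] Bt[OF U'] Bt[OF B.nabla_sa[OF U']]]
      unfolding gU' using B.tr_inner_simps(5)[OF Bt[OF X'] Bt[OF D'] Bt[OF X'], of K]
      by (simp add: B.tr_inner_simps B.tuples_intros Bt X' Y' D')
    moreover have "Re (\<phi> M X) + Re (tr_inner M (U n - X) Z) \<le> Re (\<phi> M (U n))"
      unfolding Z_def by (rule A.gradient_inequality[OF X U])
    moreover have "Re (tr_inner M (U n - X) Z) = Re (tr_inner M (U n) Z) - Re (tr_inner M X Z)"
      by (simp add: A.tr_inner_simps At U X Z)
    moreover have "Re (tr_inner M (U n) (nabla \<phi> M (U n))) = Re (tr_inner M (U n) Z) - K * Re (tr_inner M (U n) D)"
      unfolding gU using A.tr_inner_simps(5)[OF At[OF U] At[OF D] At[OF X], of n K]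
      by (simp add: A.tr_inner_simps A.tuples_intros At U Z D)
    \<comment> \<open>Sum of the two convexity inequalities: the values of \<phi> cancel, since they
      agree at X and X' and at U n and U' n, and so do the terms <U n, Z>.\<close>
    ultimately have *: "Re (tr_inner N X' Y') \<le> Re (tr_inner M X Z) + K * Re (tr_inner N X' D') - K * Re (tr_inner M (U n) D)"
      by simp
    have qn: "q ^ n \<le> 1" "0 \<le> q ^ n" "q ^ Suc n \<le> q ^ n" using q by (auto simp: power_le_one mult_left_le_one_le)
    have LD: "A.L2 D \<le> 2 * x * q ^ n"
    proof -
      have "A.L2 D = A.L2 ((U (Suc n) - X) - (U n - X))" by (simp add: D_def)
      also have "\<dots> \<le> A.L2 (U (Suc n) - X) + A.L2 (U n - X)"
        by (intro A.L2_triangle_diff At A.sa_tuples_intros U X)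
      also have "\<dots> \<le> q ^ Suc n * x + q ^ n * x" by (intro add_mono conv)
      also have "\<dots> \<le> q ^ n * x + q ^ n * x" using qn x0 by (intro add_mono mult_right_mono) auto
      finally show ?thesis by (simp add: mult_ac)
    qed
    have LU: "A.L2 (U n) \<le> 2 * x"
    proof -
      have "A.L2 (U n) = A.L2 ((U n - X) - (-1) *\<^sub>R X)" by simp
      also have "\<dots> \<le> A.L2 (U n - X) + A.L2 ((-1) *\<^sub>R X)"
        by (intro A.L2_triangle_diff At A.sa_tuples_intros U X)
      also have "\<dots> \<le> q ^ n * x + x" 
        using conv[of n] A.L2_scaleR[OF At[OF X], of "-1"] by (simp add: x_def)
      also have "\<dots> \<le> 1 * x + x" using qn x0 by (intro add_mono mult_right_mono) auto
      finally show ?thesis by simp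
    qed
    have D0: "0 \<le> A.L2 D" by (intro A.L2_nonneg At D)
    \<comment> \<open>In N no limit of the iterates is at hand; that D' is small is carried over
      from D by equality of laws.\<close>
    have "B.L2 D' = A.L2 D"
    proof -
      have "tr_inner M D D = tr_inner N D' D'"
        using pairs unfolding D_def D'_def
        by (intro S.tr_inner_law_pairs A.sa_tuples_intros B.sa_tuples_intros U U')
          (auto intro!: S.law_pairs_diff)
      then show ?thesis by (simp add: A.L2_def B.L2_def)
    qed
    then have "Re (tr_inner N X' D') \<le> B.L2 X' * A.L2 D"
      using B.Re_tr_inner_le[OF Bt[OF X'] Bt[OF D']] by simp
    moreover have "- Re (tr_inner M (U n) D) \<le> 2 * x * A.L2 D"
      using A.Re_tr_inner_le[OF At[OF U] At[OF D], of n] mult_right_mono[OF LU D0] by linarith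
    ultimately have "Re (tr_inner N X' D') - Re (tr_inner M (U n) D) \<le> (B.L2 X' + 2 * x) * A.L2 D"
      by (simp add: distrib_right)
    also have "\<dots> \<le> (B.L2 X' + 2 * x) * (2 * x * q ^ n)"
      using LD x0 x'0 by (intro mult_left_mono) auto
    finally have "K * (Re (tr_inner N X' D') - Re (tr_inner M (U n) D)) \<le> K * ((B.L2 X' + 2 * x) * (2 * x * q ^ n))"
      using K by (intro mult_left_mono) auto
    then have "K * Re (tr_inner N X' D') - K * Re (tr_inner M (U n) D) \<le> C * q ^ n"
      by (simp add: C_def algebra_simps)
    with * show ?thesis by linarith
  qed
  have "(\<lambda>n. Re (tr_inner M X Z) + C * q ^ n) \<longlonglongrightarrow> Re (tr_inner M X Z) + C * 0"
    by (intro tendsto_intros LIMSEQ_realpow_zero q)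
  from LIMSEQ_le_const[OF this] main have "Re (tr_inner N X' Y') \<le> Re (tr_inner M X Z) + C * 0" by blast
  then show ?thesis by (simp add: Z_def)
qed

text \<open>Gives the \<open>THE\<close> in \<open>push_law\<close> and in \<open>law_eval\<close>
  their meaning for the functions that occur in the theorem.\<close>

lemma law_invariance:
  assumes M: "M \<in> W" and N: "N \<in> W" and X: "X \<in> sa_tuples M" and X': "X' \<in> sa_tuples N"
    and lX: "nc_law M X = nc_law N X'"
  shows "nc_law M (nabla \<phi> M X) = nc_law N (nabla \<phi> N X')"
    and "tr_inner M (nabla \<phi> M X - X) (nabla \<phi> M X - X) = tr_inner N (nabla \<phi> N X' - X') (nabla \<phi> N X' - X')"
proof -
  interpret A: convex_potential_at W \<phi> F K c M by (rule convex_at[OF M])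
  interpret B: convex_potential_at W \<phi> F K c N by (rule convex_at[OF N])
  interpret P: potential_same_law W \<phi> F M N "\<lambda>i. X $ i" "\<lambda>i. X' $ i"
    by (rule same_law_at[OF M N X X' lX])
  have g: "(nabla \<phi> M X $ j, nabla \<phi> N X' $ j) \<in> law_pairs (\<lambda>i. X $ i) (\<lambda>i. X' $ i)" for j
    by (intro P.nabla_law_pairs X X' P.law_pairs_base)
  show "nc_law M (nabla \<phi> M X) = nc_law N (nabla \<phi> N X')"
    by (intro nc_law_eqI A.tracial_algebra_axioms B.tracial_algebra_axioms A.sa_tuples_tuples B.sa_tuples_tuples
        A.nabla_sa B.nabla_sa X X' P.law_pairs_tau P.law_pairs_word_eval g)
  have "((nabla \<phi> M X - X) $ j, (nabla \<phi> N X' - X') $ j) \<in> law_pairs (\<lambda>i. X $ i) (\<lambda>i. X' $ i)" for j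
    using g P.law_pairs_base by (simp add: P.law_pairs_diff)
  then show "tr_inner M (nabla \<phi> M X - X) (nabla \<phi> M X - X) = tr_inner N (nabla \<phi> N X' - X') (nabla \<phi> N X' - X')"
    by (intro P.tr_inner_law_pairs A.sa_tuples_intros B.sa_tuples_intros A.nabla_sa B.nabla_sa X X')
qed

lemma push_law_nabla:
  assumes M: "M \<in> W" and X: "X \<in> sa_tuples M"
  shows "push_law W (nabla \<phi>) (nc_law M X) = nc_law M (nabla \<phi> M X)"
  unfolding push_law_def
proof (rule the_equality)
  show "\<exists>N\<in>W. \<exists>X'\<in>sa_tuples N. nc_law N X' = nc_law M X \<and> nc_law M (nabla \<phi> M X) = nc_law N (nabla \<phi> N X')"
    using M X by blast
  fix \<nu> assume "\<exists>N\<in>W. \<exists>X'\<in>sa_tuples N. nc_law N X' = nc_law M X \<and> \<nu> = nc_law N (nabla \<phi> N X')"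
  then obtain N X' where N: "N \<in> W" "X' \<in> sa_tuples N" "nc_law N X' = nc_law M X" "\<nu> = nc_law N (nabla \<phi> N X')"
    by blast
  show "\<nu> = nc_law M (nabla \<phi> M X)" unfolding N(4) by (rule law_invariance(1)[OF N(1) M N(2) X N(3)])
qed

lemma law_eval_nabla:
  assumes M: "M \<in> W" and X: "X \<in> sa_tuples M"
  shows "law_eval W (nc_law M X) (\<lambda>M X. tr_inner M (nabla \<phi> M X - X) (nabla \<phi> M X - X))
    = tr_inner M (nabla \<phi> M X - X) (nabla \<phi> M X - X)"
  unfolding law_eval_def
proof (rule the_equality)
  show "\<exists>N\<in>W. \<exists>X'\<in>sa_tuples N. nc_law N X' = nc_law M X \<and>
    tr_inner M (nabla \<phi> M X - X) (nabla \<phi> M X - X) = tr_inner N (nabla \<phi> N X' - X') (nabla \<phi> N X' - X')"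
    using M X by blast
  fix z assume "\<exists>N\<in>W. \<exists>X'\<in>sa_tuples N. nc_law N X' = nc_law M X \<and> z = tr_inner N (nabla \<phi> N X' - X') (nabla \<phi> N X' - X')"
  then obtain N X' where N: "N \<in> W" "X' \<in> sa_tuples N" "nc_law N X' = nc_law M X"
    "z = tr_inner N (nabla \<phi> N X' - X') (nabla \<phi> N X' - X')" by blast
  show "z = tr_inner M (nabla \<phi> M X - X) (nabla \<phi> M X - X)"
    unfolding N(4) by (rule law_invariance(2)[OF N(1) M N(2) X N(3)])
qed

text \<open>The L2 norms of the two entries of a coupling are determined by their laws, so
  minimising the distance means maximising the inner product, which
  \<open>coupling_inequality\<close> bounds.\<close>

lemma d_W2_nabla:
  assumes M: "M \<in> W" and X: "X \<in> sa_tuples M"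
  shows "d_W2 W (nc_law M X) (nc_law M (nabla \<phi> M X)) = Lp_norm M 2 (X - nabla \<phi> M X)"
  unfolding d_W2_def
proof (rule cInf_eq_minimum)
  interpret A: convex_potential_at W \<phi> F K c M by (rule convex_at[OF M])
  let ?Z = "nabla \<phi> M X"
  have Z: "?Z \<in> sa_tuples M" by (rule A.nabla_sa[OF X])
  show "Lp_norm M 2 (X - ?Z) \<in> {Lp_norm N 2 (X' - Y') | N X' Y'. N \<in> W \<and> X' \<in> sa_tuples N \<and> Y' \<in> sa_tuples N \<and>
      nc_law N X' = nc_law M X \<and> nc_law N Y' = nc_law M ?Z}"
    using M X Z by blast
  fix r assume "r \<in> {Lp_norm N 2 (X' - Y') | N X' Y'. N \<in> W \<and> X' \<in> sa_tuples N \<and> Y' \<in> sa_tuples N \<and>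
      nc_law N X' = nc_law M X \<and> nc_law N Y' = nc_law M ?Z}"
  then obtain N X' Y' where r: "r = Lp_norm N 2 (X' - Y')" and N: "N \<in> W" and X': "X' \<in> sa_tuples N"
    and Y': "Y' \<in> sa_tuples N" and l: "nc_law N X' = nc_law M X" "nc_law N Y' = nc_law M ?Z" by blast
  interpret B: convex_potential_at W \<phi> F K c N by (rule convex_at[OF N])
  interpret P: potential_same_law W \<phi> F M N "\<lambda>i. X $ i" "\<lambda>i. X' $ i"
    by (rule same_law_at[OF M N X X' l(1)[symmetric]])
  interpret S: potential_same_law W \<phi> F M N "\<lambda>i. ?Z $ i" "\<lambda>i. Y' $ i"
    by (rule same_law_at[OF M N Z Y' l(2)[symmetric]])
  note At = A.sa_tuples_tuples and Bt = B.sa_tuples_tuples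
  have "tr_inner M X X = tr_inner N X' X'" "tr_inner M ?Z ?Z = tr_inner N Y' Y'"
    by (intro P.tr_inner_law_pairs S.tr_inner_law_pairs X X' Z Y' P.law_pairs_base S.law_pairs_base)+
  then have "(A.L2 (X - ?Z))\<^sup>2 \<le> (B.L2 (X' - Y'))\<^sup>2"
    using coupling_inequality[OF M N X X' Y' l[symmetric]]
    by (simp add: A.L2_diff_squared B.L2_diff_squared A.L2_squared B.L2_squared At Bt X X' Z Y')
  then have "A.L2 (X - ?Z) \<le> B.L2 (X' - Y')"
    by (rule power2_le_imp_le) (intro B.L2_nonneg Bt B.sa_tuples_intros X' Y')
  then show "Lp_norm M 2 (X - ?Z) \<le> r"
    unfolding r by (simp add: A.Lp_norm_2 B.Lp_norm_2 A.L2_def B.L2_def A.tuples_intros B.tuples_intros At Bt X X' Z Y')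
qed

end

theorem proposition9p8:
  fixes W :: "tracial set" and \<phi> :: "'n::finite scalar_family" and k :: nat and K :: real
  assumes "representatives W"
    and "k \<ge> 2"
    and "\<phi> \<in> tr_Ck_sa W k"
    and "K > 0"
    and "BC_norm W 1 (\<lambda>M X Ys. dir_deriv (nabla \<phi> M) X (Ys ! 0) - K *\<^sub>R (Ys ! 0)) < ennreal K"
  shows "(\<forall>\<mu>\<in>nc_laws W.
            complex_of_real (d_W2 W \<mu> (push_law W (nabla \<phi>) \<mu>))
              = csqrt (law_eval W \<mu> (\<lambda>M X. tr_inner M (nabla \<phi> M X - X) (nabla \<phi> M X - X)))) \<and>
         (\<forall>M\<in>W. \<forall>X\<in>sa_tuples M.
            optimal_coupling W M X (nabla \<phi> M X)
              (nc_law M X) (push_law W (nabla \<phi>) (nc_law M X)))"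
proof -
  let ?B = "BC_norm W 1 (\<lambda>M X Ys. dir_deriv (nabla \<phi> M) X (Ys ! 0) - K *\<^sub>R (Ys ! 0))"
  define c where "c = enn2real ?B"
  have "?B < top" using assms(5) by (rule order_less_trans) (rule ennreal_less_top)
  then have B: "?B = ennreal c" by (simp add: c_def)
  have c0: "0 \<le> c" by (simp add: c_def)
  have "ennreal c < ennreal K" using assms(5) unfolding B .
  with c0 have c: "0 \<le> c" "c < K" by (simp_all add: ennreal_less_iff)
  have "scalar_embed \<phi> \<in> Ck_tr W k 0" using assms(3) by (simp add: tr_Ck_sa_def)
  then obtain F :: "nat \<Rightarrow> ('n, 1) family" where FF: "F 0 = scalar_embed \<phi> \<and> (\<forall>j\<le>k. F j \<in> C_tr W (0 + j)) \<and>
     (\<forall>j<k. \<forall>M\<in>W. \<forall>X\<in>sa_tuples M. \<forall>Ys. \<forall>Y\<in>sa_tuples M.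
        length Ys = 0 + j \<longrightarrow> set Ys \<subseteq> sa_tuples M
        \<longrightarrow> has_dir_deriv (\<lambda>X. F j M X Ys) X Y (F (Suc j) M X (Ys @ [Y])))"
    unfolding Ck_tr_def mem_Collect_eq ..
  note F0 = conjunct1[OF FF] and FC = conjunct1[OF conjunct2[OF FF], rule_format, unfolded add_0]
    and FD = conjunct2[OF conjunct2[OF FF], rule_format]
  interpret convex_potential W \<phi> F K c
  proof
    show "\<forall>M\<in>W. tracial_algebra M"
      using assms(1) by (auto simp: representatives_def tracial_algebra_def)
    show "F 0 \<in> C_tr W 0" "F 1 \<in> C_tr W 1" "F 2 \<in> C_tr W 2"
      by (rule FC, use assms(2) in simp)+
    show "has_dir_deriv (\<lambda>X. F 0 M X []) X Y (F 1 M X [Y])"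
      if "M \<in> W" "X \<in> sa_tuples M" "Y \<in> sa_tuples M" for M X Y
      using FD[of 0 M X Y "[]"] that assms(2) by simp
    show "has_dir_deriv (\<lambda>X. F 1 M X [Y]) X Y' (F 2 M X [Y, Y'])"
      if "M \<in> W" "X \<in> sa_tuples M" "Y \<in> sa_tuples M" "Y' \<in> sa_tuples M" for M X Y Y'
      using FD[of 1 M X Y' "[Y]"] that assms(2) by (simp add: numeral_2_eq_2)
    show "\<phi> M X \<in> \<real>" if "M \<in> W" "X \<in> sa_tuples M" for M X
      using assms(3) that by (simp add: tr_Ck_sa_def)
  qed (use F0 B c assms(4) in auto)
  have opt: "optimal_coupling W M X (nabla \<phi> M X) (nc_law M X) (push_law W (nabla \<phi>) (nc_law M X))"
    if M: "M \<in> W" and X: "X \<in> sa_tuples M" for M X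
  proof -
    interpret A: convex_potential_at W \<phi> F K c M by (rule convex_at[OF M])
    show ?thesis
      unfolding optimal_coupling_def push_law_nabla[OF M X] d_W2_nabla[OF M X]
      using M X A.nabla_sa[OF X] by simp
  qed
  moreover have "complex_of_real (d_W2 W \<mu> (push_law W (nabla \<phi>) \<mu>))
      = csqrt (law_eval W \<mu> (\<lambda>M X. tr_inner M (nabla \<phi> M X - X) (nabla \<phi> M X - X)))" if \<mu>_law: "\<mu> \<in> nc_laws W" for \<mu>
  proof -
    obtain M X where \<mu>: "\<mu> = nc_law M X" and M: "M \<in> W" and X: "X \<in> sa_tuples M"
      using \<mu>_law unfolding nc_laws_def by blast
    interpret A: convex_potential_at W \<phi> F K c M by (rule convex_at[OF M])
    let ?Z = "nabla \<phi> M X"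
    have t: "X \<in> tuples M" "?Z \<in> tuples M" by (intro A.sa_tuples_tuples A.nabla_sa X)+
    have "Lp_norm M 2 (X - ?Z) = A.L2 (?Z - X)"
      using A.Lp_norm_2[OF A.tuples_intros(2)[OF t]] A.L2_minus_commute[OF t] by (simp add: A.L2_def)
    moreover have "csqrt (tr_inner M (?Z - X) (?Z - X)) = of_real (A.L2 (?Z - X))"
      using A.tr_inner_self[OF A.tuples_intros(2)[OF t(2,1)]] A.tr_inner_self_nonneg[OF A.tuples_intros(2)[OF t(2,1)]]
      unfolding A.L2_def by (metis csqrt_of_real)
    ultimately show ?thesis
      unfolding \<mu> push_law_nabla[OF M X] d_W2_nabla[OF M X] law_eval_nabla[OF M X] by simp
  qed
  ultimately show ?thesis by blast
qed

end
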